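(* Let $(M^3,\varphi,\xi,\eta,g)$ be a non-Kenmotsu almost Kenmotsu $3$-$h$-manifold such that the Reeb vector field $\xi$ is an eigenvector of the Ricci operator $Q$. Then there exists no Cotton soliton on $M^3$ with potential vector field $V$ pointwise collinear with the Reeb vector field $\xi$.
   Context: An almost contact metric manifold is an odd-dimensional differentiable manifold with a $(1,1)$-tensor field $\varphi$, a unit vector field $\xi$ (the Reeb vector field), a $1$-form $\eta$ and a Riemannian metric $g$ with $\eta(X)=g(X,\xi)$, $\varphi^2X=-X+\eta(X)\xi$, $\eta(\xi)=1$, $g(\varphi X,\varphi Y)=g(X,Y)-\eta(X)\eta(Y)$. Let $\Phi(X,Y)=g(X,\varphi Y)$. It is almost Kenmotsu if $d\eta=0$ and $d\Phi=2\eta\wedge\Phi$; it is Kenmotsu if moreover it is normal, i.e. $[\varphi,\varphi]+2d\eta\otimes\xi=0$, where $[\varphi,\varphi]$ is the Nijenhuis tensor of $\varphi$. Non-Kenmotsu means not Kenmotsu. Put $h=\frac12\mathcal{L}_\xi\varphi$; in dimension $3$ an almost Kenmotsu manifold is Kenmotsu if and only if $h=0$. An almost Kenmotsu $3$-$h$-manifold is a $3$-dimensional almost Kenmotsu manifold with $\nabla_\xi h=0$, where $\nabla$ is the Levi-Civita connection. $S$ is the Ricci tensor, $r$ the scalar curvature, and $Q$ the Ricci operator, $S(X,Y)=g(QX,Y)$. The $(0,3)$-Cotton tensor is $$C(X,Y,Z)=(\nabla_XS)(Y,Z)-(\nabla_YS)(X,Z)-\tfrac14[X(r)g(Y,Z)-Y(r)g(X,Z)].$$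 The $(0,2)$-Cotton tensor is given in a local orthonormal frame $\{e_1=\xi,e_2=e,e_3=\varphi e\}$ ($e$ a unit vector field orthogonal to $\xi$) by $C(e_i,e_j)=C_{ij}=\frac12\sum_{n,m}C_{nmi}\epsilon^{nmj}$, where $C_{nmi}=C(e_n,e_m,e_i)$ and $\epsilon$ is totally antisymmetric with $\epsilon^{123}=1$. A Cotton soliton on $M^3$ is a metric $g$ such that $(\mathcal{L}_Vg)(X,Y)+C(X,Y)-\sigma g(X,Y)=0$ for all vector fields $X,Y$, for some constant $\sigma$ and some vector field $V$, called the potential vector field; here $\mathcal{L}_V$ is the Lie derivative along $V$ and $C$ is the $(0,2)$-Cotton tensor of $g$. The potential vector field is pointwise collinear with $\xi$ if $V=\alpha\xi$ for a smooth function $\alpha$ on $M^3$.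
   Formalization: The potential vector field V is assumed not identically zero; with V = 0 allowed the claim fails, e.g. on H²(−4)×R, which is conformally flat, so C = 0 and V = 0, σ = 0 satisfies the Cotton soliton equation. *)

theory Defs
  imports "HOL-Analysis.Analysis" "HOL-Library.Function_Algebras"
begin

section \<open>Smooth 3-manifolds\<close>

text \<open>
  A 3-manifold is a type of sort \<open>{t2_space, second_countable_topology}\<close> with a smooth atlas
  modelled on \<open>real^3\<close>.  The sets in \<open>Ck_on\<close> are meant to be open.
\<close>

primrec Ck_on ::
    "nat \<Rightarrow> 'm::real_normed_vector set \<Rightarrow> ('m \<Rightarrow> 'n::real_normed_vector) \<Rightarrow> bool" where
  "Ck_on 0 S f \<longleftrightarrow> continuous_on S f"
| "Ck_on (Suc k) S f \<longleftrightarrow>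
     (\<forall>x\<in>S. f differentiable (at x)) \<and> (\<forall>v. Ck_on k S (\<lambda>x. frechet_derivative f (at x) v))"

definition smooth_on :: "'m::real_normed_vector set \<Rightarrow> ('m \<Rightarrow> 'n::real_normed_vector) \<Rightarrow> bool" where
  "smooth_on S f \<longleftrightarrow> (\<forall>k. Ck_on k S f)"

type_synonym 'a chart = "'a set \<times> ('a \<Rightarrow> real^3)"

definition smooth_atlas :: "'a::topological_space chart set \<Rightarrow> bool" where
  "smooth_atlas A \<longleftrightarrow>
     (\<forall>(U,c)\<in>A. open U \<and> open (c ` U) \<and> homeomorphism U (c ` U) c (inv_into U c)) \<and>
     (\<forall>p. \<exists>(U,c)\<in>A. p \<in> U) \<and>
     (\<forall>(U,c)\<in>A. \<forall>(W,d)\<in>A. smooth_on (c ` (U \<inter> W)) (d \<circ> inv_into U c))"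

definition smooth_fun :: "'a::topological_space chart set \<Rightarrow> 'a set \<Rightarrow> ('a \<Rightarrow> real) \<Rightarrow> bool" where
  "smooth_fun A W f \<longleftrightarrow>
     open W \<and> (\<forall>(U,c)\<in>A. smooth_on (c ` (U \<inter> W)) (f \<circ> inv_into U c))"

definition smooth_near :: "'a::topological_space chart set \<Rightarrow> 'a \<Rightarrow> ('a \<Rightarrow> real) \<Rightarrow> bool" where
  "smooth_near A p f \<longleftrightarrow> (\<exists>W. p \<in> W \<and> smooth_fun A W f)"

section \<open>Tangent vectors and vector fields\<close>

text \<open>
  A tangent vector at \<open>p\<close> acts on the real functions that are smooth near \<open>p\<close> as
  \<open>\<Sum>i. w\<^sub>i \<partial>/\<partial>x\<^sub>i\<close> in a chart; on all other functions it is \<open>0\<close> by convention, so that a tangent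
  vector is determined by its action on smooth germs.  Sums of tangent vectors and of vector
  fields are the pointwise ones of \<open>Function_Algebras\<close>.
\<close>

type_synonym 'a tvec = "('a \<Rightarrow> real) \<Rightarrow> real"
type_synonym 'a vfield = "'a \<Rightarrow> 'a tvec"

definition tangent_space :: "'a::topological_space chart set \<Rightarrow> 'a \<Rightarrow> 'a tvec set" where
  "tangent_space A p =
     {v. \<exists>(U,c)\<in>A. p \<in> U \<and> (\<exists>w. \<forall>f. v f =
        (if smooth_near A p f then frechet_derivative (f \<circ> inv_into U c) (at (c p)) w else 0))}"

definition scale_vec :: "real \<Rightarrow> 'a tvec \<Rightarrow> 'a tvec" (infixr "*\<^sub>v" 75) where
  "a *\<^sub>v v = (\<lambda>f. a * v f)"

definition scale_field :: "('a \<Rightarrow> real) \<Rightarrow> 'a vfield \<Rightarrow> 'a vfield" (infixr "*\<^sub>F" 75) where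
  "f *\<^sub>F X = (\<lambda>p. f p *\<^sub>v X p)"

text \<open>
  Fields are total functions that are only required to be smooth vector fields on the open set
  \<open>U\<close>; tensorial identities below are required for all such local fields.
\<close>

definition vector_field :: "'a::topological_space chart set \<Rightarrow> 'a set \<Rightarrow> 'a vfield \<Rightarrow> bool" where
  "vector_field A U X \<longleftrightarrow>
     open U \<and> (\<forall>p\<in>U. X p \<in> tangent_space A p) \<and>
     (\<forall>W f. W \<subseteq> U \<and> smooth_fun A W f \<longrightarrow> smooth_fun A W (\<lambda>p. X p f))"

definition lie_bracket :: "'a::topological_space chart set \<Rightarrow> 'a vfield \<Rightarrow> 'a vfield \<Rightarrow> 'a vfield" where
  "lie_bracket A X Y = (\<lambda>p f.
     if smooth_near A p f then X p (\<lambda>q. Y q f) - Y p (\<lambda>q. X q f) else 0)"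

section \<open>Tensor fields\<close>

definition ap1 :: "('a \<Rightarrow> 'a tvec \<Rightarrow> 'r) \<Rightarrow> 'a vfield \<Rightarrow> 'a \<Rightarrow> 'r" where
  "ap1 T X = (\<lambda>p. T p (X p))"

definition ap2 :: "('a \<Rightarrow> 'a tvec \<Rightarrow> 'a tvec \<Rightarrow> 'r) \<Rightarrow> 'a vfield \<Rightarrow> 'a vfield \<Rightarrow> 'a \<Rightarrow> 'r" where
  "ap2 T X Y = (\<lambda>p. T p (X p) (Y p))"

definition linear_form_on :: "'a tvec set \<Rightarrow> ('a tvec \<Rightarrow> real) \<Rightarrow> bool" where
  "linear_form_on T L \<longleftrightarrow>
     (\<forall>v\<in>T. \<forall>w\<in>T. L (v + w) = L v + L w) \<and> (\<forall>v\<in>T. \<forall>a. L (a *\<^sub>v v) = a * L v)"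

definition linear_endo_on :: "'a tvec set \<Rightarrow> ('a tvec \<Rightarrow> 'a tvec) \<Rightarrow> bool" where
  "linear_endo_on T L \<longleftrightarrow>
     (\<forall>v\<in>T. L v \<in> T) \<and> (\<forall>v\<in>T. \<forall>w\<in>T. L (v + w) = L v + L w) \<and>
     (\<forall>v\<in>T. \<forall>a. L (a *\<^sub>v v) = a *\<^sub>v L v)"

definition one_form :: "'a::topological_space chart set \<Rightarrow> ('a \<Rightarrow> 'a tvec \<Rightarrow> real) \<Rightarrow> bool" where
  "one_form A \<eta> \<longleftrightarrow>
     (\<forall>p. linear_form_on (tangent_space A p) (\<eta> p)) \<and>
     (\<forall>U X. vector_field A U X \<longrightarrow> smooth_fun A U (ap1 \<eta> X))"

definition endo_field :: "'a::topological_space chart set \<Rightarrow> ('a \<Rightarrow> 'a tvec \<Rightarrow> 'a tvec) \<Rightarrow> bool" where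
  "endo_field A \<phi> \<longleftrightarrow>
     (\<forall>p. linear_endo_on (tangent_space A p) (\<phi> p)) \<and>
     (\<forall>U X. vector_field A U X \<longrightarrow> vector_field A U (ap1 \<phi> X))"

definition riemannian_metric ::
    "'a::topological_space chart set \<Rightarrow> ('a \<Rightarrow> 'a tvec \<Rightarrow> 'a tvec \<Rightarrow> real) \<Rightarrow> bool" where
  "riemannian_metric A g \<longleftrightarrow>
     (\<forall>p. \<forall>v\<in>tangent_space A p. linear_form_on (tangent_space A p) (g p v)) \<and>
     (\<forall>p. \<forall>v\<in>tangent_space A p. \<forall>w\<in>tangent_space A p. g p v w = g p w v) \<and>
     (\<forall>p. \<forall>v\<in>tangent_space A p. v \<noteq> 0 \<longrightarrow> g p v v > 0) \<and>
     (\<forall>U X Y. vector_field A U X \<and> vector_field A U Y \<longrightarrow> smooth_fun A U (ap2 g X Y))"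

text \<open>
  Exterior derivative and wedge product carry the normalisation of contact geometry:
  \<open>d\<close> of a \<open>k\<close>-form has the factor \<open>1/(k+1)\<close>, and the wedge product is the alternation of the tensor
  product.  Only \<open>ext_d1\<close> occurs without a matching factor (\<open>2 d\<eta> \<otimes> \<xi>\<close> in the normality
  condition).
\<close>

definition ext_d1 :: "'a::topological_space chart set \<Rightarrow> ('a \<Rightarrow> 'a tvec \<Rightarrow> real) \<Rightarrow>
    'a vfield \<Rightarrow> 'a vfield \<Rightarrow> 'a \<Rightarrow> real" where
  "ext_d1 A \<eta> X Y p =
     (X p (ap1 \<eta> Y) - Y p (ap1 \<eta> X) - ap1 \<eta> (lie_bracket A X Y) p) / 2"

definition ext_d2 :: "'a::topological_space chart set \<Rightarrow> ('a \<Rightarrow> 'a tvec \<Rightarrow> 'a tvec \<Rightarrow> real) \<Rightarrow>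
    'a vfield \<Rightarrow> 'a vfield \<Rightarrow> 'a vfield \<Rightarrow> 'a \<Rightarrow> real" where
  "ext_d2 A \<omega> X Y Z p =
     (X p (ap2 \<omega> Y Z) + Y p (ap2 \<omega> Z X) + Z p (ap2 \<omega> X Y)
      - ap2 \<omega> (lie_bracket A X Y) Z p - ap2 \<omega> (lie_bracket A Y Z) X p
      - ap2 \<omega> (lie_bracket A Z X) Y p) / 3"

definition wedge12 :: "('a \<Rightarrow> 'a tvec \<Rightarrow> real) \<Rightarrow> ('a \<Rightarrow> 'a tvec \<Rightarrow> 'a tvec \<Rightarrow> real) \<Rightarrow>
    'a vfield \<Rightarrow> 'a vfield \<Rightarrow> 'a vfield \<Rightarrow> 'a \<Rightarrow> real" where
  "wedge12 \<eta> \<omega> X Y Z p =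
     (ap1 \<eta> X p * ap2 \<omega> Y Z p + ap1 \<eta> Y p * ap2 \<omega> Z X p + ap1 \<eta> Z p * ap2 \<omega> X Y p) / 3"

definition lie_metric :: "'a::topological_space chart set \<Rightarrow> ('a \<Rightarrow> 'a tvec \<Rightarrow> 'a tvec \<Rightarrow> real) \<Rightarrow>
    'a vfield \<Rightarrow> 'a vfield \<Rightarrow> 'a vfield \<Rightarrow> 'a \<Rightarrow> real" where
  "lie_metric A g V X Y p =
     V p (ap2 g X Y) - ap2 g (lie_bracket A V X) Y p - ap2 g X (lie_bracket A V Y) p"

definition lie_endo :: "'a::topological_space chart set \<Rightarrow> ('a \<Rightarrow> 'a tvec \<Rightarrow> 'a tvec) \<Rightarrow>
    'a vfield \<Rightarrow> 'a vfield \<Rightarrow> 'a vfield" where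
  "lie_endo A \<phi> V X = lie_bracket A V (ap1 \<phi> X) - ap1 \<phi> (lie_bracket A V X)"

definition nijenhuis :: "'a::topological_space chart set \<Rightarrow> ('a \<Rightarrow> 'a tvec \<Rightarrow> 'a tvec) \<Rightarrow>
    'a vfield \<Rightarrow> 'a vfield \<Rightarrow> 'a vfield" where
  "nijenhuis A \<phi> X Y =
     ap1 \<phi> (ap1 \<phi> (lie_bracket A X Y)) + lie_bracket A (ap1 \<phi> X) (ap1 \<phi> Y)
     - ap1 \<phi> (lie_bracket A (ap1 \<phi> X) Y) - ap1 \<phi> (lie_bracket A X (ap1 \<phi> Y))"

section \<open>Levi-Civita connection and curvature\<close>

definition levi_civita :: "'a::topological_space chart set \<Rightarrow> ('a \<Rightarrow> 'a tvec \<Rightarrow> 'a tvec \<Rightarrow> real) \<Rightarrow>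
    ('a vfield \<Rightarrow> 'a vfield \<Rightarrow> 'a vfield) \<Rightarrow> bool" where
  "levi_civita A g D \<longleftrightarrow>
     (\<forall>U X Y Z f. vector_field A U X \<and> vector_field A U Y \<and> vector_field A U Z \<and> smooth_fun A U f \<longrightarrow>
        vector_field A U (D X Y) \<and>
        (\<forall>p\<in>U. D (X + Y) Z p = D X Z p + D Y Z p \<and>
               D (f *\<^sub>F X) Z p = f p *\<^sub>v D X Z p \<and>
               D X (Y + Z) p = D X Y p + D X Z p \<and>
               D X (f *\<^sub>F Y) p = X p f *\<^sub>v Y p + f p *\<^sub>v D X Y p \<and>
               D X Y p - D Y X p = lie_bracket A X Y p \<and>
               X p (ap2 g Y Z) = ap2 g (D X Y) Z p + ap2 g Y (D X Z) p))"

definition curvature :: "'a::topological_space chart set \<Rightarrow> ('a vfield \<Rightarrow> 'a vfield \<Rightarrow> 'a vfield) \<Rightarrow>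
    'a vfield \<Rightarrow> 'a vfield \<Rightarrow> 'a vfield \<Rightarrow> 'a vfield" where
  "curvature A D X Y Z = D X (D Y Z) - D Y (D X Z) - D (lie_bracket A X Y) Z"

definition orthonormal_frame :: "'a::topological_space chart set \<Rightarrow>
    ('a \<Rightarrow> 'a tvec \<Rightarrow> 'a tvec \<Rightarrow> real) \<Rightarrow> 'a set \<Rightarrow> (nat \<Rightarrow> 'a vfield) \<Rightarrow> bool" where
  "orthonormal_frame A g U E \<longleftrightarrow>
     (\<forall>i\<in>{1..3}. vector_field A U (E i)) \<and>
     (\<forall>p\<in>U. \<forall>i\<in>{1..3}. \<forall>j\<in>{1..3}. g p (E i p) (E j p) = (if i = j then 1 else 0))"

text \<open>
  Traces at \<open>p\<close> are taken in an arbitrary local orthonormal frame around \<open>p\<close>; they do not depend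
  on the choice.
\<close>

definition frame_at :: "'a::topological_space chart set \<Rightarrow>
    ('a \<Rightarrow> 'a tvec \<Rightarrow> 'a tvec \<Rightarrow> real) \<Rightarrow> 'a \<Rightarrow> nat \<Rightarrow> 'a vfield" where
  "frame_at A g p = (SOME E. \<exists>U. p \<in> U \<and> orthonormal_frame A g U E)"

text \<open>\<open>S(Y,Z)\<close> is the trace of \<open>X \<mapsto> R(X,Y)Z\<close>.\<close>

definition ricci :: "'a::topological_space chart set \<Rightarrow> ('a \<Rightarrow> 'a tvec \<Rightarrow> 'a tvec \<Rightarrow> real) \<Rightarrow>
    ('a vfield \<Rightarrow> 'a vfield \<Rightarrow> 'a vfield) \<Rightarrow> 'a vfield \<Rightarrow> 'a vfield \<Rightarrow> 'a \<Rightarrow> real" where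
  "ricci A g D Y Z p =
     (\<Sum>i=1..3. ap2 g (curvature A D (frame_at A g p i) Y Z) (frame_at A g p i) p)"

definition scalar_curvature :: "'a::topological_space chart set \<Rightarrow>
    ('a \<Rightarrow> 'a tvec \<Rightarrow> 'a tvec \<Rightarrow> real) \<Rightarrow>
    ('a vfield \<Rightarrow> 'a vfield \<Rightarrow> 'a vfield) \<Rightarrow> 'a \<Rightarrow> real" where
  "scalar_curvature A g D p =
     (\<Sum>i=1..3. ricci A g D (frame_at A g p i) (frame_at A g p i) p)"

definition ricci_op :: "'a::topological_space chart set \<Rightarrow> ('a \<Rightarrow> 'a tvec \<Rightarrow> 'a tvec \<Rightarrow> real) \<Rightarrow>
    ('a vfield \<Rightarrow> 'a vfield \<Rightarrow> 'a vfield) \<Rightarrow> 'a vfield \<Rightarrow> 'a vfield" where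
  "ricci_op A g D X p =
     (THE v. v \<in> tangent_space A p \<and>
        (\<forall>U Y. p \<in> U \<and> vector_field A U Y \<longrightarrow> ricci A g D X Y p = g p v (Y p)))"

definition cov_ricci :: "'a::topological_space chart set \<Rightarrow> ('a \<Rightarrow> 'a tvec \<Rightarrow> 'a tvec \<Rightarrow> real) \<Rightarrow>
    ('a vfield \<Rightarrow> 'a vfield \<Rightarrow> 'a vfield) \<Rightarrow>
    'a vfield \<Rightarrow> 'a vfield \<Rightarrow> 'a vfield \<Rightarrow> 'a \<Rightarrow> real" where
  "cov_ricci A g D X Y Z p =
     X p (ricci A g D Y Z) - ricci A g D (D X Y) Z p - ricci A g D Y (D X Z) p"

section \<open>Almost Kenmotsu manifolds\<close>

definition almost_contact_metric :: "'a::topological_space chart set \<Rightarrow>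
    ('a \<Rightarrow> 'a tvec \<Rightarrow> 'a tvec) \<Rightarrow> 'a vfield \<Rightarrow> ('a \<Rightarrow> 'a tvec \<Rightarrow> real) \<Rightarrow>
    ('a \<Rightarrow> 'a tvec \<Rightarrow> 'a tvec \<Rightarrow> real) \<Rightarrow> bool" where
  "almost_contact_metric A \<phi> \<xi> \<eta> g \<longleftrightarrow>
     smooth_atlas A \<and> endo_field A \<phi> \<and> vector_field A UNIV \<xi> \<and> one_form A \<eta> \<and>
     riemannian_metric A g \<and>
     (\<forall>p. g p (\<xi> p) (\<xi> p) = 1 \<and> \<eta> p (\<xi> p) = 1) \<and>
     (\<forall>p. \<forall>v\<in>tangent_space A p.
        \<eta> p v = g p v (\<xi> p) \<and> \<phi> p (\<phi> p v) = - v + \<eta> p v *\<^sub>v \<xi> p) \<and>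
     (\<forall>p. \<forall>v\<in>tangent_space A p. \<forall>w\<in>tangent_space A p.
        g p (\<phi> p v) (\<phi> p w) = g p v w - \<eta> p v * \<eta> p w)"

definition fundamental_form :: "('a \<Rightarrow> 'a tvec \<Rightarrow> 'a tvec) \<Rightarrow>
    ('a \<Rightarrow> 'a tvec \<Rightarrow> 'a tvec \<Rightarrow> real) \<Rightarrow> 'a \<Rightarrow> 'a tvec \<Rightarrow> 'a tvec \<Rightarrow> real" where
  "fundamental_form \<phi> g p v w = g p v (\<phi> p w)"

definition almost_kenmotsu :: "'a::topological_space chart set \<Rightarrow>
    ('a \<Rightarrow> 'a tvec \<Rightarrow> 'a tvec) \<Rightarrow> 'a vfield \<Rightarrow> ('a \<Rightarrow> 'a tvec \<Rightarrow> real) \<Rightarrow>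
    ('a \<Rightarrow> 'a tvec \<Rightarrow> 'a tvec \<Rightarrow> real) \<Rightarrow> bool" where
  "almost_kenmotsu A \<phi> \<xi> \<eta> g \<longleftrightarrow>
     almost_contact_metric A \<phi> \<xi> \<eta> g \<and>
     (\<forall>U X Y. vector_field A U X \<and> vector_field A U Y \<longrightarrow> (\<forall>p\<in>U. ext_d1 A \<eta> X Y p = 0)) \<and>
     (\<forall>U X Y Z. vector_field A U X \<and> vector_field A U Y \<and> vector_field A U Z \<longrightarrow>
        (\<forall>p\<in>U. ext_d2 A (fundamental_form \<phi> g) X Y Z p =
                2 * wedge12 \<eta> (fundamental_form \<phi> g) X Y Z p))"

definition normal_structure :: "'a::topological_space chart set \<Rightarrow>
    ('a \<Rightarrow> 'a tvec \<Rightarrow> 'a tvec) \<Rightarrow> 'a vfield \<Rightarrow> ('a \<Rightarrow> 'a tvec \<Rightarrow> real) \<Rightarrow> bool" where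
  "normal_structure A \<phi> \<xi> \<eta> \<longleftrightarrow>
     (\<forall>U X Y. vector_field A U X \<and> vector_field A U Y \<longrightarrow>
        (\<forall>p\<in>U. nijenhuis A \<phi> X Y p + (2 * ext_d1 A \<eta> X Y p) *\<^sub>v \<xi> p = 0))"

definition kenmotsu :: "'a::topological_space chart set \<Rightarrow>
    ('a \<Rightarrow> 'a tvec \<Rightarrow> 'a tvec) \<Rightarrow> 'a vfield \<Rightarrow> ('a \<Rightarrow> 'a tvec \<Rightarrow> real) \<Rightarrow>
    ('a \<Rightarrow> 'a tvec \<Rightarrow> 'a tvec \<Rightarrow> real) \<Rightarrow> bool" where
  "kenmotsu A \<phi> \<xi> \<eta> g \<longleftrightarrow> almost_kenmotsu A \<phi> \<xi> \<eta> g \<and> normal_structure A \<phi> \<xi> \<eta>"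

definition h_op :: "'a::topological_space chart set \<Rightarrow>
    ('a \<Rightarrow> 'a tvec \<Rightarrow> 'a tvec) \<Rightarrow> 'a vfield \<Rightarrow> 'a vfield \<Rightarrow> 'a vfield" where
  "h_op A \<phi> \<xi> X = (\<lambda>p. (1/2) *\<^sub>v lie_endo A \<phi> \<xi> X p)"

text \<open>\<open>D\<close> is intended to be the Levi-Civita connection of \<open>g\<close>; the last clause is \<open>\<nabla>\<^sub>\<xi> h = 0\<close>.\<close>

definition almost_kenmotsu_3h :: "'a::topological_space chart set \<Rightarrow>
    ('a \<Rightarrow> 'a tvec \<Rightarrow> 'a tvec) \<Rightarrow> 'a vfield \<Rightarrow> ('a \<Rightarrow> 'a tvec \<Rightarrow> real) \<Rightarrow>
    ('a \<Rightarrow> 'a tvec \<Rightarrow> 'a tvec \<Rightarrow> real) \<Rightarrow>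
    ('a vfield \<Rightarrow> 'a vfield \<Rightarrow> 'a vfield) \<Rightarrow> bool" where
  "almost_kenmotsu_3h A \<phi> \<xi> \<eta> g D \<longleftrightarrow>
     almost_kenmotsu A \<phi> \<xi> \<eta> g \<and>
     (\<forall>U X. vector_field A U X \<longrightarrow>
        (\<forall>p\<in>U. D \<xi> (h_op A \<phi> \<xi> X) p - h_op A \<phi> \<xi> (D \<xi> X) p = 0))"

section \<open>Cotton tensors and Cotton solitons\<close>

definition cotton3 :: "'a::topological_space chart set \<Rightarrow> ('a \<Rightarrow> 'a tvec \<Rightarrow> 'a tvec \<Rightarrow> real) \<Rightarrow>
    ('a vfield \<Rightarrow> 'a vfield \<Rightarrow> 'a vfield) \<Rightarrow>
    'a vfield \<Rightarrow> 'a vfield \<Rightarrow> 'a vfield \<Rightarrow> 'a \<Rightarrow> real" where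
  "cotton3 A g D X Y Z p =
     cov_ricci A g D X Y Z p - cov_ricci A g D Y X Z p
     - (1/4) * (X p (scalar_curvature A g D) * ap2 g Y Z p
              - Y p (scalar_curvature A g D) * ap2 g X Z p)"

definition phi_frame :: "'a::topological_space chart set \<Rightarrow>
    ('a \<Rightarrow> 'a tvec \<Rightarrow> 'a tvec) \<Rightarrow> 'a vfield \<Rightarrow> ('a \<Rightarrow> 'a tvec \<Rightarrow> 'a tvec \<Rightarrow> real) \<Rightarrow>
    'a set \<Rightarrow> (nat \<Rightarrow> 'a vfield) \<Rightarrow> bool" where
  "phi_frame A \<phi> \<xi> g U E \<longleftrightarrow>
     orthonormal_frame A g U E \<and> (\<forall>p\<in>U. E 1 p = \<xi> p \<and> E 3 p = \<phi> p (E 2 p))"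

definition phi_frame_at :: "'a::topological_space chart set \<Rightarrow>
    ('a \<Rightarrow> 'a tvec \<Rightarrow> 'a tvec) \<Rightarrow> 'a vfield \<Rightarrow> ('a \<Rightarrow> 'a tvec \<Rightarrow> 'a tvec \<Rightarrow> real) \<Rightarrow>
    'a \<Rightarrow> nat \<Rightarrow> 'a vfield" where
  "phi_frame_at A \<phi> \<xi> g p = (SOME E. \<exists>U. p \<in> U \<and> phi_frame A \<phi> \<xi> g U E)"

text \<open>On \<open>{1,2,3}\<close> this Vandermonde product is the totally antisymmetric symbol with
  value \<open>1\<close> at \<open>(1,2,3)\<close>.\<close>

definition eps :: "nat \<Rightarrow> nat \<Rightarrow> nat \<Rightarrow> real" where
  "eps i j k = (real j - real i) * (real k - real i) * (real k - real j) / 2"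

definition cotton_comp :: "'a::topological_space chart set \<Rightarrow>
    ('a \<Rightarrow> 'a tvec \<Rightarrow> 'a tvec \<Rightarrow> real) \<Rightarrow> ('a vfield \<Rightarrow> 'a vfield \<Rightarrow> 'a vfield) \<Rightarrow>
    (nat \<Rightarrow> 'a vfield) \<Rightarrow> nat \<Rightarrow> nat \<Rightarrow> 'a \<Rightarrow> real" where
  "cotton_comp A g D E i j p =
     (1/2) * (\<Sum>n=1..3. \<Sum>m=1..3. cotton3 A g D (E n) (E m) (E i) p * eps n m j)"

text \<open>
  The (0,2)-Cotton tensor is \<open>\<Sum>i j. C\<^sub>i\<^sub>j X\<^sup>i Y\<^sup>j\<close> in a frame \<open>(\<xi>, e, \<phi> e)\<close> around the point.  All these
  frames induce the same orientation, so the choice of \<open>e\<close> is irrelevant.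
\<close>

definition cotton2 :: "'a::topological_space chart set \<Rightarrow>
    ('a \<Rightarrow> 'a tvec \<Rightarrow> 'a tvec) \<Rightarrow> 'a vfield \<Rightarrow> ('a \<Rightarrow> 'a tvec \<Rightarrow> 'a tvec \<Rightarrow> real) \<Rightarrow>
    ('a vfield \<Rightarrow> 'a vfield \<Rightarrow> 'a vfield) \<Rightarrow> 'a vfield \<Rightarrow> 'a vfield \<Rightarrow> 'a \<Rightarrow> real" where
  "cotton2 A \<phi> \<xi> g D X Y p =
     (let E = phi_frame_at A \<phi> \<xi> g p in
      \<Sum>i=1..3. \<Sum>j=1..3. cotton_comp A g D E i j p * ap2 g X (E i) p * ap2 g Y (E j) p)"

definition cotton_soliton :: "'a::topological_space chart set \<Rightarrow>
    ('a \<Rightarrow> 'a tvec \<Rightarrow> 'a tvec) \<Rightarrow> 'a vfield \<Rightarrow> ('a \<Rightarrow> 'a tvec \<Rightarrow> 'a tvec \<Rightarrow> real) \<Rightarrow>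
    ('a vfield \<Rightarrow> 'a vfield \<Rightarrow> 'a vfield) \<Rightarrow> 'a vfield \<Rightarrow> real \<Rightarrow> bool" where
  "cotton_soliton A \<phi> \<xi> g D V \<sigma> \<longleftrightarrow>
     vector_field A UNIV V \<and>
     (\<forall>U X Y. vector_field A U X \<and> vector_field A U Y \<longrightarrow>
        (\<forall>p\<in>U. lie_metric A g V X Y p + cotton2 A \<phi> \<xi> g D X Y p - \<sigma> * ap2 g X Y p = 0))"

text \<open>
  \<open>\<alpha> = 0\<close> is allowed here.  As the (0,2)-Cotton tensor is trace-free, \<open>V = 0\<close> is the potential of a
  Cotton soliton exactly when the Cotton tensor vanishes (as on the almost Kenmotsu 3-h-manifold
  \<open>H\<^sup>2(-4) \<times> \<real>\<close>), so a non-existence statement has to exclude \<open>V = 0\<close> explicitly.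
\<close>

definition pointwise_collinear :: "'a::topological_space chart set \<Rightarrow> 'a vfield \<Rightarrow> 'a vfield \<Rightarrow> bool" where
  "pointwise_collinear A V \<xi> \<longleftrightarrow> (\<exists>\<alpha>. smooth_fun A UNIV \<alpha> \<and> (\<forall>p. V p = \<alpha> p *\<^sub>v \<xi> p))"

end

theory Submission
  imports Defs
begin

text \<open>
  Let \<open>V = \<alpha> \<xi>\<close>.  In a frame \<open>(\<xi>, e, \<phi> e)\<close> with \<open>h e = \<lambda> e\<close> the conditions \<open>d\<eta> = 0\<close>,
  \<open>d\<Phi> = 2 \<eta> \<and> \<Phi>\<close> leave only \<open>\<lambda>\<close>, \<open>a = g(\<nabla>\<^sub>\<xi> e, \<phi> e)\<close>, \<open>b = g(\<nabla>\<^sub>e \<phi> e, e)\<close>,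
  \<open>c = g(\<nabla>\<^bsub>\<phi> e\<^esub> e, \<phi> e)\<close> as connection coefficients.

  Where \<open>\<lambda> \<noteq> 0\<close>, \<open>\<nabla>\<^sub>\<xi> h = 0\<close> gives \<open>a = 0\<close> and \<open>\<xi>(\<lambda>) = 0\<close>; the Ricci condition and the Bianchi
  identity give the first derivatives of \<open>\<lambda>\<close> and \<open>\<xi>(b)\<close>, \<open>\<xi>(c)\<close>, and commuting \<open>\<xi>\<close> with \<open>e\<close> and
  \<open>\<phi> e\<close> on \<open>\<lambda>\<close> forces \<open>b = c = 0\<close>.  The geometry is then that of a Lie group with explicit Ricci tensor,
  the Cotton tensor has \<open>C(e, \<phi> e) = 0\<close>, and the \<open>(e, \<phi> e)\<close> component of the soliton equation reads
  \<open>- 2 \<lambda> \<alpha> = 0\<close>.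

  On an open set where \<open>h = 0\<close> one has \<open>C(\<xi>, \<xi>) = 0\<close> and \<open>C(e, e) + C(\<phi> e, \<phi> e) = 0\<close>, so
  \<open>2 \<xi>(\<alpha>) = \<sigma> = 2 \<alpha>\<close>, whence \<open>\<sigma> = 0\<close> and \<open>\<alpha> = 0\<close>.  Applied on the open set \<open>{\<alpha> \<noteq> 0}\<close>, the two cases
  show that this set is empty.
\<close>

section \<open>Calculus of smooth functions\<close>

text \<open>Two obstacles shape the proof. Fields are total functions that are smooth only on some
  open set, and \<open>ricci\<close>, \<open>scalar_curvature\<close> and \<open>cotton2\<close> are
  evaluated in frames picked anew at every point. Hence the objects are shown to depend on germs
  only and to be tensorial, after which a single frame on an open set replaces the picked ones and
  can be differentiated. An identity may be differentiated only where it holds on an open set; so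
  nonvanishing h is excluded first, point by point inside {\<alpha> \<noteq> 0}, which leaves h = 0
  on all of that open set.

  Both cases use components for which little of the Cotton tensor has to be known. The (e, \<phi> e)
  component of the Lie derivative of g along V contains \<alpha> undifferentiated, multiplied by
  \<lambda> alone. Where h = 0 the coefficients a, b, c stay arbitrary, but they drop out of the
  (\<xi>, \<xi>) component and of the sum of the other two diagonal components. The vanishing of b
  and c comes from commutators applied to \<lambda>: the terms linear in \<lambda> cancel, and 4
  \<lambda>^2 b and 4 \<lambda>^2 c remain.\<close>

lemma scale_vec_apply [simp]: "(a *\<^sub>v v) f = a * v f"
  by (simp add: scale_vec_def)

lemma scale_field_apply: "(f *\<^sub>F X) p = f p *\<^sub>v X p"
  by (simp add: scale_field_def)

lemma sum_1_3: "(\<Sum>i=1..3. f i) = f 1 + f 2 + f (3::nat)"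
  by (simp add: numeral_3_eq_3 numeral_2_eq_2)

lemma ball_1_3: "(\<forall>i\<in>{1..3::nat}. P i) \<longleftrightarrow> P 1 \<and> P 2 \<and> P 3"
proof -
  have "{1..3::nat} = {1, 2, 3}" by auto
  then show ?thesis by simp
qed

lemma Ck_on_cong:
  assumes "open S" "\<And>x. x \<in> S \<Longrightarrow> f x = g x"
  shows "Ck_on k S f \<longleftrightarrow> Ck_on k S g"
  using assms(2)
proof (induction k arbitrary: f g)
  case 0
  then show ?case by (auto cong: continuous_on_cong)
next
  case (Suc k)
  have *: "Ck_on (Suc k) S f \<Longrightarrow> Ck_on (Suc k) S g" if eq: "\<And>x. x \<in> S \<Longrightarrow> f x = g x"
    for f g :: "'a \<Rightarrow> 'b"
  proof -
    assume f: "Ck_on (Suc k) S f"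
    have d: "g differentiable (at x)" if x: "x \<in> S" for x
    proof -
      obtain D where "(f has_derivative D) (at x)" using f x by (auto simp: differentiable_def)
      then have "(g has_derivative D) (at x)"
        by (rule has_derivative_transform_within_open[OF _ assms(1) x eq])
      then show ?thesis by (auto simp: differentiable_def)
    qed
    have "frechet_derivative f (at x) v = frechet_derivative g (at x) v" if "x \<in> S" for x v
      using f that eq assms(1) frechet_derivative_transform_within_open[of f x S g] by auto
    then have "Ck_on k S (\<lambda>x. frechet_derivative g (at x) v)" for v
      using f Suc.IH[of "\<lambda>x. frechet_derivative f (at x) v" "\<lambda>x. frechet_derivative g (at x) v"]
      by auto
    then show ?thesis using d by simp
  qed
  show ?case using *[of f g] *[of g f] Suc.prems by metis
qed

lemma Ck_on_subset: "Ck_on k S f \<Longrightarrow> T \<subseteq> S \<Longrightarrow> Ck_on k T f"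
  by (induction k arbitrary: f) (auto intro: continuous_on_subset)

lemma Ck_on_SucD: "Ck_on (Suc k) S f \<Longrightarrow> Ck_on k S f"
proof (induction k arbitrary: f)
  case 0
  then show ?case
    by (auto intro!: continuous_at_imp_continuous_on differentiable_imp_continuous_within)
next
  case (Suc k)
  show ?case using Suc.prems Suc.IH by (subst Ck_on.simps) (auto simp del: Ck_on.simps(1))
qed

lemma Ck_on_const [simp]: "Ck_on k S (\<lambda>x. c)"
  by (induction k arbitrary: c) auto

lemma Ck_on_add:
  assumes "open S" "Ck_on k S f" "Ck_on k S g"
  shows "Ck_on k S (\<lambda>x. f x + g x)"
  using assms(2,3)
proof (induction k arbitrary: f g)
  case 0
  then show ?case by (auto intro: continuous_intros)
next
  case (Suc k)
  have "frechet_derivative (\<lambda>x. f x + g x) (at x) v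
      = frechet_derivative f (at x) v + frechet_derivative g (at x) v" if "x \<in> S" for x v
  proof -
    have "((\<lambda>x. f x + g x) has_derivative
        (\<lambda>v. frechet_derivative f (at x) v + frechet_derivative g (at x) v)) (at x)"
      using Suc.prems that by (intro has_derivative_add) (auto simp: frechet_derivative_works)
    then show ?thesis using frechet_derivative_at by metis
  qed
  then have "Ck_on k S (\<lambda>x. frechet_derivative (\<lambda>x. f x + g x) (at x) v) \<longleftrightarrow>
     Ck_on k S (\<lambda>x. frechet_derivative f (at x) v + frechet_derivative g (at x) v)" for v
    using assms(1) by (intro Ck_on_cong) auto
  then show ?case using Suc by auto
qed

lemma Ck_on_sum:
  assumes "open S" "finite B" "\<And>b. b \<in> B \<Longrightarrow> Ck_on k S (f b)"
  shows "Ck_on k S (\<lambda>x. \<Sum>b\<in>B. f b x)"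
  using assms(2,3) by (induction B rule: finite_induct) (auto intro: Ck_on_add assms(1))

lemma Ck_on_mult:
  fixes f g :: "'m::real_normed_vector \<Rightarrow> real"
  assumes "open S" "Ck_on k S f" "Ck_on k S g"
  shows "Ck_on k S (\<lambda>x. f x * g x)"
  using assms(2,3)
proof (induction k arbitrary: f g)
  case 0
  then show ?case by (auto intro: continuous_intros)
next
  case (Suc k)
  have "frechet_derivative (\<lambda>x. f x * g x) (at x) v
      = f x * frechet_derivative g (at x) v + frechet_derivative f (at x) v * g x" if "x \<in> S" for x v
  proof -
    have "((\<lambda>x. f x * g x) has_derivative
        (\<lambda>v. f x * frechet_derivative g (at x) v + frechet_derivative f (at x) v * g x)) (at x)"
      using Suc.prems that by (intro has_derivative_mult) (auto simp: frechet_derivative_works)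
    then show ?thesis using frechet_derivative_at by metis
  qed
  then have *: "Ck_on k S (\<lambda>x. frechet_derivative (\<lambda>x. f x * g x) (at x) v) \<longleftrightarrow>
     Ck_on k S (\<lambda>x. f x * frechet_derivative g (at x) v + frechet_derivative f (at x) v * g x)" for v
    using assms(1) by (intro Ck_on_cong) auto
  have "Ck_on k S f" "Ck_on k S g" using Suc.prems Ck_on_SucD by blast+
  moreover have "Ck_on k S (\<lambda>x. frechet_derivative f (at x) v)"
    "Ck_on k S (\<lambda>x. frechet_derivative g (at x) v)" for v
    using Suc.prems by auto
  ultimately have "Ck_on k S (\<lambda>x. f x * frechet_derivative g (at x) v
      + frechet_derivative f (at x) v * g x)" for v
    by (intro Ck_on_add Suc.IH assms(1))
  moreover have "(\<lambda>x. f x * g x) differentiable (at x)" if "x \<in> S" for x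
    using Suc.prems that by (auto intro: differentiable_mult)
  ultimately show ?case using * by simp
qed

lemma Ck_on_inner_const:
  fixes f :: "'m::real_normed_vector \<Rightarrow> 'b::euclidean_space"
  assumes "open S" "Ck_on k S f"
  shows "Ck_on k S (\<lambda>x. f x \<bullet> b)"
  using assms(2)
proof (induction k arbitrary: f)
  case 0
  then show ?case by (auto intro: continuous_intros)
next
  case (Suc k)
  have d: "((\<lambda>x. f x \<bullet> b) has_derivative (\<lambda>v. frechet_derivative f (at x) v \<bullet> b)) (at x)"
    if "x \<in> S" for x
    using Suc.prems that by (intro has_derivative_inner_left) (auto simp: frechet_derivative_works)
  then have "frechet_derivative (\<lambda>x. f x \<bullet> b) (at x) v = frechet_derivative f (at x) v \<bullet> b"
    if "x \<in> S" for x v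
    using frechet_derivative_at that by metis
  then have *: "Ck_on k S (\<lambda>x. frechet_derivative (\<lambda>x. f x \<bullet> b) (at x) v) \<longleftrightarrow>
     Ck_on k S (\<lambda>x. frechet_derivative f (at x) v \<bullet> b)" for v
    using assms(1) by (intro Ck_on_cong) auto
  then show ?case using Suc d by (auto simp: differentiable_def)
qed

lemma Ck_on_compose:
  fixes f :: "'b::euclidean_space \<Rightarrow> real" and \<tau> :: "'m::real_normed_vector \<Rightarrow> 'b"
  assumes "open S" "open T" "\<tau> ` S \<subseteq> T" "Ck_on k S \<tau>" "Ck_on k T f"
  shows "Ck_on k S (\<lambda>x. f (\<tau> x))"
  using assms(4,5)
proof (induction k arbitrary: f)
  case 0
  then show ?case using assms(3) by (auto intro: continuous_on_compose2)
next
  case (Suc k)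
  have \<tau>S: "\<tau> x \<in> T" if "x \<in> S" for x using that assms(3) by auto
  have d: "((\<lambda>x. f (\<tau> x)) has_derivative
      (\<lambda>v. frechet_derivative f (at (\<tau> x)) (frechet_derivative \<tau> (at x) v))) (at x)" if "x \<in> S" for x
    using Suc.prems that \<tau>S[OF that]
    by (intro has_derivative_compose[of \<tau> _ x UNIV f]) (auto simp: frechet_derivative_works)
  \<comment> \<open>\<open>Ck_on\<close> controls derivatives in fixed directions only, but the
    chain rule produces a direction that moves with \<open>x\<close>. Expanding it in
    \<open>Basis\<close> leaves fixed directions with coefficients that depend on
    \<open>x\<close>.\<close>
  have "frechet_derivative (\<lambda>x. f (\<tau> x)) (at x) v
      = (\<Sum>b\<in>Basis. (frechet_derivative \<tau> (at x) v \<bullet> b) * frechet_derivative f (at (\<tau> x)) b)"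
    if "x \<in> S" for x v
  proof -
    have lin: "linear (frechet_derivative f (at (\<tau> x)))"
      using Suc.prems \<tau>S[OF that] by (auto intro: linear_frechet_derivative)
    have "frechet_derivative (\<lambda>x. f (\<tau> x)) (at x) v
        = frechet_derivative f (at (\<tau> x)) (frechet_derivative \<tau> (at x) v)"
      using d[OF that] frechet_derivative_at by metis
    also have "\<dots> = frechet_derivative f (at (\<tau> x))
        (\<Sum>b\<in>Basis. (frechet_derivative \<tau> (at x) v \<bullet> b) *\<^sub>R b)"
      by (simp add: euclidean_representation)
    also have "\<dots> = (\<Sum>b\<in>Basis. (frechet_derivative \<tau> (at x) v \<bullet> b) * frechet_derivative f (at (\<tau> x)) b)"
      by (simp add: linear_sum[OF lin] linear_scale[OF lin])
    finally show ?thesis .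
  qed
  then have *: "Ck_on k S (\<lambda>x. frechet_derivative (\<lambda>x. f (\<tau> x)) (at x) v) \<longleftrightarrow>
     Ck_on k S (\<lambda>x. \<Sum>b\<in>Basis. (frechet_derivative \<tau> (at x) v \<bullet> b) * frechet_derivative f (at (\<tau> x)) b)"
    for v
    using assms(1) by (intro Ck_on_cong) auto
  have "Ck_on k S (\<lambda>x. frechet_derivative f (at (\<tau> x)) b)" for b
    using Suc.IH[of "\<lambda>y. frechet_derivative f (at y) b"] Suc.prems Ck_on_SucD by auto
  moreover have "Ck_on k S (\<lambda>x. frechet_derivative \<tau> (at x) v \<bullet> b)" for v b
    using Suc.prems by (intro Ck_on_inner_const assms(1)) auto
  ultimately have "Ck_on k S (\<lambda>x. \<Sum>b\<in>Basis. (frechet_derivative \<tau> (at x) v \<bullet> b)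
      * frechet_derivative f (at (\<tau> x)) b)" for v
    by (intro Ck_on_sum Ck_on_mult assms(1)) auto
  then show ?case using * d by (auto simp: differentiable_def)
qed

text \<open>All exponents are treated at once because differentiation lowers \<open>a\<close> by
  one. Square roots and their inverses enter the proof as powers with exponent \<open>1/2\<close>
  and \<open>-1/2\<close>.\<close>

lemma Ck_on_powr: "Ck_on k {0<..} (\<lambda>x::real. x powr a)"
proof (induction k arbitrary: a)
  case 0
  then show ?case by (auto intro!: continuous_intros)
next
  case (Suc k)
  have d: "((\<lambda>x. x powr a) has_derivative (\<lambda>v. (a * x powr (a - 1)) * v)) (at x)"
    if "x \<in> {0<..}" for x :: real
    using that has_real_derivative_powr[of x a] by (simp add: has_field_derivative_def)
  then have "frechet_derivative (\<lambda>x. x powr a) (at x) v = (a * x powr (a - 1)) * v"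
    if "x \<in> {0<..}" for x v :: real
    using frechet_derivative_at that by metis
  then have "Ck_on k {0<..} (\<lambda>x. frechet_derivative (\<lambda>x. x powr a) (at x) v) \<longleftrightarrow>
     Ck_on k {0<..} (\<lambda>x. (a * x powr (a - 1)) * v)" for v
    by (intro Ck_on_cong) auto
  moreover have "Ck_on k {0<..} (\<lambda>x. (a * x powr (a - 1)) * v)" for v
    by (intro Ck_on_mult Suc Ck_on_const) auto
  ultimately show ?case using d by (auto simp: differentiable_def)
qed

lemma smooth_on_deriv:
  "smooth_on S f \<Longrightarrow> smooth_on S (\<lambda>x. frechet_derivative f (at x) v)"
  unfolding smooth_on_def by (metis Ck_on.simps(2))

lemma smooth_on_differentiable: "smooth_on S f \<Longrightarrow> x \<in> S \<Longrightarrow> f differentiable (at x)"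
  unfolding smooth_on_def by (metis Ck_on.simps(2))

lemma smooth_on_subset: "smooth_on S f \<Longrightarrow> T \<subseteq> S \<Longrightarrow> smooth_on T f"
  unfolding smooth_on_def using Ck_on_subset by blast

lemma smooth_on_cong:
  "open S \<Longrightarrow> (\<And>x. x \<in> S \<Longrightarrow> f x = g x) \<Longrightarrow> smooth_on S f \<longleftrightarrow> smooth_on S g"
  unfolding smooth_on_def by (simp add: Ck_on_cong[of S f g])

lemma smooth_on_compose:
  fixes f :: "'b::euclidean_space \<Rightarrow> real" and \<tau> :: "'m::real_normed_vector \<Rightarrow> 'b"
  assumes "open S" "open T" "\<tau> ` S \<subseteq> T" "smooth_on S \<tau>" "smooth_on T f"
  shows "smooth_on S (\<lambda>x. f (\<tau> x))"
  using assms unfolding smooth_on_def by (blast intro: Ck_on_compose)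

section \<open>Smooth functions and tangent vectors\<close>

locale manifold =
  fixes A :: "'a::{t2_space, second_countable_topology} chart set"
  assumes atlas: "smooth_atlas A"
begin

lemma chart_open: "(U, c) \<in> A \<Longrightarrow> open U" and
  chart_homeomorphism: "(U, c) \<in> A \<Longrightarrow> homeomorphism U (c ` U) c (inv_into U c)"
  and chart_image_open: "(U, c) \<in> A \<Longrightarrow> open (c ` U)"
  using atlas unfolding smooth_atlas_def by auto

lemma chart_at: obtains U c where "(U, c) \<in> A" "p \<in> U"
  using atlas unfolding smooth_atlas_def by blast

lemma transition_smooth:
  "(U, c) \<in> A \<Longrightarrow> (W, d) \<in> A \<Longrightarrow> smooth_on (c ` (U \<inter> W)) (d \<circ> inv_into U c)"
  using atlas unfolding smooth_atlas_def by fast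

lemma chart_inv: "(U, c) \<in> A \<Longrightarrow> p \<in> U \<Longrightarrow> inv_into U c (c p) = p"
  using chart_homeomorphism homeomorphism_apply1 by blast

lemma chart_open_map:
  assumes "(U, c) \<in> A" "open W"
  shows "open (c ` (U \<inter> W))"
proof -
  have "openin (top_of_set (c ` U)) (c ` (U \<inter> W))"
    by (rule homeomorphism_imp_open_map[OF chart_homeomorphism[OF assms(1)]])
      (use assms(2) in auto)
  then show ?thesis using openin_open_trans[OF _ chart_image_open[OF assms(1)]] by simp
qed

lemma smooth_fun_open: "smooth_fun A W f \<Longrightarrow> open W"
  by (simp add: smooth_fun_def)

lemma smooth_funI:
  assumes "open W" "\<And>U c. (U, c) \<in> A \<Longrightarrow> smooth_on (c ` (U \<inter> W)) (f \<circ> inv_into U c)"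
  shows "smooth_fun A W f"
  unfolding smooth_fun_def by (intro conjI ballI assms(1)) (use assms(2) in auto)

lemma smooth_fun_chart: "smooth_fun A W f \<Longrightarrow> (U, c) \<in> A \<Longrightarrow> smooth_on (c ` (U \<inter> W)) (f \<circ> inv_into U c)"
  unfolding smooth_fun_def by auto

lemma smooth_fun_cong:
  assumes "\<And>p. p \<in> W \<Longrightarrow> f p = g p"
  shows "smooth_fun A W f \<longleftrightarrow> smooth_fun A W g"
proof -
  have "smooth_on (c ` (U \<inter> W)) (f \<circ> inv_into U c) \<longleftrightarrow> smooth_on (c ` (U \<inter> W)) (g \<circ> inv_into U c)"
    if U: "(U, c) \<in> A" and W: "open W" for U c
  proof (rule smooth_on_cong[OF chart_open_map[OF U W]])
    fix x assume "x \<in> c ` (U \<inter> W)"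
    then obtain p where "p \<in> U" "p \<in> W" "x = c p" by blast
    then show "(f \<circ> inv_into U c) x = (g \<circ> inv_into U c) x"
      using assms chart_inv[OF U] by (simp add: o_def)
  qed
  then show ?thesis
    by (meson smooth_funI smooth_fun_chart smooth_fun_open)
qed

lemma smooth_fun_subset: "smooth_fun A W f \<Longrightarrow> open V \<Longrightarrow> V \<subseteq> W \<Longrightarrow> smooth_fun A V f"
  by (rule smooth_funI, assumption) (erule (1) smooth_on_subset[OF smooth_fun_chart], auto)

lemma smooth_fun_const [simp]: "smooth_fun A W (\<lambda>_. k) \<longleftrightarrow> open W"
  unfolding smooth_fun_def by (auto simp: smooth_on_def o_def)

lemma smooth_fun_add: "smooth_fun A W f \<Longrightarrow> smooth_fun A W g \<Longrightarrow> smooth_fun A W (\<lambda>p. f p + g p)"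
  using smooth_fun_open[of W f] smooth_fun_chart[of W f] smooth_fun_chart[of W g]
  by (intro smooth_funI) (auto simp: smooth_on_def o_def intro!: Ck_on_add chart_open_map)

lemma smooth_fun_mult: "smooth_fun A W f \<Longrightarrow> smooth_fun A W g \<Longrightarrow> smooth_fun A W (\<lambda>p. f p * g p)"
  using smooth_fun_open[of W f] smooth_fun_chart[of W f] smooth_fun_chart[of W g]
  by (intro smooth_funI) (auto simp: smooth_on_def o_def intro!: Ck_on_mult chart_open_map)

lemma smooth_fun_powr:
  assumes f: "smooth_fun A W f" and pos: "\<And>p. p \<in> W \<Longrightarrow> f p > 0"
  shows "smooth_fun A W (\<lambda>p. f p powr a)"
proof -
  have "smooth_on (c ` (U \<inter> W)) (\<lambda>x. ((f \<circ> inv_into U c) x) powr a)" if U: "(U, c) \<in> A" for U c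
  proof (rule smooth_on_compose[where f = "\<lambda>x. x powr a"])
    show "open (c ` (U \<inter> W))" by (rule chart_open_map[OF U smooth_fun_open[OF f]])
    show "(f \<circ> inv_into U c) ` (c ` (U \<inter> W)) \<subseteq> {0<..}" using pos by (auto simp: chart_inv[OF U])
    show "smooth_on (c ` (U \<inter> W)) (f \<circ> inv_into U c)" by (rule smooth_fun_chart[OF f U])
  qed (auto simp: smooth_on_def Ck_on_powr)
  then show ?thesis using smooth_fun_open[OF f] by (intro smooth_funI) (auto simp: o_def)
qed

lemma smooth_fun_continuous:
  assumes f: "smooth_fun A W f"
  shows "continuous_on W f"
proof -
  have "continuous (at p) f" if "p \<in> W" for p
  proof -
    obtain U c where U: "(U, c) \<in> A" "p \<in> U" by (rule chart_at)
    have "continuous_on (U \<inter> W) c"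
      using chart_homeomorphism[OF U(1)] by (auto simp: homeomorphism_def intro: continuous_on_subset)
    moreover have "continuous_on (c ` (U \<inter> W)) (f \<circ> inv_into U c)"
      using smooth_fun_chart[OF f U(1)] by (metis Ck_on.simps(1) smooth_on_def)
    ultimately have "continuous_on (U \<inter> W) (\<lambda>q. (f \<circ> inv_into U c) (c q))"
      by (intro continuous_on_compose2[of "c ` (U \<inter> W)" "f \<circ> inv_into U c" "U \<inter> W" c]) auto
    then have "continuous_on (U \<inter> W) f"
      by (rule continuous_on_eq) (simp add: chart_inv[OF U(1)])
    then show ?thesis
      using U that chart_open[OF U(1)] smooth_fun_open[OF f] continuous_on_eq_continuous_at[of "U \<inter> W"]
      by auto
  qed
  then show ?thesis by (auto intro: continuous_at_imp_continuous_on)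
qed

lemma smooth_fun_open_nonzero:
  assumes f: "smooth_fun A W f"
  shows "open {p\<in>W. f p \<noteq> 0}" "open {p\<in>W. f p > 0}"
proof -
  have "open (f -` (-{0}) \<inter> W)" "open (f -` {0<..} \<inter> W)"
    using continuous_on_open_vimage[OF smooth_fun_open[OF f], THEN iffD1, OF smooth_fun_continuous[OF f]]
    by (simp_all add: open_Compl)
  moreover have "f -` (-{0}) \<inter> W = {p\<in>W. f p \<noteq> 0}" "f -` {0<..} \<inter> W = {p\<in>W. f p > 0}" by auto
  ultimately show "open {p\<in>W. f p \<noteq> 0}" "open {p\<in>W. f p > 0}" by auto
qed

lemma smooth_fun_coordinate: "(U, c) \<in> A \<Longrightarrow> smooth_fun A U (\<lambda>q. c q \<bullet> w)"
  using transition_smooth[of _ _ U c]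
  by (intro smooth_funI) (auto simp: chart_open smooth_on_def o_def intro!: Ck_on_inner_const chart_open_map)

section \<open>Germs of smooth functions\<close>

lemma smooth_near_fun: "smooth_fun A W f \<Longrightarrow> p \<in> W \<Longrightarrow> smooth_near A p f"
  unfolding smooth_near_def by blast

lemma smooth_near_obtain:
  assumes "smooth_near A p f" "open W" "p \<in> W"
  obtains V where "V \<subseteq> W" "p \<in> V" "smooth_fun A V f"
proof -
  obtain V where V: "p \<in> V" "smooth_fun A V f" using assms unfolding smooth_near_def by blast
  have "smooth_fun A (V \<inter> W) f"
    by (rule smooth_fun_subset[OF V(2)]) (use V smooth_fun_open[OF V(2)] assms in auto)
  then show ?thesis using that[of "V \<inter> W"] V(1) assms(3) by simp
qed

lemma smooth_near_obtain2:
  assumes "smooth_near A p f" "smooth_near A p g"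
  obtains V where "p \<in> V" "smooth_fun A V f" "smooth_fun A V g"
proof -
  obtain V where V: "p \<in> V" "smooth_fun A V f" using assms unfolding smooth_near_def by blast
  obtain W where "W \<subseteq> V" "p \<in> W" "smooth_fun A W g"
    by (rule smooth_near_obtain[OF assms(2) smooth_fun_open[OF V(2)] V(1)])
  then show ?thesis using that smooth_fun_subset[OF V(2), of W] smooth_fun_open[of W g] by blast
qed

lemma smooth_near_const [simp]: "smooth_near A p (\<lambda>_. k)"
  unfolding smooth_near_def by (rule exI[of _ UNIV]) simp

lemma smooth_near_add: "smooth_near A p f \<Longrightarrow> smooth_near A p g \<Longrightarrow> smooth_near A p (\<lambda>q. f q + g q)"
  by (erule (1) smooth_near_obtain2) (blast intro: smooth_near_fun smooth_fun_add)

lemma smooth_near_mult: "smooth_near A p f \<Longrightarrow> smooth_near A p g \<Longrightarrow> smooth_near A p (\<lambda>q. f q * g q)"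
  by (erule (1) smooth_near_obtain2) (blast intro: smooth_near_fun smooth_fun_mult)

lemma smooth_near_minus: "smooth_near A p f \<Longrightarrow> smooth_near A p (\<lambda>q. - f q)"
  using smooth_near_mult[of p "\<lambda>_. -1" f] by simp

lemma smooth_near_diff: "smooth_near A p f \<Longrightarrow> smooth_near A p g \<Longrightarrow> smooth_near A p (\<lambda>q. f q - g q)"
  using smooth_near_add[of p f "\<lambda>q. - g q"] smooth_near_minus[of p g] by simp

lemma smooth_near_powr:
  assumes f: "smooth_near A p f" and pos: "f p > 0"
  shows "smooth_near A p (\<lambda>q. f q powr a)"
proof -
  obtain W where W: "p \<in> W" "smooth_fun A W f" using f unfolding smooth_near_def by blast
  have "smooth_fun A {q\<in>W. f q > 0} (\<lambda>q. f q powr a)"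
    by (rule smooth_fun_powr[OF smooth_fun_subset[OF W(2) smooth_fun_open_nonzero(2)[OF W(2)]]]) auto
  then show ?thesis by (rule smooth_near_fun) (use W pos in simp)
qed

lemma smooth_near_cong:
  assumes "open W" "p \<in> W" "\<And>q. q \<in> W \<Longrightarrow> f q = g q"
  shows "smooth_near A p f \<longleftrightarrow> smooth_near A p g"
proof -
  have *: "smooth_near A p g" if f: "smooth_near A p f" and eq: "\<And>q. q \<in> W \<Longrightarrow> f q = g q" for f g
  proof -
    obtain V where V: "V \<subseteq> W" "p \<in> V" "smooth_fun A V f"
      by (rule smooth_near_obtain[OF f assms(1,2)])
    then have "smooth_fun A V g" using smooth_fun_cong[of V f g] eq by blast
    then show ?thesis using V(2) by (rule smooth_near_fun)
  qed
  show ?thesis using *[of f g] *[of g f] assms(3) by auto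
qed

lemma smooth_near_differentiable:
  assumes "smooth_near A p f" "(U, c) \<in> A" "p \<in> U"
  shows "(f \<circ> inv_into U c) differentiable (at (c p))"
proof -
  obtain W where "p \<in> W" "smooth_fun A W f" using assms(1) unfolding smooth_near_def by blast
  then show ?thesis using smooth_fun_chart[of W f U c] assms smooth_on_differentiable by blast
qed

section \<open>Tangent vectors in charts\<close>

definition chart_vec :: "'a set \<Rightarrow> ('a \<Rightarrow> real^3) \<Rightarrow> 'a \<Rightarrow> real^3 \<Rightarrow> 'a tvec" where
  "chart_vec U c p w f =
     (if smooth_near A p f then frechet_derivative (f \<circ> inv_into U c) (at (c p)) w else 0)"

text \<open>The chain rule for the transition map \<open>c \<circ> inv_into W d\<close>.
  \<open>tangent_space\<close> asks only for some chart; this lets every chart at \<open>p\<close>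
  serve.\<close>

lemma chart_vec_change:
  assumes "(U, c) \<in> A" "p \<in> U" "(W, d) \<in> A" "p \<in> W"
  shows "chart_vec W d p w = chart_vec U c p (frechet_derivative (c \<circ> inv_into W d) (at (d p)) w)"
proof
  fix f
  show "chart_vec W d p w f = chart_vec U c p (frechet_derivative (c \<circ> inv_into W d) (at (d p)) w) f"
  proof (cases "smooth_near A p f")
    case True
    let ?\<tau> = "c \<circ> inv_into W d"
    have "d p \<in> d ` (W \<inter> U)" using assms by auto
    then have \<tau>: "?\<tau> differentiable (at (d p))"
      by (rule smooth_on_differentiable[OF transition_smooth[OF assms(3,1)]])
    have \<tau>p: "?\<tau> (d p) = c p" using chart_inv[OF assms(3,4)] by simp
    have F: "(f \<circ> inv_into U c) differentiable (at (?\<tau> (d p)))"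
      unfolding \<tau>p by (rule smooth_near_differentiable[OF True assms(1,2)])
    have "((\<lambda>y. (f \<circ> inv_into U c) (?\<tau> y)) has_derivative
        (\<lambda>w. frechet_derivative (f \<circ> inv_into U c) (at (c p)) (frechet_derivative ?\<tau> (at (d p)) w))) (at (d p))"
      using has_derivative_compose[OF \<tau>[unfolded frechet_derivative_works] F[unfolded frechet_derivative_works]]
      unfolding \<tau>p .
    then have "((f \<circ> inv_into W d) has_derivative
        (\<lambda>w. frechet_derivative (f \<circ> inv_into U c) (at (c p)) (frechet_derivative ?\<tau> (at (d p)) w))) (at (d p))"
      by (rule has_derivative_transform_within_open[OF _ chart_open_map[OF assms(3) chart_open[OF assms(1)]]])
        (use assms in \<open>auto simp: chart_inv[OF assms(1)] chart_inv[OF assms(3)]\<close>)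
    from frechet_derivative_at[OF this] show ?thesis
      using True unfolding chart_vec_def by metis
  qed (simp add: chart_vec_def)
qed

lemma tangent_space_chart:
  assumes "(U, c) \<in> A" "p \<in> U"
  shows "tangent_space A p = range (chart_vec U c p)"
proof -
  have "tangent_space A p = {v. \<exists>(U, c)\<in>A. p \<in> U \<and> (\<exists>w. v = chart_vec U c p w)}"
    unfolding tangent_space_def by (simp add: chart_vec_def fun_eq_iff)
  also have "\<dots> = range (chart_vec U c p)"
  proof (intro equalityI subsetI)
    fix v assume "v \<in> {v. \<exists>(U, c)\<in>A. p \<in> U \<and> (\<exists>w. v = chart_vec U c p w)}"
    then obtain W d w where "(W, d) \<in> A" "p \<in> W" "v = chart_vec W d p w" by auto
    then show "v \<in> range (chart_vec U c p)" using chart_vec_change[OF assms, of W d w] by simp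
  qed (use assms in auto)
  finally show ?thesis .
qed

lemma chart_vec_add:
  assumes "(U, c) \<in> A" "p \<in> U"
  shows "chart_vec U c p (v + w) = chart_vec U c p v + chart_vec U c p w"
  by (auto simp: chart_vec_def fun_eq_iff
      linear_add[OF linear_frechet_derivative[OF smooth_near_differentiable[OF _ assms]]])

lemma chart_vec_scale:
  assumes "(U, c) \<in> A" "p \<in> U"
  shows "chart_vec U c p (a *\<^sub>R v) = a *\<^sub>v chart_vec U c p v"
  by (auto simp: chart_vec_def fun_eq_iff scale_vec_def
      linear_scale[OF linear_frechet_derivative[OF smooth_near_differentiable[OF _ assms]]])

text \<open>Coordinate functions read off the components, so a tangent vector determines
  \<open>w\<close>; \<open>tangent_not_multiple_of_reeb\<close> rests on this.\<close>

lemma chart_vec_coordinate: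
  assumes "(U, c) \<in> A" "p \<in> U"
  shows "chart_vec U c p w (\<lambda>q. c q \<bullet> b) = w \<bullet> b"
proof -
  have "((\<lambda>y. y \<bullet> b) has_derivative (\<lambda>w. w \<bullet> b)) (at (c p))"
    by (auto intro!: derivative_eq_intros)
  then have "(((\<lambda>q. c q \<bullet> b) \<circ> inv_into U c) has_derivative (\<lambda>w. w \<bullet> b)) (at (c p))"
    by (rule has_derivative_transform_within_open[OF _ chart_image_open[OF assms(1)]])
      (use assms in \<open>auto simp: chart_inv\<close>)
  then show ?thesis
    using smooth_near_fun[OF smooth_fun_coordinate] assms unfolding chart_vec_def
    by (metis frechet_derivative_at)
qed

lemma tangent_add [simp]: "v \<in> tangent_space A p \<Longrightarrow> w \<in> tangent_space A p \<Longrightarrow> v + w \<in> tangent_space A p"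
  by (rule chart_at[of p]) (auto simp: tangent_space_chart chart_vec_add[symmetric])

lemma tangent_scale [simp]: "v \<in> tangent_space A p \<Longrightarrow> a *\<^sub>v v \<in> tangent_space A p"
  by (rule chart_at[of p]) (auto simp: tangent_space_chart chart_vec_scale[symmetric])

lemma uminus_scale_vec: "- v = (-1) *\<^sub>v v"
  by (simp add: scale_vec_def fun_eq_iff)

lemma tangent_uminus [simp]: "v \<in> tangent_space A p \<Longrightarrow> - v \<in> tangent_space A p"
  by (simp add: uminus_scale_vec)

lemma tangent_diff [simp]: "v \<in> tangent_space A p \<Longrightarrow> w \<in> tangent_space A p \<Longrightarrow> v - w \<in> tangent_space A p"
  using tangent_add[of v p "- w"] by simp

lemma tangent_zero [simp]: "0 \<in> tangent_space A p"
proof -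
  obtain U c where U: "(U, c) \<in> A" "p \<in> U" by (rule chart_at)
  then have "chart_vec U c p 0 \<in> tangent_space A p" by (simp add: tangent_space_chart)
  then have "0 *\<^sub>v chart_vec U c p 0 \<in> tangent_space A p" by (rule tangent_scale)
  then show ?thesis by (simp add: scale_vec_def zero_fun_def)
qed

lemma tangent_not_smooth: "v \<in> tangent_space A p \<Longrightarrow> \<not> smooth_near A p f \<Longrightarrow> v f = 0"
  by (rule chart_at[of p]) (auto simp: tangent_space_chart chart_vec_def)

text \<open>Agreement near \<open>p\<close> carries smoothness over as well: either both germs are
  smooth with the same derivative, or both receive the default value 0.\<close>

lemma tangent_cong:
  assumes v: "v \<in> tangent_space A p" and W: "open W" "p \<in> W" "\<And>q. q \<in> W \<Longrightarrow> f q = g q"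
  shows "v f = v g"
proof (cases "smooth_near A p f")
  case True
  obtain U c where U: "(U, c) \<in> A" "p \<in> U" by (rule chart_at)
  have "frechet_derivative (f \<circ> inv_into U c) (at (c p)) = frechet_derivative (g \<circ> inv_into U c) (at (c p))"
    by (rule frechet_derivative_transform_within_open[OF smooth_near_differentiable[OF True U]
          chart_open_map[OF U(1) W(1)]])
      (use U(2) W(2) in \<open>auto simp: chart_inv[OF U(1)] intro: W(3)\<close>)
  moreover have "smooth_near A p g" using True smooth_near_cong[of W p f g, OF W(1,2)] W(3) by simp
  ultimately show ?thesis
    using v True by (auto simp: tangent_space_chart[OF U] chart_vec_def)
next
  case False
  moreover have "\<not> smooth_near A p g" using False smooth_near_cong[of W p f g, OF W(1,2)] W(3) by simp
  ultimately show ?thesis using tangent_not_smooth[OF v] by simp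
qed

lemma tangent_const [simp]: "v \<in> tangent_space A p \<Longrightarrow> v (\<lambda>_. k) = 0"
  by (rule chart_at[of p]) (auto simp: tangent_space_chart chart_vec_def o_def)

lemma tangent_fun_add:
  assumes v: "v \<in> tangent_space A p" and f: "smooth_near A p f" and g: "smooth_near A p g"
  shows "v (\<lambda>q. f q + g q) = v f + v g"
proof -
  obtain U c where U: "(U, c) \<in> A" "p \<in> U" by (rule chart_at)
  have "((\<lambda>x. (f \<circ> inv_into U c) x + (g \<circ> inv_into U c) x) has_derivative
     (\<lambda>v. frechet_derivative (f \<circ> inv_into U c) (at (c p)) v
        + frechet_derivative (g \<circ> inv_into U c) (at (c p)) v)) (at (c p))"
    using smooth_near_differentiable[OF f U] smooth_near_differentiable[OF g U]
    by (intro has_derivative_add) (auto simp: frechet_derivative_works simp del: o_apply)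
  note D = this[THEN frechet_derivative_at, THEN sym, unfolded o_def]
  show ?thesis
    using v U f g smooth_near_add[OF f g]
    by (auto simp: tangent_space_chart[OF U] chart_vec_def o_def D)
qed

lemma tangent_fun_mult:
  assumes v: "v \<in> tangent_space A p" and f: "smooth_near A p f" and g: "smooth_near A p g"
  shows "v (\<lambda>q. f q * g q) = f p * v g + g p * v f"
proof -
  obtain U c where U: "(U, c) \<in> A" "p \<in> U" by (rule chart_at)
  have "((\<lambda>x. (f \<circ> inv_into U c) x * (g \<circ> inv_into U c) x) has_derivative
     (\<lambda>v. (f \<circ> inv_into U c) (c p) * frechet_derivative (g \<circ> inv_into U c) (at (c p)) v
        + frechet_derivative (f \<circ> inv_into U c) (at (c p)) v * (g \<circ> inv_into U c) (c p))) (at (c p))"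
    using smooth_near_differentiable[OF f U] smooth_near_differentiable[OF g U]
    by (intro has_derivative_mult) (auto simp: frechet_derivative_works simp del: o_apply)
  note D = this[THEN frechet_derivative_at, THEN sym, unfolded o_def]
  show ?thesis
    using v U f g smooth_near_mult[OF f g]
    by (auto simp: tangent_space_chart[OF U] chart_vec_def o_def D chart_inv[OF U])
qed

lemma tangent_fun_cmult:
  "v \<in> tangent_space A p \<Longrightarrow> smooth_near A p f \<Longrightarrow> v (\<lambda>q. k * f q) = k * v f"
  using tangent_fun_mult[of v p "\<lambda>_. k" f] by simp

text \<open>Valid for arbitrary \<open>f\<close>: \<open>f\<close> and its negative are smooth near
  \<open>p\<close> together, and otherwise both sides are 0 by convention.\<close>

lemma tangent_fun_minus:
  "v \<in> tangent_space A p \<Longrightarrow> v (\<lambda>q. - f q) = - v f"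
  using tangent_fun_cmult[of v p f "-1"] tangent_not_smooth[of v p f] smooth_near_minus[of p f]
    tangent_not_smooth[of v p "\<lambda>q. - f q"] smooth_near_minus[of p "\<lambda>q. - f q"]
  by (cases "smooth_near A p f") auto

lemma tangent_fun_diff:
  "v \<in> tangent_space A p \<Longrightarrow> smooth_near A p f \<Longrightarrow> smooth_near A p g \<Longrightarrow> v (\<lambda>q. f q - g q) = v f - v g"
  using tangent_fun_add[of v p f "\<lambda>q. - g q"] smooth_near_minus[of p g] tangent_fun_minus[of v p g] by simp

section \<open>Germs of vector fields\<close>

text \<open>Working with germs at \<open>p\<close> instead of explicit domains turns the closure
  properties into simplification rules that need no shared open set.\<close>

definition field_near :: "'a \<Rightarrow> 'a vfield \<Rightarrow> bool" where
  "field_near p X \<longleftrightarrow> (\<exists>U. p \<in> U \<and> vector_field A U X)"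

lemma vector_field_open: "vector_field A U X \<Longrightarrow> open U"
  by (simp add: vector_field_def)

lemma vector_field_tangent: "vector_field A U X \<Longrightarrow> p \<in> U \<Longrightarrow> X p \<in> tangent_space A p"
  by (simp add: vector_field_def)

lemma vector_field_fun: "vector_field A U X \<Longrightarrow> smooth_fun A W f \<Longrightarrow> W \<subseteq> U \<Longrightarrow> smooth_fun A W (\<lambda>p. X p f)"
  by (simp add: vector_field_def)

lemma vector_field_subset: "vector_field A U X \<Longrightarrow> open V \<Longrightarrow> V \<subseteq> U \<Longrightarrow> vector_field A V X"
  unfolding vector_field_def by blast

lemma vector_field_cong:
  assumes "\<And>p. p \<in> U \<Longrightarrow> X p = Y p"
  shows "vector_field A U X \<longleftrightarrow> vector_field A U Y"
proof -
  have "smooth_fun A W (\<lambda>p. X p f) \<longleftrightarrow> smooth_fun A W (\<lambda>p. Y p f)" if "W \<subseteq> U" for W f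
    using that assms by (intro smooth_fun_cong) auto
  then show ?thesis using assms unfolding vector_field_def by auto
qed

lemma vector_field_add: "vector_field A U X \<Longrightarrow> vector_field A U Y \<Longrightarrow> vector_field A U (X + Y)"
  unfolding vector_field_def by (simp add: smooth_fun_add)

lemma vector_field_scale:
  assumes "smooth_fun A U f" "vector_field A U X"
  shows "vector_field A U (f *\<^sub>F X)"
  using assms smooth_fun_subset[OF assms(1)] smooth_fun_open
  unfolding vector_field_def scale_field_def by (auto intro!: smooth_fun_mult)

lemma field_nearI: "vector_field A U X \<Longrightarrow> p \<in> U \<Longrightarrow> field_near p X"
  unfolding field_near_def by blast

lemma field_near_tangent [simp]: "field_near p X \<Longrightarrow> X p \<in> tangent_space A p"
  unfolding field_near_def using vector_field_tangent by blast

lemma field_near_on: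
  assumes "field_near p X" "open W" "p \<in> W"
  obtains V where "V \<subseteq> W" "p \<in> V" "vector_field A V X"
proof -
  obtain U where "p \<in> U" "vector_field A U X" using assms(1) unfolding field_near_def by blast
  then show ?thesis
    using that[of "U \<inter> W"] assms vector_field_subset[of U X "U \<inter> W"] vector_field_open[of U X] by blast
qed

lemma field_near_eventually: "field_near p X \<Longrightarrow> \<forall>\<^sub>F q in nhds p. field_near q X"
  unfolding field_near_def eventually_nhds using vector_field_open by blast

lemma smooth_near_eventually: "smooth_near A p f \<Longrightarrow> \<forall>\<^sub>F q in nhds p. smooth_near A q f"
  unfolding smooth_near_def eventually_nhds using smooth_fun_open by blast

lemma tangent_eventually_cong:
  assumes "v \<in> tangent_space A p" "\<forall>\<^sub>F q in nhds p. f q = g q"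
  shows "v f = v g"
  using assms tangent_cong unfolding eventually_nhds by metis

lemma smooth_near_eventually_cong:
  assumes "\<forall>\<^sub>F q in nhds p. f q = g q"
  shows "smooth_near A p f \<longleftrightarrow> smooth_near A p g"
proof -
  obtain W where "open W" "p \<in> W" "\<And>q. q \<in> W \<Longrightarrow> f q = g q"
    using assms unfolding eventually_nhds by blast
  then show ?thesis by (rule smooth_near_cong)
qed

lemma field_near_cong:
  assumes "\<forall>\<^sub>F q in nhds p. X q = Y q"
  shows "field_near p X \<longleftrightarrow> field_near p Y"
proof -
  obtain W where W: "open W" "p \<in> W" "\<And>q. q \<in> W \<Longrightarrow> X q = Y q"
    using assms unfolding eventually_nhds by blast
  have *: "field_near p Y" if X: "field_near p X" and eq: "\<And>q. q \<in> W \<Longrightarrow> X q = Y q" for X Y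
  proof -
    obtain V where V: "V \<subseteq> W" "p \<in> V" "vector_field A V X"
      by (rule field_near_on[OF X W(1,2)])
    then have "vector_field A V Y" using vector_field_cong[of V X Y] eq by blast
    then show ?thesis using V(2) by (rule field_nearI)
  qed
  show ?thesis using *[of X Y] *[of Y X] W(3) by auto
qed

lemma field_near_add [simp]:
  assumes "field_near p X" "field_near p Y"
  shows "field_near p (X + Y)"
proof -
  obtain U where U: "p \<in> U" "vector_field A U X" using assms(1) unfolding field_near_def by blast
  obtain V where V: "V \<subseteq> U" "p \<in> V" "vector_field A V Y"
    by (rule field_near_on[OF assms(2) vector_field_open[OF U(2)] U(1)])
  show ?thesis
    using vector_field_add[OF vector_field_subset[OF U(2) vector_field_open[OF V(3)] V(1)] V(3)] V(2)
    by (rule field_nearI)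
qed

lemma field_near_scale [simp]:
  assumes "smooth_near A p f" "field_near p X"
  shows "field_near p (f *\<^sub>F X)"
proof -
  obtain U where U: "p \<in> U" "vector_field A U X" using assms(2) unfolding field_near_def by blast
  obtain V where V: "V \<subseteq> U" "p \<in> V" "smooth_fun A V f"
    by (rule smooth_near_obtain[OF assms(1) vector_field_open[OF U(2)] U(1)])
  show ?thesis
    using vector_field_scale[OF V(3) vector_field_subset[OF U(2) smooth_fun_open[OF V(3)] V(1)]] V(2)
    by (rule field_nearI)
qed

lemma uminus_scale_field: "- X = (\<lambda>_. -1) *\<^sub>F X"
  by (simp add: scale_field_def fun_eq_iff)

lemma field_near_uminus [simp]: "field_near p X \<Longrightarrow> field_near p (- X)"
  unfolding uminus_scale_field by simp

lemma field_near_diff [simp]: "field_near p X \<Longrightarrow> field_near p Y \<Longrightarrow> field_near p (X - Y)"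
  using field_near_add[of p X "- Y"] by simp

lemma smooth_near_field [simp]:
  assumes "field_near p X" "smooth_near A p f"
  shows "smooth_near A p (\<lambda>q. X q f)"
proof -
  obtain U where U: "p \<in> U" "vector_field A U X" using assms(1) unfolding field_near_def by blast
  obtain V where V: "V \<subseteq> U" "p \<in> V" "smooth_fun A V f"
    by (rule smooth_near_obtain[OF assms(2) vector_field_open[OF U(2)] U(1)])
  show ?thesis using vector_field_fun[OF U(2) V(3,1)] V(2) by (rule smooth_near_fun)
qed

text \<open>Read in another chart, the derivative of \<open>f\<close> along a constant coordinate
  vector is a directional derivative composed with a transition map, hence smooth.\<close>

lemma vector_field_chart_vec:
  assumes U: "(U, c) \<in> A"
  shows "vector_field A U (\<lambda>q. chart_vec U c q w)"
  unfolding vector_field_def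
proof (intro conjI ballI allI impI)
  show "open U" using U by (rule chart_open)
next
  fix p assume "p \<in> U"
  then show "chart_vec U c p w \<in> tangent_space A p" using tangent_space_chart[OF U] by simp
next
  fix W f assume "W \<subseteq> U \<and> smooth_fun A W f"
  then have W: "W \<subseteq> U" and f: "smooth_fun A W f" by auto
  let ?f = "\<lambda>y. frechet_derivative (f \<circ> inv_into U c) (at y) w"
  show "smooth_fun A W (\<lambda>q. chart_vec U c q w f)"
  proof (rule smooth_funI)
    show "open W" using f by (rule smooth_fun_open)
  next
    fix V d assume V: "(V, d) \<in> A"
    have oV: "open (d ` (V \<inter> W))" and oU: "open (c ` (U \<inter> W))"
      using chart_open_map U V smooth_fun_open[OF f] by auto
    have s: "smooth_on (d ` (V \<inter> W)) (\<lambda>x. ?f ((c \<circ> inv_into V d) x))"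
    proof (rule smooth_on_compose[OF oV oU])
      show "(c \<circ> inv_into V d) ` d ` (V \<inter> W) \<subseteq> c ` (U \<inter> W)" using W by (auto simp: chart_inv[OF V])
      show "smooth_on (d ` (V \<inter> W)) (c \<circ> inv_into V d)"
        by (rule smooth_on_subset[OF transition_smooth[OF V U]]) (use W in auto)
      show "smooth_on (c ` (U \<inter> W)) ?f"
        by (rule smooth_on_deriv[OF smooth_fun_chart[OF f U]])
    qed
    have eq: "?f ((c \<circ> inv_into V d) x) = ((\<lambda>q. chart_vec U c q w f) \<circ> inv_into V d) x"
      if x: "x \<in> d ` (V \<inter> W)" for x
    proof -
      obtain q where q: "q \<in> V" "q \<in> W" "x = d q" using x by blast
      then show ?thesis
        using smooth_near_fun[OF f q(2)] by (simp add: chart_inv[OF V] chart_vec_def)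
    qed
    show "smooth_on (d ` (V \<inter> W)) ((\<lambda>q. chart_vec U c q w f) \<circ> inv_into V d)"
      by (rule smooth_on_cong[OF oV, THEN iffD1, OF _ s]) (rule eq)
  qed
qed

lemma field_extension:
  assumes "v \<in> tangent_space A p"
  obtains X where "field_near p X" "X p = v"
proof -
  obtain U c where U: "(U, c) \<in> A" "p \<in> U" by (rule chart_at)
  then obtain w where "v = chart_vec U c p w" using assms tangent_space_chart by blast
  then show ?thesis
    using that[of "\<lambda>q. chart_vec U c q w"] field_nearI[OF vector_field_chart_vec[OF U(1)] U(2)] by blast
qed

section \<open>The Lie bracket\<close>

lemma lie_bracket_apply:
  "smooth_near A p f \<Longrightarrow> lie_bracket A X Y p f = X p (\<lambda>q. Y q f) - Y p (\<lambda>q. X q f)"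
  by (simp add: lie_bracket_def)

lemma lie_bracket_antisym: "lie_bracket A Y X p = - lie_bracket A X Y p"
  by (simp add: lie_bracket_def fun_eq_iff)

lemma lie_bracket_cong:
  assumes "field_near p X" "field_near p Y"
    and "\<forall>\<^sub>F q in nhds p. X q = X' q" "\<forall>\<^sub>F q in nhds p. Y q = Y' q"
  shows "lie_bracket A X Y p = lie_bracket A X' Y' p"
proof
  fix f
  have "X p = X' p" "Y p = Y' p" using assms(3,4) eventually_nhds_x_imp_x by auto
  moreover have "X p (\<lambda>q. Y q f) = X p (\<lambda>q. Y' q f)"
    by (rule tangent_eventually_cong) (use assms in \<open>auto elim: eventually_mono\<close>)
  moreover have "Y p (\<lambda>q. X q f) = Y p (\<lambda>q. X' q f)"
    by (rule tangent_eventually_cong) (use assms in \<open>auto elim: eventually_mono\<close>)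
  ultimately show "lie_bracket A X Y p f = lie_bracket A X' Y' p f"
    by (simp add: lie_bracket_def)
qed

text \<open>Each double bracket expands into four iterated derivatives of \<open>f\<close>, and the
  twelve terms cancel in pairs. On germs that are not smooth every bracket is 0 by
  definition.\<close>

lemma jacobi_identity:
  assumes X: "field_near p X" and Y: "field_near p Y" and Z: "field_near p Z"
  shows "lie_bracket A X (lie_bracket A Y Z) p + lie_bracket A Y (lie_bracket A Z X) p
    + lie_bracket A Z (lie_bracket A X Y) p = 0"
proof
  fix f
  have *: "lie_bracket A X (lie_bracket A Y Z) p f =
     X p (\<lambda>q. Y q (\<lambda>r. Z r f)) - X p (\<lambda>q. Z q (\<lambda>r. Y r f))
     - (Y p (\<lambda>q. Z q (\<lambda>r. X r f)) - Z p (\<lambda>q. Y q (\<lambda>r. X r f)))"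
    if f: "smooth_near A p f" and X: "field_near p X" and Y: "field_near p Y" and Z: "field_near p Z"
    for X Y Z
  proof -
    have "X p (\<lambda>q. lie_bracket A Y Z q f) = X p (\<lambda>q. Y q (\<lambda>r. Z r f) - Z q (\<lambda>r. Y r f))"
      by (rule tangent_eventually_cong[OF field_near_tangent[OF X]])
        (use smooth_near_eventually[OF f] in \<open>auto elim!: eventually_mono simp: lie_bracket_apply\<close>)
    also have "\<dots> = X p (\<lambda>q. Y q (\<lambda>r. Z r f)) - X p (\<lambda>q. Z q (\<lambda>r. Y r f))"
      using X Y Z f by (simp add: tangent_fun_diff[of "X p" p])
    finally show ?thesis
      using f X by (simp add: lie_bracket_apply)
  qed
  show "(lie_bracket A X (lie_bracket A Y Z) p + lie_bracket A Y (lie_bracket A Z X) p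
    + lie_bracket A Z (lie_bracket A X Y) p) f = 0 f"
  proof (cases "smooth_near A p f")
    case True
    then show ?thesis using *[OF True X Y Z] *[OF True Y Z X] *[OF True Z X Y] by simp
  qed (simp add: lie_bracket_def)
qed

end

section \<open>The Levi-Civita connection\<close>

locale riemannian = manifold A for A :: "'a::{t2_space, second_countable_topology} chart set" +
  fixes g :: "'a \<Rightarrow> 'a tvec \<Rightarrow> 'a tvec \<Rightarrow> real"
    and D :: "'a vfield \<Rightarrow> 'a vfield \<Rightarrow> 'a vfield"
  assumes metric: "riemannian_metric A g"
    and levi_civita: "levi_civita A g D"
begin

lemma g_sym: "v \<in> tangent_space A p \<Longrightarrow> w \<in> tangent_space A p \<Longrightarrow> g p v w = g p w v"
  and g_pos: "v \<in> tangent_space A p \<Longrightarrow> v \<noteq> 0 \<Longrightarrow> g p v v > 0"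
  and g_linear: "v \<in> tangent_space A p \<Longrightarrow> linear_form_on (tangent_space A p) (g p v)"
  using metric unfolding riemannian_metric_def by auto

lemma g_add_right: "v \<in> tangent_space A p \<Longrightarrow> w \<in> tangent_space A p \<Longrightarrow> x \<in> tangent_space A p \<Longrightarrow>
    g p x (v + w) = g p x v + g p x w"
  and g_scale_right: "v \<in> tangent_space A p \<Longrightarrow> x \<in> tangent_space A p \<Longrightarrow> g p x (a *\<^sub>v v) = a * g p x v"
  using g_linear unfolding linear_form_on_def by auto

lemma g_add_left: "v \<in> tangent_space A p \<Longrightarrow> w \<in> tangent_space A p \<Longrightarrow> x \<in> tangent_space A p \<Longrightarrow>
    g p (v + w) x = g p v x + g p w x"
  by (metis g_add_right g_sym tangent_add)

lemma g_scale_left: "v \<in> tangent_space A p \<Longrightarrow> x \<in> tangent_space A p \<Longrightarrow> g p (a *\<^sub>v v) x = a * g p v x"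
  by (metis g_scale_right g_sym tangent_scale)

lemma g_uminus_right: "v \<in> tangent_space A p \<Longrightarrow> x \<in> tangent_space A p \<Longrightarrow> g p x (- v) = - g p x v"
  unfolding uminus_scale_vec by (simp add: g_scale_right)

lemma g_uminus_left: "v \<in> tangent_space A p \<Longrightarrow> x \<in> tangent_space A p \<Longrightarrow> g p (- v) x = - g p v x"
  unfolding uminus_scale_vec by (simp add: g_scale_left)

lemma g_diff_right: "v \<in> tangent_space A p \<Longrightarrow> w \<in> tangent_space A p \<Longrightarrow> x \<in> tangent_space A p \<Longrightarrow>
    g p x (v - w) = g p x v - g p x w"
  using g_add_right[of v p "- w" x] by (simp add: g_uminus_right)

lemma g_diff_left: "v \<in> tangent_space A p \<Longrightarrow> w \<in> tangent_space A p \<Longrightarrow> x \<in> tangent_space A p \<Longrightarrow>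
    g p (v - w) x = g p v x - g p w x"
  using g_add_left[of v p "- w" x] by (simp add: g_uminus_left)

lemma g_zero_left [simp]: "x \<in> tangent_space A p \<Longrightarrow> g p 0 x = 0"
  using g_diff_left[of x p x x] by simp

lemma g_zero_right [simp]: "x \<in> tangent_space A p \<Longrightarrow> g p x 0 = 0"
  using g_diff_right[of x p x x] by simp

lemmas g_simps = g_add_left g_add_right g_scale_left g_scale_right g_uminus_left g_uminus_right
  g_diff_left g_diff_right

lemma g_eqI:
  assumes "v \<in> tangent_space A p" "w \<in> tangent_space A p"
    and "\<And>x. x \<in> tangent_space A p \<Longrightarrow> g p v x = g p w x"
  shows "v = w"
proof (rule ccontr)
  assume "v \<noteq> w"
  then have "g p (v - w) (v - w) > 0" using assms(1,2) by (intro g_pos) auto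
  moreover have "g p (v - w) (v - w) = 0" using assms by (simp add: g_diff_left)
  ultimately show False by simp
qed

lemma smooth_near_metric [simp]:
  assumes "field_near p X" "field_near p Y"
  shows "smooth_near A p (\<lambda>q. g q (X q) (Y q))"
proof -
  obtain U where U: "p \<in> U" "vector_field A U X" using assms(1) unfolding field_near_def by blast
  obtain V where V: "V \<subseteq> U" "p \<in> V" "vector_field A V Y"
    by (rule field_near_on[OF assms(2) vector_field_open[OF U(2)] U(1)])
  then have "smooth_fun A V (ap2 g X Y)"
    using metric vector_field_subset[OF U(2) vector_field_open[OF V(3)] V(1)]
    unfolding riemannian_metric_def by blast
  then show ?thesis using V(2) unfolding ap2_def by (rule smooth_near_fun)
qed

lemma connection_on:
  assumes "vector_field A U X" "vector_field A U Y" "vector_field A U Z" "smooth_fun A U f"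
  shows "vector_field A U (D X Y)"
    and "p \<in> U \<Longrightarrow> D (X + Y) Z p = D X Z p + D Y Z p"
    and "p \<in> U \<Longrightarrow> D (f *\<^sub>F X) Z p = f p *\<^sub>v D X Z p"
    and "p \<in> U \<Longrightarrow> D X (Y + Z) p = D X Y p + D X Z p"
    and "p \<in> U \<Longrightarrow> D X (f *\<^sub>F Y) p = X p f *\<^sub>v Y p + f p *\<^sub>v D X Y p"
    and "p \<in> U \<Longrightarrow> D X Y p - D Y X p = lie_bracket A X Y p"
    and "p \<in> U \<Longrightarrow> X p (\<lambda>q. g q (Y q) (Z q)) = g p (D X Y p) (Z p) + g p (Y p) (D X Z p)"
proof -
  have *: "vector_field A U (D X Y) \<and>
        (\<forall>p\<in>U. D (X + Y) Z p = D X Z p + D Y Z p \<and>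
               D (f *\<^sub>F X) Z p = f p *\<^sub>v D X Z p \<and>
               D X (Y + Z) p = D X Y p + D X Z p \<and>
               D X (f *\<^sub>F Y) p = X p f *\<^sub>v Y p + f p *\<^sub>v D X Y p \<and>
               D X Y p - D Y X p = lie_bracket A X Y p \<and>
               X p (ap2 g Y Z) = ap2 g (D X Y) Z p + ap2 g Y (D X Z) p)"
    using levi_civita[unfolded levi_civita_def, rule_format, of U X Y Z f] assms by blast
  show "vector_field A U (D X Y)"
    and "p \<in> U \<Longrightarrow> D (X + Y) Z p = D X Z p + D Y Z p"
    and "p \<in> U \<Longrightarrow> D (f *\<^sub>F X) Z p = f p *\<^sub>v D X Z p"
    and "p \<in> U \<Longrightarrow> D X (Y + Z) p = D X Y p + D X Z p"
    and "p \<in> U \<Longrightarrow> D X (f *\<^sub>F Y) p = X p f *\<^sub>v Y p + f p *\<^sub>v D X Y p"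
    and "p \<in> U \<Longrightarrow> D X Y p - D Y X p = lie_bracket A X Y p"
    and "p \<in> U \<Longrightarrow> X p (\<lambda>q. g q (Y q) (Z q)) = g p (D X Y p) (Z p) + g p (Y p) (D X Z p)"
    using * by (auto simp: ap2_def)
qed

text \<open>The axioms of \<open>levi_civita\<close> speak of several fields and a function on one
  open set, whereas germs at \<open>p\<close> come with different ones.\<close>

lemma common_domain:
  assumes "field_near p X" "field_near p Y" "field_near p Z" "smooth_near A p f"
  obtains U where "p \<in> U" "vector_field A U X" "vector_field A U Y" "vector_field A U Z" "smooth_fun A U f"
proof -
  obtain U1 where U1: "p \<in> U1" "vector_field A U1 X" using assms(1) unfolding field_near_def by blast
  obtain U2 where U2: "U2 \<subseteq> U1" "p \<in> U2" "vector_field A U2 Y"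
    by (rule field_near_on[OF assms(2) vector_field_open[OF U1(2)] U1(1)])
  obtain U3 where U3: "U3 \<subseteq> U2" "p \<in> U3" "vector_field A U3 Z"
    by (rule field_near_on[OF assms(3) vector_field_open[OF U2(3)] U2(2)])
  obtain U4 where U4: "U4 \<subseteq> U3" "p \<in> U4" "smooth_fun A U4 f"
    by (rule smooth_near_obtain[OF assms(4) vector_field_open[OF U3(3)] U3(2)])
  have o: "open U4" using U4(3) by (rule smooth_fun_open)
  show ?thesis
    by (rule that[OF U4(2) vector_field_subset[OF U1(2) o] vector_field_subset[OF U2(3) o]
          vector_field_subset[OF U3(3) o] U4(3)]) (use U2(1) U3(1) U4(1) in blast)+
qed

lemma D_field [simp]:
  assumes "field_near p X" "field_near p Y"
  shows "field_near p (D X Y)"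
  by (rule common_domain[OF assms assms(1) smooth_near_const[of p 0]])
    (rule field_nearI[OF connection_on(1)], assumption+)

lemma D_add_left:
  assumes "field_near p X" "field_near p Y" "field_near p Z"
  shows "D (X + Y) Z p = D X Z p + D Y Z p"
  by (rule common_domain[OF assms smooth_near_const[of p 0]]) (rule connection_on(2), assumption+)

lemma D_scale_left:
  assumes "smooth_near A p f" "field_near p X" "field_near p Z"
  shows "D (f *\<^sub>F X) Z p = f p *\<^sub>v D X Z p"
  by (rule common_domain[OF assms(2,3,3,1)]) (rule connection_on(3), assumption+)

lemma D_add_right:
  assumes "field_near p X" "field_near p Y" "field_near p Z"
  shows "D X (Y + Z) p = D X Y p + D X Z p"
  by (rule common_domain[OF assms smooth_near_const[of p 0]]) (rule connection_on(4), assumption+)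

lemma D_scale_right:
  assumes "smooth_near A p f" "field_near p X" "field_near p Y"
  shows "D X (f *\<^sub>F Y) p = X p f *\<^sub>v Y p + f p *\<^sub>v D X Y p"
  by (rule common_domain[OF assms(2,3,3,1)]) (rule connection_on(5), assumption+)

lemma torsion_free:
  assumes "field_near p X" "field_near p Y"
  shows "lie_bracket A X Y p = D X Y p - D Y X p"
  by (rule common_domain[OF assms assms(1) smooth_near_const[of p 0]])
    (rule connection_on(6)[symmetric], assumption+)

lemma metric_compatible:
  assumes "field_near p X" "field_near p Y" "field_near p Z"
  shows "X p (\<lambda>q. g q (Y q) (Z q)) = g p (D X Y p) (Z p) + g p (Y p) (D X Z p)"
  by (rule common_domain[OF assms smooth_near_const[of p 0]]) (rule connection_on(7), assumption+)

lemma torsion_free_eventually: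
  assumes "field_near p X" "field_near p Y"
  shows "\<forall>\<^sub>F q in nhds p. lie_bracket A X Y q = (D X Y - D Y X) q"
  using field_near_eventually[OF assms(1)] field_near_eventually[OF assms(2)]
  by eventually_elim (simp add: torsion_free)

text \<open>Near \<open>p\<close> the bracket equals \<open>D X Y - D Y X\<close>, so it inherits
  smoothness from the connection.\<close>

lemma lie_bracket_field [simp]:
  assumes "field_near p X" "field_near p Y"
  shows "field_near p (lie_bracket A X Y)"
  using assms field_near_cong[OF torsion_free_eventually[OF assms]] by (simp del: minus_apply)

lemma koszul:
  assumes X: "field_near p X" and Y: "field_near p Y" and Z: "field_near p Z"
  shows "2 * g p (D X Y p) (Z p) =
    X p (\<lambda>q. g q (Y q) (Z q)) + Y p (\<lambda>q. g q (Z q) (X q)) - Z p (\<lambda>q. g q (X q) (Y q))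
    + g p (lie_bracket A X Y p) (Z p) - g p (lie_bracket A X Z p) (Y p) - g p (lie_bracket A Y Z p) (X p)"
  using assms
  by (simp add: metric_compatible torsion_free g_diff_left
      g_sym[of "Y p" p] g_sym[of "X p" p] g_sym[of "Z p" p])

text \<open>The axioms of \<^const>\<open>levi_civita\<close> do not state that \<open>D X Y p\<close> depends on germs only; this comes from
  Koszul's formula, whose right-hand side visibly has that property.\<close>

lemma D_cong:
  assumes X: "field_near p X" and Y: "field_near p Y"
    and eX: "\<forall>\<^sub>F q in nhds p. X q = X' q" and eY: "\<forall>\<^sub>F q in nhds p. Y q = Y' q"
  shows "D X Y p = D X' Y' p"
proof (rule g_eqI)
  have X': "field_near p X'" and Y': "field_near p Y'"
    using field_near_cong[OF eX] field_near_cong[OF eY] X Y by auto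
  then show "D X Y p \<in> tangent_space A p" "D X' Y' p \<in> tangent_space A p" using X Y by simp_all
  fix x assume "x \<in> tangent_space A p"
  then obtain Z where Z: "field_near p Z" "Z p = x" by (rule field_extension)
  have v: "X p = X' p" "Y p = Y' p" using eX eY eventually_nhds_x_imp_x by auto
  have eZ: "\<forall>\<^sub>F q in nhds p. Z q = Z q" by simp
  have "lie_bracket A X Y p = lie_bracket A X' Y' p" "lie_bracket A X Z p = lie_bracket A X' Z p"
     "lie_bracket A Y Z p = lie_bracket A Y' Z p"
    using lie_bracket_cong[OF X Y eX eY] lie_bracket_cong[OF X Z(1) eX eZ] lie_bracket_cong[OF Y Z(1) eY eZ]
    by auto
  moreover have "X' p (\<lambda>q. g q (Y q) (Z q)) = X' p (\<lambda>q. g q (Y' q) (Z q))"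
    by (rule tangent_eventually_cong[OF field_near_tangent[OF X']])
      (use eY in \<open>auto elim: eventually_mono\<close>)
  moreover have "Y' p (\<lambda>q. g q (Z q) (X q)) = Y' p (\<lambda>q. g q (Z q) (X' q))"
    by (rule tangent_eventually_cong[OF field_near_tangent[OF Y']])
      (use eX in \<open>auto elim: eventually_mono\<close>)
  moreover have "Z p (\<lambda>q. g q (X q) (Y q)) = Z p (\<lambda>q. g q (X' q) (Y' q))"
    by (rule tangent_eventually_cong[OF field_near_tangent[OF Z(1)]])
      (use eX eY in eventually_elim, auto)
  ultimately have "2 * g p (D X Y p) (Z p) = 2 * g p (D X' Y' p) (Z p)"
    unfolding koszul[OF X Y Z(1)] koszul[OF X' Y' Z(1)] by (simp add: v)
  then show "g p (D X Y p) x = g p (D X' Y' p) x" using Z(2) by simp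
qed

lemma D_uminus_left:
  assumes "field_near p X" "field_near p Y"
  shows "D (- X) Y p = - D X Y p"
  unfolding uminus_scale_field using D_scale_left[OF smooth_near_const assms] by (simp add: fun_eq_iff)

lemma D_uminus_right:
  assumes "field_near p X" "field_near p Y"
  shows "D X (- Y) p = - D X Y p"
  unfolding uminus_scale_field using D_scale_right[OF smooth_near_const assms] tangent_const[OF field_near_tangent[OF assms(1)]]
  by (simp add: fun_eq_iff)

lemma D_diff_right:
  assumes "field_near p X" "field_near p Y" "field_near p Z"
  shows "D X (Y - Z) p = D X Y p - D X Z p"
  using D_add_right[of p X Y "- Z"] assms by (simp add: D_uminus_right)

lemma lie_bracket_add_right:
  assumes "field_near p X" "field_near p Y" "field_near p Z"
  shows "lie_bracket A X (Y + Z) p = lie_bracket A X Y p + lie_bracket A X Z p"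
  using assms by (simp add: torsion_free D_add_left D_add_right)

lemma lie_bracket_scale_right:
  assumes "smooth_near A p f" "field_near p X" "field_near p Y"
  shows "lie_bracket A X (f *\<^sub>F Y) p = X p f *\<^sub>v Y p + f p *\<^sub>v lie_bracket A X Y p"
  using assms by (simp add: torsion_free D_scale_left D_scale_right fun_eq_iff algebra_simps)

section \<open>Orthonormal frames and tensoriality\<close>

lemma frame_field: "orthonormal_frame A g U E \<Longrightarrow> p \<in> U \<Longrightarrow> i \<in> {1..3} \<Longrightarrow> field_near p (E i)"
  unfolding orthonormal_frame_def using field_nearI by blast

lemma frame_open: "orthonormal_frame A g U E \<Longrightarrow> open U"
  unfolding orthonormal_frame_def ball_1_3 using vector_field_open by blast

lemma frame_inner:
  "orthonormal_frame A g U E \<Longrightarrow> p \<in> U \<Longrightarrow> i \<in> {1..3} \<Longrightarrow> j \<in> {1..3} \<Longrightarrow>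
    g p (E i p) (E j p) = (if i = j then 1 else 0)"
  unfolding orthonormal_frame_def by blast

lemma g_sum3_left:
  assumes "\<And>i. i \<in> {1..3::nat} \<Longrightarrow> e i \<in> tangent_space A p" "x \<in> tangent_space A p"
  shows "(\<Sum>i=1..3. a i *\<^sub>v e i) \<in> tangent_space A p"
    and "g p (\<Sum>i=1..3. a i *\<^sub>v e i) x = (\<Sum>i=1..3. a i * g p (e i) x)"
  using assms unfolding sum_1_3 by (simp_all add: g_simps)

text \<open>In a chart the frame becomes three vectors \<open>w 1\<close>, \<open>w 2\<close>,
  \<open>w 3\<close> of \<open>real^3\<close>. Orthonormality makes them independent, so by
  dimension they span, and pairing with \<open>E j\<close> identifies the coefficients.\<close>

lemma frame_expand:
  assumes E: "orthonormal_frame A g U E" "p \<in> U" and v: "v \<in> tangent_space A p"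
  shows "v = (\<Sum>i=1..3. g p v (E i p) *\<^sub>v E i p)"
proof -
  obtain W c where W: "(W, c) \<in> A" "p \<in> W" by (rule chart_at)
  note T = tangent_space_chart[OF W]
  have Ei: "E i p \<in> tangent_space A p" if "i \<in> {1..3}" for i
    using frame_field[OF E that] by simp
  have "\<exists>w. E i p = chart_vec W c p w" if "i \<in> {1..3}" for i
    using Ei[OF that] unfolding T by auto
  then obtain w where w: "\<And>i. i \<in> {1..3} \<Longrightarrow> E i p = chart_vec W c p (w i)" by metis
  have lin: "chart_vec W c p (\<Sum>i=1..3. a i *\<^sub>R w i) = (\<Sum>i=1..3. a i *\<^sub>v E i p)" for a
    unfolding sum_1_3 using w by (simp add: chart_vec_add[OF W] chart_vec_scale[OF W])
  have coeff: "g p (\<Sum>i=1..3. a i *\<^sub>v E i p) (E j p) = a j" if j: "j \<in> {1..3}" for a j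
  proof -
    have "g p (\<Sum>i=1..3. a i *\<^sub>v E i p) (E j p) = (\<Sum>i=1..3. a i * g p (E i p) (E j p))"
      using Ei by (intro g_sum3_left(2)) (use j in auto)
    also have "\<dots> = (\<Sum>i=1..3. if i = j then a i else 0)"
      using frame_inner[OF E _ j] by (intro sum.cong) auto
    also have "\<dots> = a j" using j by simp
    finally show ?thesis .
  qed
  have inj: "inj_on w {1..3}"
  proof (rule inj_onI)
    fix i j assume "i \<in> {1..3::nat}" "j \<in> {1..3}" "w i = w j"
    then have "g p (E i p) (E i p) = g p (E i p) (E j p)" using w by simp
    then show "i = j" using frame_inner[OF E] \<open>i \<in> {1..3}\<close> \<open>j \<in> {1..3}\<close> by (metis zero_neq_one)
  qed
  have "independent (w ` {1..3})"
  proof (rule independent_if_scalars_zero)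
    fix f x assume f: "(\<Sum>x\<in>w ` {1..3}. f x *\<^sub>R x) = 0" and x: "x \<in> w ` {1..3::nat}"
    then obtain j where j: "j \<in> {1..3}" "x = w j" by blast
    have "(\<Sum>i=1..3. f (w i) *\<^sub>R w i) = 0" using f inj by (simp add: sum.reindex)
    then have "(\<Sum>i=1..3. f (w i) *\<^sub>v E i p) = chart_vec W c p 0" using lin[of "\<lambda>i. f (w i)"] by simp
    also have "\<dots> = 0" using chart_vec_scale[OF W, of 0 0] by (simp add: fun_eq_iff)
    finally show "f x = 0" using coeff[OF j(1), of "\<lambda>i. f (w i)"] j Ei[OF j(1)] by simp
  qed simp
  moreover have "card (w ` {1..3}) = DIM(real^3)" using inj by (simp add: card_image)
  ultimately have "span (w ` {1..3}) = UNIV"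
    using card_eq_dim[of "w ` {1..3}" UNIV] by (simp add: dim_UNIV) blast
  moreover obtain u where u: "v = chart_vec W c p u" using v unfolding T by auto
  ultimately have "u \<in> span (w ` {1..3})" by simp
  then obtain b where "u = (\<Sum>x\<in>w ` {1..3}. b x *\<^sub>R x)" unfolding span_finite[OF finite_imageI[OF finite_atLeastAtMost]] by auto
  then have "u = (\<Sum>i=1..3. b (w i) *\<^sub>R w i)" using inj by (simp add: sum.reindex)
  then have *: "v = (\<Sum>i=1..3. b (w i) *\<^sub>v E i p)" using lin u by simp
  then have "g p v (E j p) = b (w j)" if "j \<in> {1..3}" for j using coeff[OF that] by simp
  then show ?thesis using * by (metis (no_types, lifting) sum.cong)
qed

lemma frame_inner_expand:
  assumes E: "orthonormal_frame A g U E" "p \<in> U"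
    and v: "v \<in> tangent_space A p" and w: "w \<in> tangent_space A p"
  shows "g p v w = (\<Sum>i=1..3. g p v (E i p) * g p w (E i p))"
proof -
  have Ei: "E i p \<in> tangent_space A p" if "i \<in> {1..3}" for i
    using frame_field[OF E that] by simp
  have "g p v w = g p (\<Sum>i=1..3. g p v (E i p) *\<^sub>v E i p) w" using frame_expand[OF E v] by simp
  also have "\<dots> = (\<Sum>i=1..3. g p v (E i p) * g p (E i p) w)" by (rule g_sum3_left(2)[OF Ei w])
  also have "\<dots> = (\<Sum>i=1..3. g p v (E i p) * g p w (E i p))"
    using g_sym[OF w] Ei by (intro sum.cong) auto
  finally show ?thesis .
qed

text \<open>Linearity over smooth functions, at \<open>p\<close>. The last clause ties
  \<open>T\<close> to germs: a field equals its frame expansion only near \<open>p\<close>, and that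
  clause is what lets \<open>T\<close> be evaluated on the expansion.\<close>

definition tensorial :: "'a \<Rightarrow> ('a vfield \<Rightarrow> real) \<Rightarrow> bool" where
  "tensorial p T \<longleftrightarrow>
     (\<forall>X Y. field_near p X \<longrightarrow> field_near p Y \<longrightarrow> T (X + Y) = T X + T Y) \<and>
     (\<forall>f X. smooth_near A p f \<longrightarrow> field_near p X \<longrightarrow> T (f *\<^sub>F X) = f p * T X) \<and>
     (\<forall>X Y. field_near p X \<longrightarrow> (\<forall>\<^sub>F q in nhds p. X q = Y q) \<longrightarrow> T X = T Y)"

lemma tensorial_addD: "tensorial p T \<Longrightarrow> field_near p X \<Longrightarrow> field_near p Y \<Longrightarrow> T (X + Y) = T X + T Y"
  and tensorial_scaleD: "tensorial p T \<Longrightarrow> smooth_near A p f \<Longrightarrow> field_near p X \<Longrightarrow> T (f *\<^sub>F X) = f p * T X"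
  and tensorial_congD: "tensorial p T \<Longrightarrow> field_near p X \<Longrightarrow> \<forall>\<^sub>F q in nhds p. X q = Y q \<Longrightarrow> T X = T Y"
  unfolding tensorial_def by blast+

lemma tensorial_add: "tensorial p S \<Longrightarrow> tensorial p T \<Longrightarrow> tensorial p (\<lambda>X. S X + T X)"
  unfolding tensorial_def by (simp add: algebra_simps)

lemma tensorial_cmult: "tensorial p T \<Longrightarrow> tensorial p (\<lambda>X. c * T X)"
  unfolding tensorial_def by (simp add: algebra_simps)

lemma tensorial_diff: "tensorial p S \<Longrightarrow> tensorial p T \<Longrightarrow> tensorial p (\<lambda>X. S X - T X)"
  using tensorial_add[of p S "\<lambda>X. (-1) * T X"] tensorial_cmult[of p T "-1"] by simp

lemma tensorial_derivative: "tensorial p (\<lambda>X. X p f)"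
  unfolding tensorial_def by (auto simp: scale_field_apply dest: eventually_nhds_x_imp_x)

lemma tensorial_metric: "w \<in> tangent_space A p \<Longrightarrow> tensorial p (\<lambda>X. g p (X p) w)"
  unfolding tensorial_def by (auto simp: scale_field_apply g_simps dest: eventually_nhds_x_imp_x)

lemma tensorial_metric_right: "w \<in> tangent_space A p \<Longrightarrow> tensorial p (\<lambda>X. g p w (X p))"
  unfolding tensorial_def by (auto simp: scale_field_apply g_simps dest: eventually_nhds_x_imp_x)

lemma tensorial_expand:
  assumes E: "orthonormal_frame A g U E" "p \<in> U" and T: "tensorial p T" and X: "field_near p X"
  shows "T X = (\<Sum>i=1..3. g p (X p) (E i p) * T (E i))"
proof -
  let ?c = "\<lambda>i q. g q (X q) (E i q)"
  have Ei: "field_near p (E 1)" "field_near p (E 2)" "field_near p (E 3)"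
    using frame_field[OF E] by auto
  have c: "smooth_near A p (?c 1)" "smooth_near A p (?c 2)" "smooth_near A p (?c 3)"
    using X Ei by simp_all
  have "\<forall>\<^sub>F q in nhds p. q \<in> U" using frame_open[OF E(1)] E(2) by (rule eventually_nhds_in_open)
  then have "\<forall>\<^sub>F q in nhds p. X q = (?c 1 *\<^sub>F E 1 + ?c 2 *\<^sub>F E 2 + ?c 3 *\<^sub>F E 3) q"
    using field_near_eventually[OF X]
  proof eventually_elim
    case (elim q)
    show ?case using frame_expand[OF E(1) elim(1) field_near_tangent[OF elim(2)]]
      unfolding sum_1_3 by (simp add: scale_field_apply)
  qed
  then have "T X = T (?c 1 *\<^sub>F E 1 + ?c 2 *\<^sub>F E 2 + ?c 3 *\<^sub>F E 3)"
    by (rule tensorial_congD[OF T X])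
  also have "\<dots> = (\<Sum>i=1..3. ?c i p * T (E i))"
    unfolding sum_1_3 using Ei c by (simp add: tensorial_addD[OF T] tensorial_scaleD[OF T])
  finally show ?thesis .
qed

text \<open>The matrix of inner products \<open>g p (F i p) (E j p)\<close> is orthogonal: summing
  products of two columns over \<open>i\<close> is the expansion of an inner product of
  \<open>E\<close>-vectors in the frame \<open>F\<close>.\<close>

lemma trace_independent:
  assumes E: "orthonormal_frame A g U E" "p \<in> U" and F: "orthonormal_frame A g V F" "p \<in> V"
    and T1: "\<And>Y. field_near p Y \<Longrightarrow> tensorial p (\<lambda>X. T X Y)"
    and T2: "\<And>X. field_near p X \<Longrightarrow> tensorial p (T X)"
  shows "(\<Sum>i=1..3. T (F i) (F i)) = (\<Sum>i=1..3. T (E i) (E i))"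
proof -
  let ?a = "\<lambda>i j. g p (F i p) (E j p)"
  have fE: "field_near p (E i)" and fF: "field_near p (F i)" if "i \<in> {1..3}" for i
    using frame_field[OF E that] frame_field[OF F that] .
  have "T (F i) (F i) = (\<Sum>j=1..3. \<Sum>k=1..3. ?a i j * ?a i k * T (E j) (E k))"
    if i: "i \<in> {1..3}" for i
  proof -
    have "T (F i) (F i) = (\<Sum>j=1..3. ?a i j * T (E j) (F i))"
      by (rule tensorial_expand[OF E T1[OF fF[OF i]] fF[OF i]])
    also have "\<dots> = (\<Sum>j=1..3. ?a i j * (\<Sum>k=1..3. ?a i k * T (E j) (E k)))"
      using tensorial_expand[OF E T2[OF fE] fF[OF i]] by (intro sum.cong) auto
    finally show ?thesis by (simp add: sum_distrib_left mult.assoc)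
  qed
  then have "(\<Sum>i=1..3. T (F i) (F i))
      = (\<Sum>i=1..3. \<Sum>j=1..3. \<Sum>k=1..3. ?a i j * ?a i k * T (E j) (E k))" by simp
  also have "\<dots> = (\<Sum>j=1..3. \<Sum>k=1..3. \<Sum>i=1..3. ?a i j * ?a i k * T (E j) (E k))"
    by (subst sum.swap, rule sum.cong[OF refl], rule sum.swap)
  also have "\<dots> = (\<Sum>j=1..3. \<Sum>k=1..3. (if j = k then T (E j) (E k) else 0))"
  proof (intro sum.cong refl)
    fix j k assume j: "j \<in> {1..3::nat}" and k: "k \<in> {1..3::nat}"
    have "(\<Sum>i=1..3. ?a i j * ?a i k) = (\<Sum>i=1..3. g p (E j p) (F i p) * g p (E k p) (F i p))"
      using fE[OF j] fE[OF k] fF by (intro sum.cong) (auto simp: g_sym)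
    also have "\<dots> = g p (E j p) (E k p)"
      using frame_inner_expand[OF F] fE[OF j] fE[OF k] by simp
    also have "\<dots> = (if j = k then 1 else 0)" by (rule frame_inner[OF E j k])
    finally show "(\<Sum>i=1..3. ?a i j * ?a i k * T (E j) (E k)) = (if j = k then T (E j) (E k) else 0)"
      by (simp add: sum_distrib_right[symmetric])
  qed
  also have "\<dots> = (\<Sum>j=1..3. T (E j) (E j))" by (intro sum.cong) auto
  finally show ?thesis .
qed

section \<open>Curvature\<close>

lemma smooth_near_ev_D_scale:
  assumes "smooth_near A p f" "field_near p X" "field_near p Y"
  shows "\<forall>\<^sub>F q in nhds p. D (f *\<^sub>F X) Y q = (f *\<^sub>F D X Y) q"
    and "\<forall>\<^sub>F q in nhds p. D X (f *\<^sub>F Y) q = ((\<lambda>q. X q f) *\<^sub>F Y + f *\<^sub>F D X Y) q"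
    and "\<forall>\<^sub>F q in nhds p. lie_bracket A X (f *\<^sub>F Y) q = ((\<lambda>q. X q f) *\<^sub>F Y + f *\<^sub>F lie_bracket A X Y) q"
  using smooth_near_eventually[OF assms(1)] field_near_eventually[OF assms(2)] field_near_eventually[OF assms(3)]
  by (eventually_elim, simp add: D_scale_left D_scale_right lie_bracket_scale_right scale_field_apply)+

lemma D_add_eventually:
  assumes "field_near p X" "field_near p Y" "field_near p Z"
  shows "\<forall>\<^sub>F q in nhds p. D (X + Y) Z q = (D X Z + D Y Z) q"
    and "\<forall>\<^sub>F q in nhds p. D X (Y + Z) q = (D X Y + D X Z) q"
    and "\<forall>\<^sub>F q in nhds p. lie_bracket A X (Y + Z) q = (lie_bracket A X Y + lie_bracket A X Z) q"
  using field_near_eventually[OF assms(1)] field_near_eventually[OF assms(2)] field_near_eventually[OF assms(3)]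
  by (eventually_elim, simp add: D_add_left D_add_right lie_bracket_add_right)+

text \<open>Nested covariant derivatives require equality near \<open>p\<close>, not just at
  \<open>p\<close>. Equal germs at \<open>p\<close> are equal germs at all nearby points, so
  \<open>D_cong\<close> applies at each of them.\<close>

lemma D_cong_eventually:
  assumes "field_near p X" "field_near p Y" "\<forall>\<^sub>F q in nhds p. X q = X' q" "\<forall>\<^sub>F q in nhds p. Y q = Y' q"
  shows "\<forall>\<^sub>F q in nhds p. D X Y q = D X' Y' q"
proof -
  have "\<forall>\<^sub>F q in nhds p. \<forall>\<^sub>F r in nhds q. X r = X' r" "\<forall>\<^sub>F q in nhds p. \<forall>\<^sub>F r in nhds q. Y r = Y' r"
    using assms(3,4) by (simp_all add: eventually_eventually)
  then show ?thesis using field_near_eventually[OF assms(1)] field_near_eventually[OF assms(2)]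
    by eventually_elim (rule D_cong)
qed

lemma lie_bracket_cong_eventually:
  assumes "field_near p X" "field_near p Y" "\<forall>\<^sub>F q in nhds p. X q = X' q" "\<forall>\<^sub>F q in nhds p. Y q = Y' q"
  shows "\<forall>\<^sub>F q in nhds p. lie_bracket A X Y q = lie_bracket A X' Y' q"
proof -
  have "\<forall>\<^sub>F q in nhds p. \<forall>\<^sub>F r in nhds q. X r = X' r" "\<forall>\<^sub>F q in nhds p. \<forall>\<^sub>F r in nhds q. Y r = Y' r"
    using assms(3,4) by (simp_all add: eventually_eventually)
  then show ?thesis using field_near_eventually[OF assms(1)] field_near_eventually[OF assms(2)]
    by eventually_elim (rule lie_bracket_cong)
qed

lemma tensorial_D:
  assumes T: "tensorial p T" and Y: "field_near p Y"
  shows "tensorial p (\<lambda>X. T (D X Y))"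
  unfolding tensorial_def
proof (intro conjI allI impI)
  fix X X' assume X: "field_near p X" "field_near p X'"
  have "T (D (X + X') Y) = T (D X Y + D X' Y)"
    using X Y by (intro tensorial_congD[OF T] D_add_eventually) auto
  then show "T (D (X + X') Y) = T (D X Y) + T (D X' Y)" using X Y by (simp add: tensorial_addD[OF T])
next
  fix f X assume X: "smooth_near A p f" "field_near p X"
  have "T (D (f *\<^sub>F X) Y) = T (f *\<^sub>F D X Y)"
    using X Y by (intro tensorial_congD[OF T] smooth_near_ev_D_scale) auto
  then show "T (D (f *\<^sub>F X) Y) = f p * T (D X Y)" using X Y by (simp add: tensorial_scaleD[OF T])
next
  fix X X' assume X: "field_near p X" and e: "\<forall>\<^sub>F q in nhds p. X q = X' q"
  show "T (D X Y) = T (D X' Y)"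
    by (rule tensorial_congD[OF T _ D_cong_eventually[OF X Y e]]) (use X Y in simp_all)
qed

lemma curvature_field [simp]:
  "field_near p X \<Longrightarrow> field_near p Y \<Longrightarrow> field_near p Z \<Longrightarrow> field_near p (curvature A D X Y Z)"
  by (simp add: curvature_def)

lemma curvature_apply:
  "curvature A D X Y Z p = D X (D Y Z) p - D Y (D X Z) p - D (lie_bracket A X Y) Z p"
  by (simp add: curvature_def)

lemma curvature_antisym:
  assumes "field_near p X" "field_near p Y" "field_near p Z"
  shows "curvature A D X Y Z p = - curvature A D Y X Z p"
proof -
  have "D (lie_bracket A X Y) Z p = D (- lie_bracket A Y X) Z p"
    using assms by (intro D_cong) (auto simp: lie_bracket_antisym[of Y X] fun_eq_iff)
  then show ?thesis using assms by (simp add: curvature_apply D_uminus_left)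
qed

text \<open>The second derivatives of \<open>f\<close> occur as X(Y f) - Y(X f) minus the bracket
  applied to \<open>f\<close>, which is 0; the products of first derivatives cancel by
  antisymmetry.\<close>

lemma curvature_tensorial3:
  assumes X: "field_near p X" and Y: "field_near p Y" and w: "w \<in> tangent_space A p"
  shows "tensorial p (\<lambda>Z. g p (curvature A D X Y Z p) w)"
  unfolding tensorial_def
proof (intro conjI allI impI)
  fix Z Z' assume Z: "field_near p Z" "field_near p Z'"
  have "D X (D Y (Z + Z')) p = D X (D Y Z + D Y Z') p" "D Y (D X (Z + Z')) p = D Y (D X Z + D X Z') p"
    using X Y Z by (auto intro!: D_cong D_add_eventually)
  then have "curvature A D X Y (Z + Z') p = curvature A D X Y Z p + curvature A D X Y Z' p"
    using X Y Z by (simp add: curvature_apply D_add_right)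
  then show "g p (curvature A D X Y (Z + Z') p) w
      = g p (curvature A D X Y Z p) w + g p (curvature A D X Y Z' p) w"
    using X Y Z w by (simp add: g_add_left)
next
  fix f Z assume f: "smooth_near A p f" and Z: "field_near p Z"
  have "D X (D Y (f *\<^sub>F Z)) p = D X ((\<lambda>q. Y q f) *\<^sub>F Z + f *\<^sub>F D Y Z) p"
    "D Y (D X (f *\<^sub>F Z)) p = D Y ((\<lambda>q. X q f) *\<^sub>F Z + f *\<^sub>F D X Z) p"
    using f X Y Z by (auto intro!: D_cong smooth_near_ev_D_scale)
  then have "curvature A D X Y (f *\<^sub>F Z) p = f p *\<^sub>v curvature A D X Y Z p"
    using f X Y Z by (simp add: curvature_apply D_add_right D_scale_right lie_bracket_apply
        fun_eq_iff algebra_simps)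
  then show "g p (curvature A D X Y (f *\<^sub>F Z) p) w = f p * g p (curvature A D X Y Z p) w"
    using X Y Z w by (simp add: g_scale_left)
next
  fix Z Z' assume Z: "field_near p Z" and e: "\<forall>\<^sub>F q in nhds p. Z q = Z' q"
  have "D X (D Y Z) p = D X (D Y Z') p" "D Y (D X Z) p = D Y (D X Z') p"
     "D (lie_bracket A X Y) Z p = D (lie_bracket A X Y) Z' p"
    using X Y Z e by (auto intro!: D_cong D_cong_eventually)
  then show "g p (curvature A D X Y Z p) w = g p (curvature A D X Y Z' p) w"
    by (simp add: curvature_apply)
qed

lemma curvature_tensorial2:
  assumes X: "field_near p X" and Z: "field_near p Z" and w: "w \<in> tangent_space A p"
  shows "tensorial p (\<lambda>Y. g p (curvature A D X Y Z p) w)"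
  unfolding tensorial_def
proof (intro conjI allI impI)
  fix Y Y' assume Y: "field_near p Y" "field_near p Y'"
  have "D X (D (Y + Y') Z) p = D X (D Y Z + D Y' Z) p"
    "D (lie_bracket A X (Y + Y')) Z p = D (lie_bracket A X Y + lie_bracket A X Y') Z p"
    using X Y Z by (auto intro!: D_cong D_add_eventually)
  then have "curvature A D X (Y + Y') Z p = curvature A D X Y Z p + curvature A D X Y' Z p"
    using X Y Z by (simp add: curvature_apply D_add_left D_add_right)
  then show "g p (curvature A D X (Y + Y') Z p) w
      = g p (curvature A D X Y Z p) w + g p (curvature A D X Y' Z p) w"
    using X Y Z w by (simp add: g_add_left)
next
  fix f Y assume f: "smooth_near A p f" and Y: "field_near p Y"
  have "D X (D (f *\<^sub>F Y) Z) p = D X (f *\<^sub>F D Y Z) p"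
    "D (lie_bracket A X (f *\<^sub>F Y)) Z p = D ((\<lambda>q. X q f) *\<^sub>F Y + f *\<^sub>F lie_bracket A X Y) Z p"
    using f X Y Z by (auto intro!: D_cong smooth_near_ev_D_scale)
  then have "curvature A D X (f *\<^sub>F Y) Z p = f p *\<^sub>v curvature A D X Y Z p"
    using f X Y Z by (simp add: curvature_apply D_add_left D_scale_left D_scale_right fun_eq_iff algebra_simps)
  then show "g p (curvature A D X (f *\<^sub>F Y) Z p) w = f p * g p (curvature A D X Y Z p) w"
    using X Y Z w by (simp add: g_scale_left)
next
  fix Y Y' assume Y: "field_near p Y" and e: "\<forall>\<^sub>F q in nhds p. Y q = Y' q"
  have "D X (D Y Z) p = D X (D Y' Z) p" "D Y (D X Z) p = D Y' (D X Z) p"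
     "D (lie_bracket A X Y) Z p = D (lie_bracket A X Y') Z p"
    using X Y Z e by (auto intro!: D_cong D_cong_eventually lie_bracket_cong_eventually)
  then show "g p (curvature A D X Y Z p) w = g p (curvature A D X Y' Z p) w"
    by (simp add: curvature_apply)
qed

lemma tensorial_eq:
  assumes "tensorial p T" "\<And>X. field_near p X \<Longrightarrow> S X = T X"
  shows "tensorial p S"
  unfolding tensorial_def
proof (intro conjI allI impI)
  fix X Y assume X: "field_near p X" and e: "\<forall>\<^sub>F q in nhds p. X q = Y q"
  have "field_near p Y" using X field_near_cong[OF e] by simp
  then show "S X = S Y" using tensorial_congD[OF assms(1) X e] assms(2) X by simp
qed (use assms in \<open>simp_all add: tensorial_addD tensorial_scaleD\<close>)

text \<open>Reduced to the second slot by the antisymmetry in \<open>X\<close> and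
  \<open>Y\<close>.\<close>

lemma curvature_tensorial1:
  assumes Y: "field_near p Y" and Z: "field_near p Z" and w: "w \<in> tangent_space A p"
  shows "tensorial p (\<lambda>X. g p (curvature A D X Y Z p) w)"
proof (rule tensorial_eq[OF tensorial_cmult[OF curvature_tensorial2[OF Y Z w], of "-1"]])
  fix X assume "field_near p X"
  then show "g p (curvature A D X Y Z p) w = - 1 * g p (curvature A D Y X Z p) w"
    using Y Z w by (simp add: curvature_antisym[of p X] g_uminus_left)
qed

text \<open>Torsion-freeness rewrites the three double brackets of the Jacobi identity as the nine
  terms of the cyclic sum of curvatures.\<close>

lemma bianchi_identity:
  assumes X: "field_near p X" and Y: "field_near p Y" and Z: "field_near p Z"
  shows "curvature A D X Y Z p + curvature A D Y Z X p + curvature A D Z X Y p = 0"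
proof -
  have *: "lie_bracket A X (lie_bracket A Y Z) p
      = D X (D Y Z) p - D X (D Z Y) p - D (lie_bracket A Y Z) X p"
    if X: "field_near p X" and Y: "field_near p Y" and Z: "field_near p Z" for X Y Z
  proof -
    have "D X (lie_bracket A Y Z) p = D X (D Y Z - D Z Y) p"
      using X Y Z by (intro D_cong torsion_free_eventually) auto
    then show ?thesis using X Y Z by (simp add: torsion_free[of p X] D_diff_right)
  qed
  show ?thesis using jacobi_identity[OF X Y Z]
    unfolding *[OF X Y Z] *[OF Y Z X] *[OF Z X Y] curvature_apply
    by (simp add: algebra_simps)
qed

section \<open>Ricci tensor, scalar curvature and (0,3)-Cotton tensor\<close>

text \<open>At each point \<open>ricci\<close> uses whatever frame \<open>frame_at\<close> selects
  there, with no smooth dependence on the point. Independence of the trace puts one frame on all of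
  \<open>U\<close> in its place, which is what makes \<open>ricci\<close> smooth.\<close>

lemma ricci_frame:
  assumes E: "orthonormal_frame A g U E" "p \<in> U" and Y: "field_near p Y" and Z: "field_near p Z"
  shows "ricci A g D Y Z p = (\<Sum>i=1..3. g p (curvature A D (E i) Y Z p) (E i p))"
proof -
  have "\<exists>V. p \<in> V \<and> orthonormal_frame A g V (frame_at A g p)"
    unfolding frame_at_def by (rule someI[of _ E]) (use E in blast)
  then obtain V where F: "orthonormal_frame A g V (frame_at A g p)" "p \<in> V" by blast
  show ?thesis unfolding ricci_def ap2_def
    by (rule trace_independent[OF E F, where T = "\<lambda>X X'. g p (curvature A D X Y Z p) (X' p)"])
      (use Y Z in \<open>auto intro: curvature_tensorial1 tensorial_metric_right\<close>)
qed

lemma ricci_tensorial1: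
  assumes E: "orthonormal_frame A g U E" "p \<in> U" and Z: "field_near p Z"
  shows "tensorial p (\<lambda>Y. ricci A g D Y Z p)"
proof (rule tensorial_eq)
  fix Y assume "field_near p Y"
  then show "ricci A g D Y Z p = g p (curvature A D (E 1) Y Z p) (E 1 p)
      + g p (curvature A D (E 2) Y Z p) (E 2 p) + g p (curvature A D (E 3) Y Z p) (E 3 p)"
    by (simp only: ricci_frame[OF E _ Z] sum_1_3)
qed (use Z frame_field[OF E] in \<open>auto intro!: tensorial_add curvature_tensorial2\<close>)

lemma ricci_tensorial2:
  assumes E: "orthonormal_frame A g U E" "p \<in> U" and Y: "field_near p Y"
  shows "tensorial p (\<lambda>Z. ricci A g D Y Z p)"
proof (rule tensorial_eq)
  fix Z assume "field_near p Z"
  then show "ricci A g D Y Z p = g p (curvature A D (E 1) Y Z p) (E 1 p)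
      + g p (curvature A D (E 2) Y Z p) (E 2 p) + g p (curvature A D (E 3) Y Z p) (E 3 p)"
    by (simp only: ricci_frame[OF E Y] sum_1_3)
qed (use Y frame_field[OF E] in \<open>auto intro!: tensorial_add curvature_tensorial3\<close>)

lemma ricci_smooth:
  assumes E: "orthonormal_frame A g U E" "p \<in> U" and Y: "field_near p Y" and Z: "field_near p Z"
  shows "smooth_near A p (ricci A g D Y Z)"
proof -
  have "\<forall>\<^sub>F q in nhds p. q \<in> U" using frame_open[OF E(1)] E(2) by (rule eventually_nhds_in_open)
  then have "\<forall>\<^sub>F q in nhds p. ricci A g D Y Z q = g q (curvature A D (E 1) Y Z q) (E 1 q)
      + g q (curvature A D (E 2) Y Z q) (E 2 q) + g q (curvature A D (E 3) Y Z q) (E 3 q)"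
    using field_near_eventually[OF Y] field_near_eventually[OF Z]
    by eventually_elim (simp only: ricci_frame[OF E(1)] sum_1_3)
  from smooth_near_eventually_cong[OF this] show ?thesis
    using Y Z frame_field[OF E] by (simp add: smooth_near_add)
qed

lemma scalar_curvature_frame:
  assumes E: "orthonormal_frame A g U E" "p \<in> U"
  shows "scalar_curvature A g D p = (\<Sum>i=1..3. ricci A g D (E i) (E i) p)"
proof -
  have "\<exists>V. p \<in> V \<and> orthonormal_frame A g V (frame_at A g p)"
    unfolding frame_at_def by (rule someI[of _ E]) (use E in blast)
  then obtain V where F: "orthonormal_frame A g V (frame_at A g p)" "p \<in> V" by blast
  show ?thesis unfolding scalar_curvature_def
    by (rule trace_independent[OF E F, where T = "\<lambda>Y Z. ricci A g D Y Z p"])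
      (auto intro: ricci_tensorial1[OF E] ricci_tensorial2[OF E])
qed

lemma cov_ricci_tensorial1:
  assumes E: "orthonormal_frame A g U E" "p \<in> U" and "field_near p Y" "field_near p Z"
  shows "tensorial p (\<lambda>X. cov_ricci A g D X Y Z p)"
  unfolding cov_ricci_def
  by (intro tensorial_diff tensorial_derivative tensorial_D[where T = "\<lambda>X. ricci A g D X Z p"]
      tensorial_D[where T = "\<lambda>X. ricci A g D Y X p"] ricci_tensorial1[OF E] ricci_tensorial2[OF E] assms)

text \<open>The Leibniz term X(f) S(Y, Z) of the outer derivative cancels the one that the covariant
  derivative of f Y puts inside \<open>ricci\<close>.\<close>

lemma cov_ricci_tensorial2:
  assumes E: "orthonormal_frame A g U E" "p \<in> U" and X: "field_near p X" and Z: "field_near p Z"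
  shows "tensorial p (\<lambda>Y. cov_ricci A g D X Y Z p)"
  unfolding tensorial_def
proof (intro conjI allI impI)
  have U: "\<forall>\<^sub>F q in nhds p. q \<in> U" using frame_open[OF E(1)] E(2) by (rule eventually_nhds_in_open)
  note T = ricci_tensorial1[OF E]
  note s = ricci_smooth[OF E]
  note c = tangent_eventually_cong[OF field_near_tangent[OF X]]
  {
    fix Y Y' assume Y: "field_near p Y" "field_near p Y'"
    have "\<forall>\<^sub>F q in nhds p. ricci A g D (Y + Y') Z q = ricci A g D Y Z q + ricci A g D Y' Z q"
      using U field_near_eventually[OF Y(1)] field_near_eventually[OF Y(2)] field_near_eventually[OF Z]
      by eventually_elim (rule tensorial_addD[OF ricci_tensorial1[OF E(1)]])
    then have "X p (ricci A g D (Y + Y') Z) = X p (ricci A g D Y Z) + X p (ricci A g D Y' Z)"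
      using c[of "ricci A g D (Y + Y') Z" "\<lambda>q. ricci A g D Y Z q + ricci A g D Y' Z q"]
        tangent_fun_add[OF field_near_tangent[OF X] s[OF Y(1) Z] s[OF Y(2) Z]] by simp
    moreover have "ricci A g D (D X (Y + Y')) Z p = ricci A g D (D X Y + D X Y') Z p"
      using X Y by (intro tensorial_congD[OF T[OF Z]] D_add_eventually) auto
    ultimately show "cov_ricci A g D X (Y + Y') Z p = cov_ricci A g D X Y Z p + cov_ricci A g D X Y' Z p"
      using X Y Z by (simp add: cov_ricci_def tensorial_addD[OF T[OF Z]] tensorial_addD[OF T[of "D X Z"]])
  next
    fix f Y assume f: "smooth_near A p f" and Y: "field_near p Y"
    have "\<forall>\<^sub>F q in nhds p. ricci A g D (f *\<^sub>F Y) Z q = f q * ricci A g D Y Z q"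
      using U field_near_eventually[OF Y] field_near_eventually[OF Z] smooth_near_eventually[OF f]
      by eventually_elim (rule tensorial_scaleD[OF ricci_tensorial1[OF E(1)]])
    then have "X p (ricci A g D (f *\<^sub>F Y) Z) = f p * X p (ricci A g D Y Z) + ricci A g D Y Z p * X p f"
      using c[of "ricci A g D (f *\<^sub>F Y) Z" "\<lambda>q. f q * ricci A g D Y Z q"]
        tangent_fun_mult[OF field_near_tangent[OF X] f s[OF Y Z]] by simp
    moreover have "ricci A g D (D X (f *\<^sub>F Y)) Z p = ricci A g D ((\<lambda>q. X q f) *\<^sub>F Y + f *\<^sub>F D X Y) Z p"
      using X Y f by (intro tensorial_congD[OF T[OF Z]] smooth_near_ev_D_scale) auto
    ultimately show "cov_ricci A g D X (f *\<^sub>F Y) Z p = f p * cov_ricci A g D X Y Z p"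
      using X Y Z f
      by (simp add: cov_ricci_def tensorial_addD[OF T[OF Z]] tensorial_scaleD[OF T[OF Z]]
          tensorial_scaleD[OF T[of "D X Z"]] algebra_simps)
  next
    fix Y Y' assume Y: "field_near p Y" and e: "\<forall>\<^sub>F q in nhds p. Y q = Y' q"
    have "\<forall>\<^sub>F q in nhds p. \<forall>\<^sub>F r in nhds q. Y r = Y' r" using e by (simp add: eventually_eventually)
    then have "\<forall>\<^sub>F q in nhds p. ricci A g D Y Z q = ricci A g D Y' Z q"
      using U field_near_eventually[OF Y] field_near_eventually[OF Z]
      by eventually_elim (rule tensorial_congD[OF ricci_tensorial1[OF E(1)]])
    then have "X p (ricci A g D Y Z) = X p (ricci A g D Y' Z)" by (rule c)
    moreover have "ricci A g D (D X Y) Z p = ricci A g D (D X Y') Z p"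
      by (rule tensorial_congD[OF T[OF Z]]) (use X Y e in \<open>auto intro: D_cong_eventually\<close>)
    moreover have "ricci A g D Y (D X Z) p = ricci A g D Y' (D X Z) p"
      by (rule tensorial_congD[OF T]) (use X Y Z e in auto)
    ultimately show "cov_ricci A g D X Y Z p = cov_ricci A g D X Y' Z p"
      by (simp add: cov_ricci_def)
  }
qed

text \<open>The same cancellation in the other slot of \<open>ricci\<close>, carried out separately
  because symmetry of \<open>ricci\<close> is not derived.\<close>

lemma cov_ricci_tensorial3:
  assumes E: "orthonormal_frame A g U E" "p \<in> U" and X: "field_near p X" and Z: "field_near p Z"
  shows "tensorial p (\<lambda>Y. cov_ricci A g D X Z Y p)"
  unfolding tensorial_def
proof (intro conjI allI impI)
  have U: "\<forall>\<^sub>F q in nhds p. q \<in> U" using frame_open[OF E(1)] E(2) by (rule eventually_nhds_in_open)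
  note T = ricci_tensorial2[OF E]
  note s = ricci_smooth[OF E]
  note c = tangent_eventually_cong[OF field_near_tangent[OF X]]
  {
    fix Y Y' assume Y: "field_near p Y" "field_near p Y'"
    have "\<forall>\<^sub>F q in nhds p. ricci A g D Z (Y + Y') q = ricci A g D Z Y q + ricci A g D Z Y' q"
      using U field_near_eventually[OF Y(1)] field_near_eventually[OF Y(2)] field_near_eventually[OF Z]
      by eventually_elim (rule tensorial_addD[OF ricci_tensorial2[OF E(1)]])
    then have "X p (ricci A g D Z (Y + Y')) = X p (ricci A g D Z Y) + X p (ricci A g D Z Y')"
      using c[of "ricci A g D Z (Y + Y')" "\<lambda>q. ricci A g D Z Y q + ricci A g D Z Y' q"]
        tangent_fun_add[OF field_near_tangent[OF X] s[OF Z Y(1)] s[OF Z Y(2)]] by simp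
    moreover have "ricci A g D Z (D X (Y + Y')) p = ricci A g D Z (D X Y + D X Y') p"
      using X Y by (intro tensorial_congD[OF T[OF Z]] D_add_eventually) auto
    ultimately show "cov_ricci A g D X Z (Y + Y') p = cov_ricci A g D X Z Y p + cov_ricci A g D X Z Y' p"
      using X Y Z by (simp add: cov_ricci_def tensorial_addD[OF T[OF Z]] tensorial_addD[OF T[of "D X Z"]])
  next
    fix f Y assume f: "smooth_near A p f" and Y: "field_near p Y"
    have "\<forall>\<^sub>F q in nhds p. ricci A g D Z (f *\<^sub>F Y) q = f q * ricci A g D Z Y q"
      using U field_near_eventually[OF Y] field_near_eventually[OF Z] smooth_near_eventually[OF f]
      by eventually_elim (rule tensorial_scaleD[OF ricci_tensorial2[OF E(1)]])
    then have "X p (ricci A g D Z (f *\<^sub>F Y)) = f p * X p (ricci A g D Z Y) + ricci A g D Z Y p * X p f"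
      using c[of "ricci A g D Z (f *\<^sub>F Y)" "\<lambda>q. f q * ricci A g D Z Y q"]
        tangent_fun_mult[OF field_near_tangent[OF X] f s[OF Z Y]] by simp
    moreover have "ricci A g D Z (D X (f *\<^sub>F Y)) p = ricci A g D Z ((\<lambda>q. X q f) *\<^sub>F Y + f *\<^sub>F D X Y) p"
      using X Y f by (intro tensorial_congD[OF T[OF Z]] smooth_near_ev_D_scale) auto
    ultimately show "cov_ricci A g D X Z (f *\<^sub>F Y) p = f p * cov_ricci A g D X Z Y p"
      using X Y Z f
      by (simp add: cov_ricci_def tensorial_addD[OF T[OF Z]] tensorial_scaleD[OF T[OF Z]]
          tensorial_scaleD[OF T[of "D X Z"]] algebra_simps)
  next
    fix Y Y' assume Y: "field_near p Y" and e: "\<forall>\<^sub>F q in nhds p. Y q = Y' q"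
    have "\<forall>\<^sub>F q in nhds p. \<forall>\<^sub>F r in nhds q. Y r = Y' r" using e by (simp add: eventually_eventually)
    then have "\<forall>\<^sub>F q in nhds p. ricci A g D Z Y q = ricci A g D Z Y' q"
      using U field_near_eventually[OF Y] field_near_eventually[OF Z]
      by eventually_elim (rule tensorial_congD[OF ricci_tensorial2[OF E(1)]])
    then have "X p (ricci A g D Z Y) = X p (ricci A g D Z Y')" by (rule c)
    moreover have "ricci A g D Z (D X Y) p = ricci A g D Z (D X Y') p"
      by (rule tensorial_congD[OF T[OF Z]]) (use X Y e in \<open>auto intro: D_cong_eventually\<close>)
    moreover have "ricci A g D (D X Z) Y p = ricci A g D (D X Z) Y' p"
      by (rule tensorial_congD[OF T]) (use X Y Z e in auto)
    ultimately show "cov_ricci A g D X Z Y p = cov_ricci A g D X Z Y' p"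
      by (simp add: cov_ricci_def)
  }
qed

lemma cotton3_tensorial1:
  assumes E: "orthonormal_frame A g U E" "p \<in> U" and Y: "field_near p Y" and Z: "field_near p Z"
  shows "tensorial p (\<lambda>X. cotton3 A g D X Y Z p)"
proof (rule tensorial_eq)
  fix X
  show "cotton3 A g D X Y Z p = cov_ricci A g D X Y Z p - cov_ricci A g D Y X Z p
     - (1/4) * (g p (Y p) (Z p) * X p (scalar_curvature A g D) - Y p (scalar_curvature A g D) * g p (X p) (Z p))"
    by (simp add: cotton3_def ap2_def)
qed (intro tensorial_diff tensorial_cmult tensorial_derivative tensorial_metric
      cov_ricci_tensorial1[OF E] cov_ricci_tensorial2[OF E] field_near_tangent Y Z)

lemma cotton3_antisym: "cotton3 A g D Y X Z p = - cotton3 A g D X Y Z p"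
  by (simp add: cotton3_def algebra_simps)

lemma cotton3_tensorial2:
  assumes E: "orthonormal_frame A g U E" "p \<in> U" and "field_near p X" "field_near p Z"
  shows "tensorial p (\<lambda>Y. cotton3 A g D X Y Z p)"
  by (rule tensorial_eq[OF tensorial_cmult[OF cotton3_tensorial1[OF assms], of "-1"]])
    (simp add: cotton3_antisym[of _ X])

lemma cotton3_tensorial3:
  assumes E: "orthonormal_frame A g U E" "p \<in> U" and X: "field_near p X" and Y: "field_near p Y"
  shows "tensorial p (\<lambda>Z. cotton3 A g D X Y Z p)"
proof (rule tensorial_eq)
  fix Z assume "field_near p Z"
  then show "cotton3 A g D X Y Z p = cov_ricci A g D X Y Z p - cov_ricci A g D Y X Z p
     - (1/4) * (X p (scalar_curvature A g D) * g p (Z p) (Y p) - Y p (scalar_curvature A g D) * g p (Z p) (X p))"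
    using X Y by (simp add: cotton3_def ap2_def g_sym[of "Z p"])
qed (intro tensorial_diff tensorial_cmult tensorial_derivative tensorial_metric
      cov_ricci_tensorial3[OF E] field_near_tangent X Y)

section \<open>Structure equations of an orthonormal frame\<close>

definition connection_coeff :: "(nat \<Rightarrow> 'a vfield) \<Rightarrow> nat \<Rightarrow> nat \<Rightarrow> nat \<Rightarrow> 'a \<Rightarrow> real" where
  "connection_coeff E i j k p = g p (D (E i) (E j) p) (E k p)"

lemma frame_eventually:
  assumes "orthonormal_frame A g U E" "p \<in> U"
  shows "\<forall>\<^sub>F q in nhds p. q \<in> U"
  using frame_open[OF assms(1)] assms(2) by (rule eventually_nhds_in_open)

lemma connection_coeff_smooth:
  assumes "orthonormal_frame A g U E" "p \<in> U" "i \<in> {1..3}" "j \<in> {1..3}" "k \<in> {1..3}"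
  shows "smooth_near A p (connection_coeff E i j k)"
  unfolding connection_coeff_def using frame_field[OF assms(1,2)] assms(3-) by simp

lemma frame_derivative_cong:
  assumes "orthonormal_frame A g U E" "p \<in> U" "i \<in> {1..3}" "\<And>q. q \<in> U \<Longrightarrow> f q = h q"
  shows "E i p f = E i p h"
  by (rule tangent_cong[OF field_near_tangent[OF frame_field[OF assms(1,2,3)]] frame_open[OF assms(1)] assms(2)])
    (rule assms(4))

lemma frame_derivative_const:
  assumes "orthonormal_frame A g U E" "p \<in> U" "i \<in> {1..3}" "\<And>q. q \<in> U \<Longrightarrow> f q = k"
  shows "E i p f = 0"
  using frame_derivative_cong[OF assms(1-3), of f "\<lambda>_. k"] assms(4)
    tangent_const[OF field_near_tangent[OF frame_field[OF assms(1,2,3)]]] by simp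

lemma connection_coeff_antisym:
  assumes E: "orthonormal_frame A g U E" "p \<in> U" "i \<in> {1..3}" "j \<in> {1..3}" "k \<in> {1..3}"
  shows "connection_coeff E i j k p = - connection_coeff E i k j p"
proof -
  have F: "field_near p (E i)" "field_near p (E j)" "field_near p (E k)"
    using frame_field[OF E(1,2)] E(3-) by auto
  have "E i p (\<lambda>q. g q (E j q) (E k q)) = 0"
    by (rule frame_derivative_const[OF E(1-3)]) (rule frame_inner[OF E(1) _ E(4,5)])
  then show ?thesis
    unfolding metric_compatible[OF F] connection_coeff_def using F g_sym[of "E j p" p "D (E i) (E k) p"] by simp
qed

text \<open>Metric compatibility replaces each second covariant derivative by the derivative of a
  coefficient minus the inner product of two first covariant derivatives, which is then expanded in
  the frame; the bracket is expanded by torsion-freeness.\<close>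

lemma curvature_frame:
  assumes E: "orthonormal_frame A g U E" "p \<in> U"
    and i: "i \<in> {1..3}" and j: "j \<in> {1..3}" and k: "k \<in> {1..3}" and l: "l \<in> {1..3}"
  defines "G \<equiv> connection_coeff E"
  shows "g p (curvature A D (E i) (E j) (E k) p) (E l p) =
    E i p (G j k l) - E j p (G i k l)
    - (\<Sum>m=1..3. G j k m p * G i l m p) + (\<Sum>m=1..3. G i k m p * G j l m p)
    - (\<Sum>m=1..3. (G i j m p - G j i m p) * G m k l p)"
proof -
  note F = frame_field[OF E]
  have *: "g p (D (E i) (D (E j) (E k)) p) (E l p) = E i p (G j k l) - (\<Sum>m=1..3. G j k m p * G i l m p)"
    if i: "i \<in> {1..3}" and j: "j \<in> {1..3}" for i j
    using metric_compatible[OF F[OF i] D_field[OF F[OF j] F[OF k]] F[OF l]]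
      frame_inner_expand[OF E field_near_tangent[OF D_field[OF F[OF j] F[OF k]]]
        field_near_tangent[OF D_field[OF F[OF i] F[OF l]]]]
    by (simp add: G_def connection_coeff_def[abs_def])
  have "g p (D (lie_bracket A (E i) (E j)) (E k) p) (E l p)
    = (\<Sum>m=1..3. g p (lie_bracket A (E i) (E j) p) (E m p) * G m k l p)"
    unfolding G_def connection_coeff_def
    by (rule tensorial_expand[OF E tensorial_D[OF tensorial_metric F[OF k]]]) (use F i j k l in simp_all)
  also have "\<dots> = (\<Sum>m=1..3. (G i j m p - G j i m p) * G m k l p)"
    using F i j by (intro sum.cong) (simp_all add: torsion_free g_diff_left G_def connection_coeff_def)
  finally show ?thesis
    using *[OF i j] *[OF j i] F i j k l by (simp add: curvature_apply g_diff_left)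
qed

lemma commutator_frame:
  assumes E: "orthonormal_frame A g U E" "p \<in> U" and i: "i \<in> {1..3}" and j: "j \<in> {1..3}"
    and f: "smooth_near A p f"
  defines "G \<equiv> connection_coeff E"
  shows "E i p (\<lambda>q. E j q f) - E j p (\<lambda>q. E i q f) = (\<Sum>m=1..3. (G i j m p - G j i m p) * E m p f)"
proof -
  note F = frame_field[OF E]
  have T: "lie_bracket A (E i) (E j) p \<in> tangent_space A p" using F i j by simp
  have "lie_bracket A (E i) (E j) p = (\<Sum>m=1..3. (G i j m p - G j i m p) *\<^sub>v E m p)"
    using frame_expand[OF E T] F i j unfolding sum_1_3
    by (simp add: torsion_free g_diff_left G_def connection_coeff_def)
  then show ?thesis using lie_bracket_apply[OF f, of "E i" "E j"] unfolding sum_1_3 by simp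
qed

lemma cov_ricci_frame:
  assumes E: "orthonormal_frame A g U E" "p \<in> U"
    and i: "i \<in> {1..3}" and j: "j \<in> {1..3}" and k: "k \<in> {1..3}"
  shows "cov_ricci A g D (E i) (E j) (E k) p = E i p (ricci A g D (E j) (E k))
    - (\<Sum>m=1..3. connection_coeff E i j m p * ricci A g D (E m) (E k) p)
    - (\<Sum>m=1..3. connection_coeff E i k m p * ricci A g D (E j) (E m) p)"
  using tensorial_expand[OF E ricci_tensorial1[OF E], of "E k" "D (E i) (E j)"]
    tensorial_expand[OF E ricci_tensorial2[OF E], of "E j" "D (E i) (E k)"] frame_field[OF E] i j k
  by (simp add: cov_ricci_def connection_coeff_def)

end

section \<open>Almost Kenmotsu 3-h-manifolds\<close>

locale almost_kenmotsu_3h_manifold = riemannian A g D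
  for A :: "'a::{t2_space, second_countable_topology} chart set"
    and g :: "'a \<Rightarrow> 'a tvec \<Rightarrow> 'a tvec \<Rightarrow> real" and D :: "'a vfield \<Rightarrow> 'a vfield \<Rightarrow> 'a vfield" +
  fixes \<phi> :: "'a \<Rightarrow> 'a tvec \<Rightarrow> 'a tvec" and \<xi> :: "'a vfield" and \<eta> :: "'a \<Rightarrow> 'a tvec \<Rightarrow> real"
  assumes structure_3h: "almost_kenmotsu_3h A \<phi> \<xi> \<eta> g D"
begin

lemma almost_kenmotsu: "almost_kenmotsu A \<phi> \<xi> \<eta> g"
  using structure_3h unfolding almost_kenmotsu_3h_def by blast

lemma almost_contact_metric: "almost_contact_metric A \<phi> \<xi> \<eta> g"
  using almost_kenmotsu unfolding almost_kenmotsu_def by blast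

lemma reeb_vector_field: "vector_field A UNIV \<xi>"
  using almost_contact_metric unfolding almost_contact_metric_def by blast

lemma reeb_field [simp]: "field_near p \<xi>"
  using reeb_vector_field field_nearI by blast

lemma reeb_unit [simp]: "g p (\<xi> p) (\<xi> p) = 1"
  using almost_contact_metric unfolding almost_contact_metric_def by blast

lemma eta_eq: "v \<in> tangent_space A p \<Longrightarrow> \<eta> p v = g p v (\<xi> p)"
  using almost_contact_metric unfolding almost_contact_metric_def by blast

lemma phi_endo: "endo_field A \<phi>"
  using almost_contact_metric unfolding almost_contact_metric_def by blast

lemma phi_tangent [simp]: "v \<in> tangent_space A p \<Longrightarrow> \<phi> p v \<in> tangent_space A p"
  and phi_add: "v \<in> tangent_space A p \<Longrightarrow> w \<in> tangent_space A p \<Longrightarrow> \<phi> p (v + w) = \<phi> p v + \<phi> p w"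
  and phi_scale: "v \<in> tangent_space A p \<Longrightarrow> \<phi> p (a *\<^sub>v v) = a *\<^sub>v \<phi> p v"
  using phi_endo unfolding endo_field_def linear_endo_on_def by auto

lemma phi_uminus: "v \<in> tangent_space A p \<Longrightarrow> \<phi> p (- v) = - \<phi> p v"
  unfolding uminus_scale_vec by (rule phi_scale)

lemma phi_vector_field: "vector_field A U X \<Longrightarrow> vector_field A U (ap1 \<phi> X)"
  using phi_endo unfolding endo_field_def by blast

lemma phi_field [simp]: "field_near p X \<Longrightarrow> field_near p (ap1 \<phi> X)"
  unfolding field_near_def using phi_vector_field by blast

lemma phi_phi: "v \<in> tangent_space A p \<Longrightarrow> \<phi> p (\<phi> p v) = - v + g p v (\<xi> p) *\<^sub>v \<xi> p"
  using almost_contact_metric eta_eq unfolding almost_contact_metric_def by metis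

lemma phi_metric: "v \<in> tangent_space A p \<Longrightarrow> w \<in> tangent_space A p \<Longrightarrow>
    g p (\<phi> p v) (\<phi> p w) = g p v w - g p v (\<xi> p) * g p w (\<xi> p)"
  using almost_contact_metric eta_eq unfolding almost_contact_metric_def by metis

text \<open>\<open>phi_metric\<close> gives \<phi> \<xi> the squared length 1 - 1 = 0, and
  \<open>g\<close> is positive.\<close>

lemma phi_reeb: "\<phi> p (\<xi> p) = 0"
  using phi_metric[of "\<xi> p" p "\<xi> p"] g_pos[of "\<phi> p (\<xi> p)" p] by fastforce

text \<open>\<phi>^3 v is evaluated twice, with \<open>phi_phi\<close> applied to v or to \<phi> v.
  The results differ exactly by the \<xi>-part of \<phi> v.\<close>

lemma phi_orthogonal:
  assumes v: "v \<in> tangent_space A p"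
  shows "g p (\<phi> p v) (\<xi> p) = 0"
proof -
  have "\<phi> p (\<phi> p (\<phi> p v)) = \<phi> p (- v) + \<phi> p (g p v (\<xi> p) *\<^sub>v \<xi> p)"
    unfolding phi_phi[OF v] by (rule phi_add) (use v in simp_all)
  then have "\<phi> p (\<phi> p (\<phi> p v)) = - \<phi> p v"
    using v by (simp add: phi_uminus phi_scale phi_reeb fun_eq_iff)
  moreover have "\<phi> p (\<phi> p (\<phi> p v)) = - \<phi> p v + g p (\<phi> p v) (\<xi> p) *\<^sub>v \<xi> p"
    by (rule phi_phi[OF phi_tangent[OF v]])
  ultimately have "g p (\<phi> p v) (\<xi> p) *\<^sub>v \<xi> p = 0" by simp
  then have "g p (g p (\<phi> p v) (\<xi> p) *\<^sub>v \<xi> p) (\<xi> p) = 0" by simp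
  then show ?thesis by (simp add: g_scale_left)
qed

text \<open>\<open>phi_metric\<close> for the pair \<phi> v, w, combined with the expansion of
  \<phi>^2 v; the \<xi>-terms vanish by \<open>phi_orthogonal\<close>.\<close>

lemma phi_skew:
  assumes v: "v \<in> tangent_space A p" and w: "w \<in> tangent_space A p"
  shows "g p (\<phi> p v) w = - g p v (\<phi> p w)"
proof -
  have "g p (\<phi> p (\<phi> p v)) (\<phi> p w) = g p (\<phi> p v) w"
    using phi_metric[of "\<phi> p v" p w] v w phi_orthogonal[OF v] by simp
  then show ?thesis
    using v w phi_orthogonal[OF w] g_sym[of "\<xi> p" p "\<phi> p w"] by (simp add: phi_phi g_simps)
qed

lemma eta_closed: "field_near p X \<Longrightarrow> field_near p Y \<Longrightarrow>
    X p (\<lambda>q. g q (Y q) (\<xi> q)) - Y p (\<lambda>q. g q (X q) (\<xi> q)) = g p (lie_bracket A X Y p) (\<xi> p)"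
proof -
  assume X: "field_near p X" and Y: "field_near p Y"
  obtain U where U: "p \<in> U" "vector_field A U X" "vector_field A U Y"
    using common_domain[OF X Y X smooth_near_const] by metis
  then have "X p (ap1 \<eta> Y) - Y p (ap1 \<eta> X) = \<eta> p (lie_bracket A X Y p)"
    using almost_kenmotsu unfolding almost_kenmotsu_def ext_d1_def ap1_def by force
  moreover have ev: "\<forall>\<^sub>F q in nhds p. ap1 \<eta> Z q = g q (Z q) (\<xi> q)" if "field_near p Z" for Z
    using field_near_eventually[OF that] by eventually_elim (simp add: ap1_def eta_eq)
  have "X p (ap1 \<eta> Y) = X p (\<lambda>q. g q (Y q) (\<xi> q))" "Y p (ap1 \<eta> X) = Y p (\<lambda>q. g q (X q) (\<xi> q))"
    using tangent_eventually_cong[OF field_near_tangent[OF X] ev[OF Y]]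
      tangent_eventually_cong[OF field_near_tangent[OF Y] ev[OF X]] by auto
  ultimately show ?thesis using X Y by (simp add: eta_eq)
qed

text \<open>The factors 1/3 of \<open>ext_d2\<close> and \<open>wedge12\<close> cancel; the 2 of
  d\<Phi> = 2 \<eta> \<and> \<Phi> stays.\<close>

lemma fundamental_form_differential:
  assumes X: "field_near p X" and Y: "field_near p Y" and Z: "field_near p Z"
  shows "X p (\<lambda>q. g q (Y q) (\<phi> q (Z q))) + Y p (\<lambda>q. g q (Z q) (\<phi> q (X q))) + Z p (\<lambda>q. g q (X q) (\<phi> q (Y q)))
     - g p (lie_bracket A X Y p) (\<phi> p (Z p)) - g p (lie_bracket A Y Z p) (\<phi> p (X p))
     - g p (lie_bracket A Z X p) (\<phi> p (Y p))
    = 2 * (g p (X p) (\<xi> p) * g p (Y p) (\<phi> p (Z p)) + g p (Y p) (\<xi> p) * g p (Z p) (\<phi> p (X p))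
      + g p (Z p) (\<xi> p) * g p (X p) (\<phi> p (Y p)))"
proof -
  obtain U where U: "p \<in> U" "vector_field A U X" "vector_field A U Y" "vector_field A U Z"
    using common_domain[OF X Y Z smooth_near_const] by metis
  then have "ext_d2 A (fundamental_form \<phi> g) X Y Z p = 2 * wedge12 \<eta> (fundamental_form \<phi> g) X Y Z p"
    using almost_kenmotsu unfolding almost_kenmotsu_def by blast
  then show ?thesis
    using X Y Z unfolding ext_d2_def wedge12_def ap1_def ap2_def fundamental_form_def by (simp add: eta_eq)
qed

section \<open>The operator h\<close>

lemma h_field:
  assumes "field_near p Y"
  shows "field_near p (h_op A \<phi> \<xi> Y)"
proof -
  have "h_op A \<phi> \<xi> Y = (\<lambda>_. 1/2) *\<^sub>F (lie_bracket A \<xi> (ap1 \<phi> Y) - ap1 \<phi> (lie_bracket A \<xi> Y))"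
    unfolding h_op_def lie_endo_def scale_field_def ..
  then show ?thesis using assms by (simp del: minus_apply)
qed

text \<open>Skewness moves the outer \<phi> onto the test vector, so that only brackets with \<xi>
  remain to be evaluated.\<close>

lemma h_inner:
  assumes "field_near p Y" "w \<in> tangent_space A p"
  shows "g p (h_op A \<phi> \<xi> Y p) w
     = (g p (lie_bracket A \<xi> (ap1 \<phi> Y) p) w + g p (lie_bracket A \<xi> Y p) (\<phi> p w)) / 2"
proof -
  have "ap1 \<phi> (lie_bracket A \<xi> Y) p = \<phi> p (lie_bracket A \<xi> Y p)" by (simp add: ap1_def)
  then show ?thesis
    using assms by (simp add: h_op_def lie_endo_def g_simps phi_skew)
qed

text \<open>The two Leibniz terms are \<xi>(f) g(\<phi> X, w) and \<xi>(f) g(X, \<phi> w), which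
  cancel because \<phi> is skew.\<close>

lemma h_tensorial:
  assumes w: "w \<in> tangent_space A p"
  shows "tensorial p (\<lambda>Y. g p (h_op A \<phi> \<xi> Y p) w)"
proof (rule tensorial_eq)
  show "tensorial p (\<lambda>Y. (g p (lie_bracket A \<xi> (ap1 \<phi> Y) p) w + g p (lie_bracket A \<xi> Y p) (\<phi> p w)) / 2)"
    unfolding tensorial_def
  proof (intro conjI allI impI)
    fix X Y assume X: "field_near p X" and Y: "field_near p Y"
    have "\<forall>\<^sub>F q in nhds p. ap1 \<phi> (X + Y) q = (ap1 \<phi> X + ap1 \<phi> Y) q"
      using field_near_eventually[OF X] field_near_eventually[OF Y]
      by eventually_elim (simp add: ap1_def phi_add)
    then have "lie_bracket A \<xi> (ap1 \<phi> (X + Y)) p = lie_bracket A \<xi> (ap1 \<phi> X + ap1 \<phi> Y) p"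
      using X Y by (intro lie_bracket_cong) auto
    then show "(g p (lie_bracket A \<xi> (ap1 \<phi> (X + Y)) p) w + g p (lie_bracket A \<xi> (X + Y) p) (\<phi> p w)) / 2
      = (g p (lie_bracket A \<xi> (ap1 \<phi> X) p) w + g p (lie_bracket A \<xi> X p) (\<phi> p w)) / 2
      + (g p (lie_bracket A \<xi> (ap1 \<phi> Y) p) w + g p (lie_bracket A \<xi> Y p) (\<phi> p w)) / 2"
      using X Y w by (simp add: lie_bracket_add_right g_simps add_divide_distrib)
  next
    fix f X assume f: "smooth_near A p f" and X: "field_near p X"
    have "\<forall>\<^sub>F q in nhds p. ap1 \<phi> (f *\<^sub>F X) q = (f *\<^sub>F ap1 \<phi> X) q"
      using field_near_eventually[OF X]
      by eventually_elim (simp add: ap1_def phi_scale scale_field_apply)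
    then have "lie_bracket A \<xi> (ap1 \<phi> (f *\<^sub>F X)) p = lie_bracket A \<xi> (f *\<^sub>F ap1 \<phi> X) p"
      using f X by (intro lie_bracket_cong) auto
    moreover have "g p (ap1 \<phi> X p) w = - g p (X p) (\<phi> p w)"
      using X w by (simp add: ap1_def phi_skew)
    ultimately show "(g p (lie_bracket A \<xi> (ap1 \<phi> (f *\<^sub>F X)) p) w + g p (lie_bracket A \<xi> (f *\<^sub>F X) p) (\<phi> p w)) / 2
      = f p * ((g p (lie_bracket A \<xi> (ap1 \<phi> X) p) w + g p (lie_bracket A \<xi> X p) (\<phi> p w)) / 2)"
      using f X w by (simp add: lie_bracket_scale_right g_simps field_simps)
  next
    fix X Y assume X: "field_near p X" and e: "\<forall>\<^sub>F q in nhds p. X q = Y q"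
    have "lie_bracket A \<xi> X p = lie_bracket A \<xi> Y p"
      "lie_bracket A \<xi> (ap1 \<phi> X) p = lie_bracket A \<xi> (ap1 \<phi> Y) p"
      using X e by (auto intro!: lie_bracket_cong elim: eventually_mono, simp_all add: ap1_def eventually_mono)
    then show "(g p (lie_bracket A \<xi> (ap1 \<phi> X) p) w + g p (lie_bracket A \<xi> X p) (\<phi> p w)) / 2
      = (g p (lie_bracket A \<xi> (ap1 \<phi> Y) p) w + g p (lie_bracket A \<xi> Y p) (\<phi> p w)) / 2"
      by simp
  qed
qed (use w h_inner in auto)

lemma h_parallel:
  assumes "field_near p X"
  shows "D \<xi> (h_op A \<phi> \<xi> X) p = h_op A \<phi> \<xi> (D \<xi> X) p"
proof -
  obtain U where "p \<in> U" "vector_field A U X" using assms unfolding field_near_def by blast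
  then have "D \<xi> (h_op A \<phi> \<xi> X) p - h_op A \<phi> \<xi> (D \<xi> X) p = 0"
    using structure_3h unfolding almost_kenmotsu_3h_def by blast
  then show ?thesis by simp
qed

section \<open>Existence of frames adapted to the almost contact structure\<close>

definition adapted_frame :: "'a vfield \<Rightarrow> nat \<Rightarrow> 'a vfield" where
  "adapted_frame e i = (if i = 1 then \<xi> else if i = 2 then e else ap1 \<phi> e)"

definition transverse_unit :: "'a set \<Rightarrow> 'a vfield \<Rightarrow> bool" where
  "transverse_unit U e \<longleftrightarrow> vector_field A U e \<and> (\<forall>p\<in>U. g p (e p) (e p) = 1 \<and> g p (e p) (\<xi> p) = 0)"

lemma adapted_frame_simps:
  "adapted_frame e 1 = \<xi>" "adapted_frame e (Suc 0) = \<xi>" "adapted_frame e 2 = e" "adapted_frame e 3 = ap1 \<phi> e"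
  by (simp_all add: adapted_frame_def)

lemma adapted_frame_orthonormal:
  assumes e: "transverse_unit U e"
  shows "orthonormal_frame A g U (adapted_frame e)"
proof -
  have v: "vector_field A U e" and u: "\<And>p. p \<in> U \<Longrightarrow> g p (e p) (e p) = 1"
    and o: "\<And>p. p \<in> U \<Longrightarrow> g p (e p) (\<xi> p) = 0" using e unfolding transverse_unit_def by auto
  have t: "e p \<in> tangent_space A p" if "p \<in> U" for p using v that by (rule vector_field_tangent)
  have "vector_field A U \<xi>" by (rule vector_field_subset[OF reeb_vector_field vector_field_open[OF v]]) simp
  moreover have "g p (\<xi> p) (e p) = 0" "g p (\<phi> p (e p)) (\<xi> p) = 0" "g p (\<xi> p) (\<phi> p (e p)) = 0"
     "g p (\<phi> p (e p)) (\<phi> p (e p)) = 1" "g p (\<phi> p (e p)) (e p) = 0" "g p (e p) (\<phi> p (e p)) = 0" if p: "p \<in> U" for p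
  proof -
    show 1: "g p (\<phi> p (e p)) (\<xi> p) = 0" using t[OF p] by (rule phi_orthogonal)
    show "g p (\<xi> p) (e p) = 0" using t[OF p] o[OF p] g_sym[of "\<xi> p" p "e p"] by simp
    show "g p (\<xi> p) (\<phi> p (e p)) = 0" using t[OF p] 1 g_sym[of "\<xi> p" p] by simp
    show "g p (\<phi> p (e p)) (\<phi> p (e p)) = 1" using t[OF p] o[OF p] u[OF p] by (simp add: phi_metric)
    show 2: "g p (\<phi> p (e p)) (e p) = 0"
      using phi_skew[OF t[OF p] t[OF p]] g_sym[OF t[OF p], of "\<phi> p (e p)"] t[OF p] by simp
    then show "g p (e p) (\<phi> p (e p)) = 0" using g_sym[OF t[OF p], of "\<phi> p (e p)"] t[OF p] by simp
  qed
  ultimately show ?thesis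
    unfolding orthonormal_frame_def ball_1_3 using v u o phi_vector_field[OF v] by (simp add: ap1_def adapted_frame_simps)
qed

text \<open>Dividing by the length is smooth where \<open>X\<close> does not vanish, an open set
  containing \<open>p\<close>; orthogonality to \<xi> survives the rescaling.\<close>

lemma normalize_transverse:
  assumes X: "field_near p X" and nz: "X p \<noteq> 0" and orth: "\<forall>\<^sub>F q in nhds p. g q (X q) (\<xi> q) = 0"
  obtains U n where "p \<in> U" "smooth_fun A U n" "transverse_unit U (n *\<^sub>F X)"
    "\<And>q. q \<in> U \<Longrightarrow> n q > 0" "\<And>q. q \<in> U \<Longrightarrow> n q * n q * g q (X q) (X q) = 1"
proof -
  obtain W where W: "open W" "p \<in> W" "\<And>q. q \<in> W \<Longrightarrow> g q (X q) (\<xi> q) = 0"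
    using orth unfolding eventually_nhds by blast
  obtain V where V: "V \<subseteq> W" "p \<in> V" "vector_field A V X" by (rule field_near_on[OF X W(1,2)])
  let ?N = "\<lambda>q. g q (X q) (X q)"
  have N: "smooth_fun A V ?N"
    using metric V(3) unfolding riemannian_metric_def ap2_def by blast
  define U where "U = {q\<in>V. ?N q > 0}"
  have U: "open U" "U \<subseteq> V" unfolding U_def using smooth_fun_open_nonzero(2)[OF N] by auto
  define n where "n q = ?N q powr (-1/2)" for q
  have n: "smooth_fun A U n" unfolding n_def
    by (rule smooth_fun_powr[OF smooth_fun_subset[OF N U]]) (simp add: U_def)
  have pos: "n q > 0" if "q \<in> U" for q using that by (simp add: n_def U_def)
  have sq: "n q * n q * ?N q = 1" if "q \<in> U" for q
  proof -
    have "n q * n q = ?N q powr (-1)" unfolding n_def by (simp add: powr_add[symmetric])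
    then show ?thesis using that by (simp add: U_def powr_minus)
  qed
  have "transverse_unit U (n *\<^sub>F X)" unfolding transverse_unit_def
  proof (intro conjI ballI)
    show "vector_field A U (n *\<^sub>F X)"
      by (rule vector_field_scale[OF n vector_field_subset[OF V(3) U]])
    fix q assume q: "q \<in> U"
    then have t: "X q \<in> tangent_space A q" using V(3) U(2) vector_field_tangent by blast
    show "g q ((n *\<^sub>F X) q) ((n *\<^sub>F X) q) = 1"
      using sq[OF q] t by (simp add: scale_field_apply g_simps mult.assoc)
    show "g q ((n *\<^sub>F X) q) (\<xi> q) = 0"
      using W(3) q U(2) V(1) t by (auto simp add: scale_field_apply g_simps)
  qed
  moreover have "p \<in> U" using V(2) g_pos[OF field_near_tangent[OF X] nz] by (simp add: U_def)
  ultimately show ?thesis using that n pos sq by blast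
qed

lemma transverse_unit_subset:
  "transverse_unit U e \<Longrightarrow> open V \<Longrightarrow> V \<subseteq> U \<Longrightarrow> transverse_unit V e"
  unfolding transverse_unit_def using vector_field_subset by blast

text \<open>In a chart \<xi> is the image of a single vector \<open>w\<close>, and one vector cannot
  span \<open>real^3\<close>.\<close>

lemma tangent_not_multiple_of_reeb:
  obtains v where "v \<in> tangent_space A p" "v \<noteq> g p v (\<xi> p) *\<^sub>v \<xi> p"
proof -
  obtain U c where U: "(U, c) \<in> A" "p \<in> U" by (rule chart_at)
  have "\<xi> p \<in> range (chart_vec U c p)"
    using field_near_tangent[OF reeb_field] tangent_space_chart[OF U] by metis
  then obtain w where w: "\<xi> p = chart_vec U c p w" by blast
  have "\<exists>x::real^3. x \<notin> span {w}"
  proof (rule ccontr)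
    assume "\<not> (\<exists>x. x \<notin> span {w})"
    then have "span {w} = UNIV" by auto
    then have "dim (UNIV :: (real^3) set) \<le> card {w}" by (intro dim_le_card) auto
    then show False by (simp add: dim_UNIV)
  qed
  then obtain x where x: "x \<notin> span {w}" by blast
  let ?v = "chart_vec U c p x"
  have "?v \<noteq> a *\<^sub>v \<xi> p" for a
  proof
    assume "?v = a *\<^sub>v \<xi> p"
    then have "chart_vec U c p x = chart_vec U c p (a *\<^sub>R w)" using w chart_vec_scale[OF U] by simp
    then have "x \<bullet> b = (a *\<^sub>R w) \<bullet> b" for b
      using chart_vec_coordinate[OF U] by metis
    then have "x = a *\<^sub>R w" by (metis vector_eq_rdot)
    then show False using x by (simp add: span_base span_scale)
  qed
  then show ?thesis using that[of ?v] tangent_space_chart[OF U] by blast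
qed

text \<open>A Gram-Schmidt step: the \<xi>-part is subtracted from a vector outside the line of
  \<xi>, then the result is normalised.\<close>

lemma adapted_frame_exists:
  obtains U e where "p \<in> U" "transverse_unit U e"
proof -
  obtain v where v: "v \<in> tangent_space A p" "v \<noteq> g p v (\<xi> p) *\<^sub>v \<xi> p" by (rule tangent_not_multiple_of_reeb)
  obtain X where X: "field_near p X" "X p = v" using v(1) by (rule field_extension)
  define Y where "Y = X - (\<lambda>q. g q (X q) (\<xi> q)) *\<^sub>F \<xi>"
  have Y: "field_near p Y" unfolding Y_def using X by simp
  have "Y p \<noteq> 0" using v X by (simp add: Y_def scale_field_apply)
  moreover have "\<forall>\<^sub>F q in nhds p. g q (Y q) (\<xi> q) = 0"
    using field_near_eventually[OF X(1)]
    by eventually_elim (simp add: Y_def scale_field_apply g_simps)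
  ultimately show ?thesis using normalize_transverse[OF Y] that by metis
qed

end

section \<open>Structure equations in an adapted frame\<close>

locale adapted_frame_domain = almost_kenmotsu_3h_manifold A g D \<phi> \<xi> \<eta>
  for A :: "'a::{t2_space, second_countable_topology} chart set"
    and g :: "'a \<Rightarrow> 'a tvec \<Rightarrow> 'a tvec \<Rightarrow> real" and D :: "'a vfield \<Rightarrow> 'a vfield \<Rightarrow> 'a vfield"
    and \<phi> :: "'a \<Rightarrow> 'a tvec \<Rightarrow> 'a tvec" and \<xi> :: "'a vfield" and \<eta> :: "'a \<Rightarrow> 'a tvec \<Rightarrow> real" +
  fixes U :: "'a set" and e :: "'a vfield"
  assumes unit: "transverse_unit U e"
    and ricci_eigen: "\<And>p. \<exists>\<mu>. ricci_op A g D \<xi> p = \<mu> *\<^sub>v \<xi> p"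
begin

text \<open>The frame index 1 has to stay a numeral so that rules about \<open>E 1\<close> or
  \<open>G 1 2 3\<close> keep matching.\<close>

declare One_nat_def [simp del]

text \<open>In the notation of the introduction \<open>a = G 1 2 3\<close>, \<open>b = - G 2 2 3\<close>, \<open>c = G 3 2 3\<close>; for a general
  adapted frame \<open>h e = - q e + u \<phi>e\<close> with \<open>q = G 2 1 3\<close> and \<open>u = G 2 1 2 - 1\<close>, and \<open>\<lambda> = - q\<close> in an
  eigenframe.  Rewriting \<open>E 1\<close> and \<open>\<xi>\<close> into each other must go from \<open>E 1\<close> to \<open>\<xi>\<close>, because
  \<^const>\<open>adapted_frame\<close> has \<open>\<xi>\<close> as a hidden argument.\<close>

abbreviation E where "E \<equiv> adapted_frame e"
abbreviation G where "G \<equiv> connection_coeff (adapted_frame e)"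
abbreviation Ric where "Ric i j \<equiv> ricci A g D (adapted_frame e i) (adapted_frame e j)"

lemma frame: "orthonormal_frame A g U E"
  using unit by (rule adapted_frame_orthonormal)

lemma E_1: "E 1 = \<xi>" and E_2: "E 2 = e" and E_3: "E 3 = ap1 \<phi> (E 2)"
  by (simp_all add: adapted_frame_simps)

lemma E_field [simp]: "p \<in> U \<Longrightarrow> i \<in> {1..3} \<Longrightarrow> field_near p (E i)"
  using frame_field[OF frame] .

lemma E_tangent [simp]: "p \<in> U \<Longrightarrow> i \<in> {1..3} \<Longrightarrow> E i p \<in> tangent_space A p"
  by simp

lemma E_inner [simp]: "p \<in> U \<Longrightarrow> i \<in> {1..3} \<Longrightarrow> j \<in> {1..3} \<Longrightarrow> g p (E i p) (E j p) = (if i = j then 1 else 0)"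
  using frame_inner[OF frame] .

lemma phi_E:
  assumes "p \<in> U"
  shows "\<phi> p (E 1 p) = 0" "\<phi> p (E 2 p) = E 3 p" "\<phi> p (E 3 p) = - E 2 p"
proof -
  show "\<phi> p (E 1 p) = 0" by (simp add: E_1 phi_reeb)
  show *: "\<phi> p (E 2 p) = E 3 p" by (simp add: E_3 ap1_def)
  have "g p (E 2 p) (\<xi> p) = 0" using E_inner[OF assms, of 2 1] by (simp add: E_1)
  then show "\<phi> p (E 3 p) = - E 2 p"
    unfolding *[symmetric] using assms by (simp add: phi_phi fun_eq_iff)
qed

lemma E_reeb [simp]: "p \<in> U \<Longrightarrow> i \<in> {1..3} \<Longrightarrow> g p (E i p) (\<xi> p) = (if i = 1 then 1 else 0)"
  using E_inner[of p i 1] by (simp add: E_1)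

lemma D_E_inner: "g p (D (E i) (E j) p) (E k p) = G i j k p"
  by (simp add: connection_coeff_def)

lemma bracket_E_inner:
  "p \<in> U \<Longrightarrow> i \<in> {1..3} \<Longrightarrow> j \<in> {1..3} \<Longrightarrow> k \<in> {1..3} \<Longrightarrow>
    g p (lie_bracket A (E i) (E j) p) (E k p) = G i j k p - G j i k p"
  by (simp add: torsion_free g_diff_left D_E_inner)

lemma bracket_reeb_inner:
  "p \<in> U \<Longrightarrow> j \<in> {1..3} \<Longrightarrow> k \<in> {1..3} \<Longrightarrow>
    g p (lie_bracket A \<xi> (E j) p) (E k p) = G 1 j k p - G j 1 k p"
  using bracket_E_inner[of p 1 j k] by (simp add: E_1)

text \<open>This is d\<eta> = 0: brackets of frame fields have no \<xi>-component.\<close>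

lemma G_sym:
  assumes "p \<in> U" "i \<in> {1..3}" "j \<in> {1..3}"
  shows "G i j 1 p = G j i 1 p"
proof -
  have "E i p (\<lambda>q. g q (E j q) (\<xi> q)) = 0" if "i \<in> {1..3}" "j \<in> {1..3}" for i j
    by (rule frame_derivative_const[OF frame assms(1) that(1)]) (use that in simp)
  then have "g p (lie_bracket A (E i) (E j) p) (E 1 p) = 0"
    using eta_closed[of p "E i" "E j"] assms by (simp add: E_1)
  then show ?thesis using assms by (simp add: bracket_E_inner)
qed

lemma G_skew: "p \<in> U \<Longrightarrow> i \<in> {1..3} \<Longrightarrow> j \<in> {1..3} \<Longrightarrow> k \<in> {1..3} \<Longrightarrow> G i j k p = - G i k j p"
  using connection_coeff_antisym[OF frame] .

text \<open>This is d\<Phi> = 2 \<eta> \<and> \<Phi> on the triple (\<xi>, e, \<phi> e); it says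
  that \<xi> has divergence 2.\<close>

lemma G_trace:
  assumes p: "p \<in> U"
  shows "G 2 1 2 p + G 3 1 3 p = 2"
proof -
  \<comment> \<open>The derivative terms of d\<Phi> differentiate constants: \<Phi>(e, \<phi> e) =
    -1, and the other two values are 0. Only the bracket terms are left.\<close>
  have "E 1 p (\<lambda>q. g q (E 2 q) (\<phi> q (E 3 q))) = 0" "E 2 p (\<lambda>q. g q (E 3 q) (\<phi> q (E 1 q))) = 0"
    "E 3 p (\<lambda>q. g q (E 1 q) (\<phi> q (E 2 q))) = 0"
    by (rule frame_derivative_const[OF frame p, where k = "-1"], simp, simp add: phi_E g_uminus_right,
        rule frame_derivative_const[OF frame p, where k = 0], simp, simp add: phi_E,
        rule frame_derivative_const[OF frame p, where k = 0], simp, simp add: phi_E)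
  then have "G 1 2 2 p - G 2 1 2 p - (G 3 1 3 p - G 1 3 3 p) = - 2"
    using fundamental_form_differential[of p "E 1" "E 2" "E 3"] p
    by (simp add: phi_E g_uminus_right bracket_E_inner)
  moreover have "G 1 2 2 p = 0" "G 1 3 3 p = 0" using G_skew[OF p, of 1 2 2] G_skew[OF p, of 1 3 3] by auto
  ultimately show ?thesis by simp
qed

text \<open>A normal form: \<open>G 1 2 3\<close>, \<open>G 2 2 3\<close>, \<open>G 3 2 3\<close>,
  \<open>G 2 1 2\<close> and \<open>G 2 1 3\<close> are all that remains. The vanishing of
  \<open>G 1 1 2\<close> and \<open>G 1 1 3\<close> says that the integral curves of \<xi> are
  geodesics.\<close>

lemma G_simps:
  assumes p: "p \<in> U"
  shows "i \<in> {1..3} \<Longrightarrow> k \<in> {1..3} \<Longrightarrow> G i k k p = 0"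
    and "i \<in> {1..3} \<Longrightarrow> G i 2 1 p = - G i 1 2 p" and "i \<in> {1..3} \<Longrightarrow> G i 3 1 p = - G i 1 3 p"
    and "i \<in> {1..3} \<Longrightarrow> G i 3 2 p = - G i 2 3 p"
    and "G 1 1 2 p = 0" and "G 1 1 3 p = 0" and "G 3 1 2 p = G 2 1 3 p" and "G 3 1 3 p = 2 - G 2 1 2 p"
proof -
  show *: "G i k k p = 0" if "i \<in> {1..3}" "k \<in> {1..3}" for i k using G_skew[OF p that(1,2,2)] by simp
  show "G i 2 1 p = - G i 1 2 p" if "i \<in> {1..3}" for i using G_skew[OF p that, of 2 1] by simp
  show "G i 3 1 p = - G i 1 3 p" if "i \<in> {1..3}" for i using G_skew[OF p that, of 3 1] by simp
  show "G i 3 2 p = - G i 2 3 p" if "i \<in> {1..3}" for i using G_skew[OF p that, of 3 2] by simp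
  show "G 1 1 2 p = 0" using G_skew[OF p, of 1 1 2] G_sym[OF p, of 1 2] *[of 2 1] by simp
  show "G 1 1 3 p = 0" using G_skew[OF p, of 1 1 3] G_sym[OF p, of 1 3] *[of 3 1] by simp
  show "G 3 1 2 p = G 2 1 3 p" using G_skew[OF p, of 3 1 2] G_skew[OF p, of 2 1 3] G_sym[OF p, of 2 3] by simp
  show "G 3 1 3 p = 2 - G 2 1 2 p" using G_trace[OF p] by simp
qed

lemma G_smooth [simp]: "p \<in> U \<Longrightarrow> i \<in> {1..3} \<Longrightarrow> j \<in> {1..3} \<Longrightarrow> k \<in> {1..3} \<Longrightarrow> smooth_near A p (G i j k)"
  using connection_coeff_smooth[OF frame] .

lemma E_const: "p \<in> U \<Longrightarrow> i \<in> {1..3} \<Longrightarrow> (\<And>q. q \<in> U \<Longrightarrow> f q = k) \<Longrightarrow> E i p f = 0"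
  using frame_derivative_const[OF frame] .

lemma E_cong: "p \<in> U \<Longrightarrow> i \<in> {1..3} \<Longrightarrow> (\<And>q. q \<in> U \<Longrightarrow> f q = h q) \<Longrightarrow> E i p f = E i p h"
  using frame_derivative_cong[OF frame] .

lemma E_minus: "p \<in> U \<Longrightarrow> i \<in> {1..3} \<Longrightarrow> E i p (\<lambda>q. - f q) = - E i p f"
  using tangent_fun_minus[OF E_tangent] .

lemma E_mult: "p \<in> U \<Longrightarrow> i \<in> {1..3} \<Longrightarrow> smooth_near A p f \<Longrightarrow> smooth_near A p h \<Longrightarrow>
    E i p (\<lambda>q. f q * h q) = f p * E i p h + h p * E i p f"
  using tangent_fun_mult[OF E_tangent] .

lemma E_cmult: "p \<in> U \<Longrightarrow> i \<in> {1..3} \<Longrightarrow> smooth_near A p f \<Longrightarrow> E i p (\<lambda>q. k * f q) = k * E i p f"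
  using tangent_fun_cmult[OF E_tangent] .

text \<open>The relations of \<open>G_simps\<close> hold on the whole open set \<open>U\<close> and
  may therefore be differentiated.\<close>

lemma dG_simps:
  assumes p: "p \<in> U" and i: "i \<in> {1..3}"
  shows "j \<in> {1..3} \<Longrightarrow> k \<in> {1..3} \<Longrightarrow> E i p (G j k k) = 0"
    and "j \<in> {1..3} \<Longrightarrow> E i p (G j 2 1) = - E i p (G j 1 2)"
    and "j \<in> {1..3} \<Longrightarrow> E i p (G j 3 1) = - E i p (G j 1 3)"
    and "j \<in> {1..3} \<Longrightarrow> E i p (G j 3 2) = - E i p (G j 2 3)"
    and "E i p (G 1 1 2) = 0" and "E i p (G 1 1 3) = 0" and "E i p (G 3 1 2) = E i p (G 2 1 3)"
  using E_const[OF p i, of "G j k k" 0] E_const[OF p i, of "G 1 1 2" 0] E_const[OF p i, of "G 1 1 3" 0]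
    E_cong[OF p i, of "G j 2 1" "\<lambda>q. - G j 1 2 q"] E_cong[OF p i, of "G j 3 1" "\<lambda>q. - G j 1 3 q"]
    E_cong[OF p i, of "G j 3 2" "\<lambda>q. - G j 2 3 q"] E_cong[OF p i, of "G 3 1 2" "G 2 1 3"]
  by (simp_all add: G_simps E_minus[OF p i])

lemma h_coeffs:
  assumes p: "p \<in> U"
  shows "g p (h_op A \<phi> \<xi> (E 2) p) (E 1 p) = 0"
    and "g p (h_op A \<phi> \<xi> (E 2) p) (E 2 p) = - G 2 1 3 p"
    and "g p (h_op A \<phi> \<xi> (E 2) p) (E 3 p) = G 2 1 2 p - 1"
    and "g p (h_op A \<phi> \<xi> (E 3) p) (E 2 p) = G 2 1 2 p - 1"
    and "g p (h_op A \<phi> \<xi> (E 3) p) (E 3 p) = G 2 1 3 p"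
proof -
  \<comment> \<open>This equality is available on \<open>U\<close> only, so it enters the bracket as
    an equality of germs.\<close>
  have "\<forall>\<^sub>F q in nhds p. ap1 \<phi> (E 3) q = (- E 2) q"
    using frame_eventually[OF frame p] by eventually_elim (simp add: ap1_def phi_E)
  then have "lie_bracket A \<xi> (ap1 \<phi> (E 3)) p = lie_bracket A \<xi> (- E 2) p"
    using p by (intro lie_bracket_cong) auto
  also have "\<dots> = - lie_bracket A \<xi> (E 2) p"
    using p by (simp add: torsion_free D_uminus_left D_uminus_right)
  finally have "lie_bracket A \<xi> (ap1 \<phi> (E 3)) p = - lie_bracket A \<xi> (E 2) p" .
  then show "g p (h_op A \<phi> \<xi> (E 2) p) (E 1 p) = 0"
    and "g p (h_op A \<phi> \<xi> (E 2) p) (E 2 p) = - G 2 1 3 p"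
    and "g p (h_op A \<phi> \<xi> (E 2) p) (E 3 p) = G 2 1 2 p - 1"
    and "g p (h_op A \<phi> \<xi> (E 3) p) (E 2 p) = G 2 1 2 p - 1"
    and "g p (h_op A \<phi> \<xi> (E 3) p) (E 3 p) = G 2 1 3 p"
    using p by (simp_all add: h_inner E_3[symmetric] phi_E g_uminus_left g_uminus_right
        bracket_reeb_inner G_simps)
qed

text \<open>With u = \<open>G 2 1 2\<close> - 1 and q = \<open>G 2 1 3\<close>, the pair (q, u)
  rotates along \<xi> at twice the speed of the frame: h is parallel along \<xi>, while the frame
  turns at rate a = \<open>G 1 2 3\<close>.\<close>

lemma h_parallel_coeffs:
  assumes p: "p \<in> U"
  shows "E 1 p (G 2 1 3) = - 2 * (G 2 1 2 p - 1) * G 1 2 3 p"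
    and "E 1 p (G 2 1 2) = 2 * G 2 1 3 p * G 1 2 3 p"
proof -
  let ?h = "h_op A \<phi> \<xi>"
  have hf: "field_near p (?h (E 2))" using p by (simp add: h_field)
  have *: "E 1 p (\<lambda>q. g q (?h (E 2) q) (E k q))
     = (\<Sum>m=1..3. g p (?h (E 2) p) (E m p) * G 1 k m p) + (\<Sum>m=1..3. G 1 2 m p * g p (?h (E m) p) (E k p))"
    if k: "k \<in> {1..3}" for k
  proof -
    have "E 1 p (\<lambda>q. g q (?h (E 2) q) (E k q))
      = g p (D (E 1) (?h (E 2)) p) (E k p) + g p (?h (E 2) p) (D (E 1) (E k) p)"
      using p k hf by (intro metric_compatible) auto
    also have "D (E 1) (?h (E 2)) p = ?h (D (E 1) (E 2)) p"
      using h_parallel[of p "E 2"] p by (simp add: E_1)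
    also have "g p (?h (D (E 1) (E 2)) p) (E k p) = (\<Sum>m=1..3. G 1 2 m p * g p (?h (E m) p) (E k p))"
      unfolding connection_coeff_def
      by (rule tensorial_expand[OF frame p h_tensorial]) (use p k in simp_all)
    also have "g p (?h (E 2) p) (D (E 1) (E k) p) = (\<Sum>m=1..3. g p (?h (E 2) p) (E m p) * G 1 k m p)"
      unfolding connection_coeff_def
      by (rule frame_inner_expand[OF frame p]) (use p k hf in simp_all)
    finally show ?thesis by simp
  qed
  have "E 1 p (\<lambda>q. g q (?h (E 2) q) (E 2 q)) = E 1 p (\<lambda>q. - G 2 1 3 q)"
    "E 1 p (\<lambda>q. g q (?h (E 2) q) (E 3 q)) = E 1 p (\<lambda>q. G 2 1 2 q - 1)"
    by (rule E_cong[OF p]; simp add: h_coeffs)+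
  moreover have "E 1 p (\<lambda>q. - G 2 1 3 q) = - E 1 p (G 2 1 3)" using p by (simp add: E_minus)
  moreover have "E 1 p (\<lambda>q. G 2 1 2 q - 1) = E 1 p (G 2 1 2)"
    using tangent_fun_diff[OF E_tangent[OF p], of 1 "G 2 1 2" "\<lambda>_. 1"] p
      tangent_const[OF E_tangent[OF p], of 1] by simp
  ultimately show "E 1 p (G 2 1 3) = - 2 * (G 2 1 2 p - 1) * G 1 2 3 p"
    and "E 1 p (G 2 1 2) = 2 * G 2 1 3 p * G 1 2 3 p"
    using *[of 2] *[of 3] by (simp_all add: sum_1_3 h_coeffs[OF p] G_simps[OF p] algebra_simps)
qed

text \<open>The description operator in \<open>ricci_op\<close> is evaluated by exhibiting the
  vector \<open>v\<close> that represents \<open>ricci A g D \<xi>\<close>, unique because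
  \<open>g\<close> is positive. The eigenvector condition makes \<open>v\<close> a multiple of
  \<xi>.\<close>

lemma ricci_reeb:
  assumes p: "p \<in> U" and i: "i \<in> {2, 3}"
  shows "Ric 1 i p = 0"
proof -
  define v where "v = (\<Sum>i=1..3. Ric 1 i p *\<^sub>v E i p)"
  have v: "v \<in> tangent_space A p" "\<And>x. x \<in> tangent_space A p \<Longrightarrow> g p v x = (\<Sum>i=1..3. Ric 1 i p * g p (E i p) x)"
    unfolding v_def using p by (auto intro!: g_sum3_left(1)[of "\<lambda>i. E i p" p "E 1 p"] g_sum3_left(2))
  have *: "ricci A g D \<xi> Y p = g p v (Y p)" if Y: "field_near p Y" for Y
  proof -
    have "ricci A g D \<xi> Y p = (\<Sum>i=1..3. g p (Y p) (E i p) * ricci A g D \<xi> (E i) p)"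
      by (rule tensorial_expand[OF frame p ricci_tensorial2[OF frame p] Y]) simp
    also have "\<dots> = g p v (Y p)"
      using Y p by (simp add: v(2) sum_1_3 E_1 g_sym[of "Y p"])
    finally show ?thesis .
  qed
  have "ricci_op A g D \<xi> p = v" unfolding ricci_op_def
  proof (rule the_equality)
    show "v \<in> tangent_space A p \<and>
      (\<forall>U Y. p \<in> U \<and> vector_field A U Y \<longrightarrow> ricci A g D \<xi> Y p = g p v (Y p))"
      using v(1) * field_nearI by blast
  next
    fix w assume w: "w \<in> tangent_space A p \<and>
      (\<forall>U Y. p \<in> U \<and> vector_field A U Y \<longrightarrow> ricci A g D \<xi> Y p = g p w (Y p))"
    show "w = v"
    proof (rule g_eqI)
      fix x assume "x \<in> tangent_space A p"
      then obtain Y where Y: "field_near p Y" "Y p = x" by (rule field_extension)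
      then show "g p w x = g p v x" using w * unfolding field_near_def by metis
    qed (use v w in auto)
  qed
  then obtain \<mu> where "v = \<mu> *\<^sub>v E 1 p" using ricci_eigen[of p] E_1 by metis
  then have "g p v (E i p) = 0" using p i by (auto simp: g_scale_left)
  moreover have "g p v (E i p) = Ric 1 i p" using p i by (auto simp: v(2) sum_1_3)
  ultimately show ?thesis by simp
qed

lemma Ric_frame:
  "p \<in> U \<Longrightarrow> j \<in> {1..3} \<Longrightarrow> k \<in> {1..3} \<Longrightarrow>
    Ric j k p = (\<Sum>i=1..3. g p (curvature A D (E i) (E j) (E k) p) (E i p))"
  by (rule ricci_frame[OF frame]) simp_all

text \<open>Metric compatibility and torsion-freeness turn the Lie derivative of the metric into the
  symmetrised covariant derivative of the field, where derivatives of \<alpha> meet only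
  \<xi>-slots.\<close>

lemma lie_metric_collinear:
  assumes p: "p \<in> U" and i: "i \<in> {1..3}" and j: "j \<in> {1..3}" and \<alpha>: "smooth_near A p \<alpha>"
  shows "lie_metric A g (\<alpha> *\<^sub>F \<xi>) (E i) (E j) p
    = (if j = 1 then E i p \<alpha> else 0) + (if i = 1 then E j p \<alpha> else 0) + \<alpha> p * (G i 1 j p + G j 1 i p)"
proof -
  have V: "field_near p (\<alpha> *\<^sub>F \<xi>)" using \<alpha> by simp
  have *: "g p (D (E i) (\<alpha> *\<^sub>F \<xi>) p) (E j p) = (if j = 1 then E i p \<alpha> else 0) + \<alpha> p * G i 1 j p"
    if "i \<in> {1..3}" "j \<in> {1..3}" for i j
    using p that \<alpha> E_inner[OF p, of 1 j]
    by (simp add: D_scale_right g_simps connection_coeff_def E_1)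
  have "(\<alpha> *\<^sub>F \<xi>) p (\<lambda>q. g q (E i q) (E j q))
      = g p (D (\<alpha> *\<^sub>F \<xi>) (E i) p) (E j p) + g p (E i p) (D (\<alpha> *\<^sub>F \<xi>) (E j) p)"
    using p i j V by (intro metric_compatible) auto
  then have "lie_metric A g (\<alpha> *\<^sub>F \<xi>) (E i) (E j) p
     = g p (D (E i) (\<alpha> *\<^sub>F \<xi>) p) (E j p) + g p (D (E j) (\<alpha> *\<^sub>F \<xi>) p) (E i p)"
    using p i j V by (simp add: lie_metric_def ap2_def torsion_free g_simps g_sym[of "E i p"])
  then show ?thesis using *[OF i j] *[OF j i] by (simp add: algebra_simps)
qed

section \<open>The (0,2)-Cotton tensor in an adapted frame\<close>

lemma phi_frame_at_orthonormal:
  assumes p: "p \<in> U"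
  obtains V where "p \<in> V" "orthonormal_frame A g V (phi_frame_at A \<phi> \<xi> g p)"
    "phi_frame_at A \<phi> \<xi> g p 1 p = E 1 p"
    "phi_frame_at A \<phi> \<xi> g p 3 p = \<phi> p (phi_frame_at A \<phi> \<xi> g p 2 p)"
proof -
  have "\<exists>V. p \<in> V \<and> phi_frame A \<phi> \<xi> g V (phi_frame_at A \<phi> \<xi> g p)"
    unfolding phi_frame_at_def
  proof (rule someI[of _ E], intro exI conjI)
    show "p \<in> U" by (rule p)
    show "phi_frame A \<phi> \<xi> g U E"
      unfolding phi_frame_def using frame by (simp add: E_1 phi_E)
  qed
  then show ?thesis using that unfolding phi_frame_def by (metis E_1)
qed

lemma cotton2_components:
  assumes p: "p \<in> U"
  defines "C \<equiv> \<lambda>i j k. cotton3 A g D (E i) (E j) (E k) p"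
  shows "cotton2 A \<phi> \<xi> g D (E 1) (E 1) p = C 2 3 1"
    and "cotton2 A \<phi> \<xi> g D (E 2) (E 2) p + cotton2 A \<phi> \<xi> g D (E 3) (E 3) p = C 3 1 2 + C 1 2 3"
    and "cotton2 A \<phi> \<xi> g D (E 2) (E 3) p = C 1 2 2"
proof -
  define F where "F = phi_frame_at A \<phi> \<xi> g p"
  obtain V where V: "p \<in> V" and F: "orthonormal_frame A g V F" and F1: "F 1 p = E 1 p" and F3: "F 3 p = \<phi> p (F 2 p)"
    unfolding F_def by (rule phi_frame_at_orthonormal[OF p])
  note fF = frame_field[OF F V]
  define x y where "x = g p (F 2 p) (E 2 p)" and "y = g p (F 2 p) (E 3 p)"
  have F2T: "F 2 p \<in> tangent_space A p" using fF[of 2] by simp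
  have "g p (F 2 p) (E 1 p) = 0" using frame_inner[OF F V, of 2 1] F1 by simp
  then have F2: "F 2 p = x *\<^sub>v E 2 p + y *\<^sub>v E 3 p"
    using frame_expand[OF frame p F2T] by (simp add: sum_1_3 x_def y_def fun_eq_iff)
  \<comment> \<open>\<phi> is a quarter turn of the plane orthogonal to \<xi>, so the pair (F 2, F
    3) is rotated and not reflected; a reflection would flip the sign of the Cotton
    components.\<close>
  have F3: "F 3 p = (- y) *\<^sub>v E 2 p + x *\<^sub>v E 3 p"
    unfolding F3 F2 using p by (simp add: phi_add phi_scale phi_E fun_eq_iff)
  have xy: "x * x + y * y = 1"
    using frame_inner[OF F V, of 2 2] p unfolding F2 by (simp add: g_simps)
  define R where "R i j = g p (F i p) (E j p)" for i j
  have R: "R 1 1 = 1" "R 1 2 = 0" "R 1 3 = 0" "R 2 1 = 0" "R 2 2 = x" "R 2 3 = y" "R 3 1 = 0" "R 3 2 = - y" "R 3 3 = x"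
    unfolding R_def F1 F2 F3 using p by (simp_all add: g_simps)
  have R': "g p (E j p) (F i p) = R i j" if "i \<in> {1..3}" "j \<in> {1..3}" for i j
    unfolding R_def using p that fF by (simp add: g_sym)
  have T: "cotton3 A g D (F i) (F j) (F k) p = (\<Sum>l=1..3. R i l * (\<Sum>m=1..3. R j m * (\<Sum>n=1..3. R k n * C l m n)))"
    if i: "i \<in> {1..3}" and j: "j \<in> {1..3}" and k: "k \<in> {1..3}" for i j k
  proof -
    have "cotton3 A g D (F i) (F j) (F k) p = (\<Sum>l=1..3. R i l * cotton3 A g D (E l) (F j) (F k) p)"
      unfolding R_def by (rule tensorial_expand[OF frame p cotton3_tensorial1[OF frame p]]) (use fF i j k in auto)
    also have "\<dots> = (\<Sum>l=1..3. R i l * (\<Sum>m=1..3. R j m * cotton3 A g D (E l) (E m) (F k) p))"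
      unfolding R_def by (intro sum.cong refl arg_cong2[of _ _ _ _ "(*)"]
          tensorial_expand[OF frame p cotton3_tensorial2[OF frame p]]) (use fF i j k p in auto)
    also have "\<dots> = (\<Sum>l=1..3. R i l * (\<Sum>m=1..3. R j m * (\<Sum>n=1..3. R k n * C l m n)))"
      unfolding R_def C_def by (intro sum.cong refl arg_cong2[of _ _ _ _ "(*)"]
          tensorial_expand[OF frame p cotton3_tensorial3[OF frame p]]) (use fF i j k p in auto)
    finally show ?thesis .
  qed
  have C0: "C i i k = 0" and C1: "C 2 1 k = - C 1 2 k" "C 3 1 k = - C 1 3 k" "C 3 2 k = - C 2 3 k" for i k
    unfolding C_def using cotton3_antisym[of "E i" "E i" "E k" p] by (simp_all add: cotton3_antisym[of "E 1"] cotton3_antisym[of "E 2" "E 3"])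
  have comp: "cotton_comp A g D F i 1 p = (\<Sum>n=1..3. R i n * C 2 3 n)"
    "cotton_comp A g D F i 2 p = (\<Sum>n=1..3. R i n * (y * C 1 2 n - x * C 1 3 n))"
    "cotton_comp A g D F i 3 p = (\<Sum>n=1..3. R i n * (x * C 1 2 n + y * C 1 3 n))" if i: "i \<in> {1..3}" for i
  proof -
    have "cotton_comp A g D F i 1 p = cotton3 A g D (F 2) (F 3) (F i) p"
      "cotton_comp A g D F i 2 p = cotton3 A g D (F 3) (F 1) (F i) p"
      "cotton_comp A g D F i 3 p = cotton3 A g D (F 1) (F 2) (F i) p"
      using cotton3_antisym[of "F 2" "F 3" "F i" p] cotton3_antisym[of "F 3" "F 1" "F i" p]
        cotton3_antisym[of "F 1" "F 2" "F i" p]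
      by (simp_all add: cotton_comp_def sum_1_3 eps_def)
    \<comment> \<open>An alternating expression in the plane picks up the determinant x^2 + y^2 of
      the rotation.\<close>
    moreover have "cotton3 A g D (F 2) (F 3) (F i) p = (x * x + y * y) * (\<Sum>n=1..3. R i n * C 2 3 n)"
      using i by (simp add: T R sum_1_3 C0 C1 algebra_simps)
    moreover have "cotton3 A g D (F 3) (F 1) (F i) p = (\<Sum>n=1..3. R i n * (y * C 1 2 n - x * C 1 3 n))"
      using i by (simp add: T R sum_1_3 C0 C1 algebra_simps)
    moreover have "cotton3 A g D (F 1) (F 2) (F i) p = (\<Sum>n=1..3. R i n * (x * C 1 2 n + y * C 1 3 n))"
      using i by (simp add: T R sum_1_3 C0 C1 algebra_simps)
    ultimately show "cotton_comp A g D F i 1 p = (\<Sum>n=1..3. R i n * C 2 3 n)"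
      "cotton_comp A g D F i 2 p = (\<Sum>n=1..3. R i n * (y * C 1 2 n - x * C 1 3 n))"
      "cotton_comp A g D F i 3 p = (\<Sum>n=1..3. R i n * (x * C 1 2 n + y * C 1 3 n))"
      unfolding xy by simp_all
  qed
  have c2: "cotton2 A \<phi> \<xi> g D (E a) (E b) p = (\<Sum>i=1..3. \<Sum>j=1..3. cotton_comp A g D F i j p * R i a * R j b)"
    if "a \<in> {1..3}" "b \<in> {1..3}" for a b
    unfolding cotton2_def Let_def F_def[symmetric] ap2_def using that by (intro sum.cong refl) (simp add: R')
  show "cotton2 A \<phi> \<xi> g D (E 1) (E 1) p = C 2 3 1"
    by (simp add: c2 comp sum_1_3 R)
  have "cotton2 A \<phi> \<xi> g D (E 2) (E 2) p + cotton2 A \<phi> \<xi> g D (E 3) (E 3) p = (x * x + y * y) * (x * x + y * y) * (C 3 1 2 + C 1 2 3)"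
    by (simp add: c2 comp sum_1_3 R C1 algebra_simps)
  then show "cotton2 A \<phi> \<xi> g D (E 2) (E 2) p + cotton2 A \<phi> \<xi> g D (E 3) (E 3) p = C 3 1 2 + C 1 2 3" unfolding xy by simp
  have "cotton2 A \<phi> \<xi> g D (E 2) (E 3) p = (x * x + y * y) * (x * x + y * y) * C 1 2 2"
    by (simp add: c2 comp sum_1_3 R C1 algebra_simps)
  then show "cotton2 A \<phi> \<xi> g D (E 2) (E 3) p = C 1 2 2" unfolding xy by simp
qed

section \<open>Rotated frames and eigenframes of h\<close>

text \<open>Both coefficients come from the covariant derivative of \<xi> in the direction e', so
  they depend on the value of e' at \<open>r\<close> alone and no derivative of the rotation angle
  appears. The result is the double-angle law for a symmetric 2x2 matrix.\<close>

lemma rotated_coeffs: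
  assumes r: "r \<in> U" and e': "transverse_unit V e'" "r \<in> V" and rot: "e' r = c *\<^sub>v E 2 r + s *\<^sub>v E 3 r"
  shows "c * c + s * s = 1"
    and "connection_coeff (adapted_frame e') 2 1 2 r
      = 1 + (G 2 1 2 r - 1) * (c * c - s * s) + 2 * (c * s) * G 2 1 3 r"
    and "connection_coeff (adapted_frame e') 2 1 3 r
      = G 2 1 3 r * (c * c - s * s) - 2 * (c * s) * (G 2 1 2 r - 1)"
proof -
  show cs: "c * c + s * s = 1"
    using e' r unfolding transverse_unit_def by (auto simp: rot g_simps)
  have f: "field_near r e'" using e' unfolding transverse_unit_def by (blast intro: field_nearI)
  have rot': "\<phi> r (e' r) = (- s) *\<^sub>v E 2 r + c *\<^sub>v E 3 r"
    unfolding rot using r by (simp add: phi_add phi_scale phi_E fun_eq_iff)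
  have k: "g r (D (E i) \<xi> r) (E j r) = G i 1 j r" for i j
    by (simp add: connection_coeff_def E_1)
  have *: "g r (D e' \<xi> r) w = c * g r (D (E 2) \<xi> r) w + s * g r (D (E 3) \<xi> r) w"
    if "w \<in> tangent_space A r" for w
    using tensorial_expand[OF frame r tensorial_D[OF tensorial_metric[OF that] reeb_field] f] r
    by (simp add: rot g_simps sum_1_3)
  have "connection_coeff (adapted_frame e') 2 1 2 r = g r (D e' \<xi> r) (c *\<^sub>v E 2 r + s *\<^sub>v E 3 r)"
    by (simp add: connection_coeff_def adapted_frame_simps rot)
  also have "\<dots> = (c * c + s * s) + (G 2 1 2 r - 1) * (c * c - s * s) + 2 * (c * s) * G 2 1 3 r"
    using r by (simp add: * g_add_right g_scale_right k G_simps algebra_simps)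
  finally show "connection_coeff (adapted_frame e') 2 1 2 r
      = 1 + (G 2 1 2 r - 1) * (c * c - s * s) + 2 * (c * s) * G 2 1 3 r" unfolding cs .
  have "connection_coeff (adapted_frame e') 2 1 3 r = g r (D e' \<xi> r) ((- s) *\<^sub>v E 2 r + c *\<^sub>v E 3 r)"
    by (simp add: connection_coeff_def adapted_frame_simps ap1_def rot')
  also have "\<dots> = G 2 1 3 r * (c * c - s * s) - 2 * (c * s) * (G 2 1 2 r - 1)"
    using r by (simp add: * g_add_right g_scale_right k G_simps algebra_simps)
  finally show "connection_coeff (adapted_frame e') 2 1 3 r
      = G 2 1 3 r * (c * c - s * s) - 2 * (c * s) * (G 2 1 2 r - 1)" .
qed

text \<open>The vector \<open>x e + y \<phi>e\<close> below is \<open>h e + l e\<close> or \<open>h \<phi>e + l \<phi>e\<close>, where \<open>l\<close> is the positive eigenvalue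
  of \<open>h\<close>; at least one of the two does not vanish.\<close>

lemma eigenframe_exists:
  assumes p: "p \<in> U" and h: "G 2 1 2 p \<noteq> 1 \<or> G 2 1 3 p \<noteq> 0"
  obtains V e' where "p \<in> V" "transverse_unit V e'"
    "\<And>r. r \<in> V \<Longrightarrow> connection_coeff (adapted_frame e') 2 1 2 r = 1"
    "\<And>r. r \<in> V \<Longrightarrow> connection_coeff (adapted_frame e') 2 1 3 r \<noteq> 0"
proof -
  define u q where "u r = G 2 1 2 r - 1" and "q r = G 2 1 3 r" for r
  define \<Lambda> where "\<Lambda> r = u r * u r + q r * q r" for r
  define l where "l r = \<Lambda> r powr (1/2)" for r
  have su: "smooth_near A p u" and sq: "smooth_near A p q"
    unfolding u_def[abs_def] q_def[abs_def] using p by (simp_all add: smooth_near_diff)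
  then have s\<Lambda>: "smooth_near A p \<Lambda>" unfolding \<Lambda>_def[abs_def] by (intro smooth_near_add smooth_near_mult)
  have \<Lambda>p: "\<Lambda> p > 0"
    using h unfolding \<Lambda>_def u_def q_def by (metis eq_iff_diff_eq_0 sum_squares_gt_zero_iff)
  have sl: "smooth_near A p l" unfolding l_def[abs_def] by (rule smooth_near_powr[OF s\<Lambda> \<Lambda>p])
  have l_sq: "l r * l r = u r * u r + q r * q r" for r
  proof -
    have "\<Lambda> r \<ge> 0" unfolding \<Lambda>_def by simp
    then show ?thesis unfolding l_def by (simp add: powr_add[symmetric] \<Lambda>_def)
  qed
  have l_pos: "l p > 0" unfolding l_def using \<Lambda>p by simp
  \<comment> \<open>By \<open>rotated_coeffs\<close> the equation \<open>xy\<close> says, up to the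
    squared normalising factor, that the new frame has \<open>G 2 1 2\<close> equal to 1.\<close>
  obtain x y where sx: "smooth_near A p x" and sy: "smooth_near A p y"
    and xy: "\<And>r. u r * (x r * x r - y r * y r) + 2 * (x r * y r) * q r = 0"
    and nz: "x p \<noteq> 0 \<or> y p \<noteq> 0"
  \<comment> \<open>If \<open>q p = l p\<close>, then \<open>u p = 0\<close> and h e = - l e at
    \<open>p\<close>; so h e + l e vanishes there and h \<phi>e + l \<phi>e is used. Otherwise the
    e-component l - q of h e + l e is nonzero at \<open>p\<close>.\<close>
  proof (cases "q p = l p")
    case True
    show ?thesis
    proof (rule that[of u "\<lambda>r. q r + l r"])
      show "smooth_near A p (\<lambda>r. q r + l r)" by (rule smooth_near_add[OF sq sl])
      have "u r * (u r * u r - (q r + l r) * (q r + l r)) + 2 * (u r * (q r + l r)) * q r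
        = u r * (u r * u r + q r * q r - l r * l r)" for r by (simp add: algebra_simps)
      then show "u r * (u r * u r - (q r + l r) * (q r + l r)) + 2 * (u r * (q r + l r)) * q r = 0" for r
        by (simp add: l_sq)
      show "u p \<noteq> 0 \<or> q p + l p \<noteq> 0" using True l_pos by simp
    qed (rule su)
  next
    case False
    show ?thesis
    proof (rule that[of "\<lambda>r. l r - q r" u])
      show "smooth_near A p (\<lambda>r. l r - q r)" by (rule smooth_near_diff[OF sl sq])
      have "u r * ((l r - q r) * (l r - q r) - u r * u r) + 2 * ((l r - q r) * u r) * q r
        = u r * (l r * l r - (u r * u r + q r * q r))" for r by (simp add: algebra_simps)
      then show "u r * ((l r - q r) * (l r - q r) - u r * u r) + 2 * ((l r - q r) * u r) * q r = 0" for r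
        by (simp add: l_sq)
      show "l p - q p \<noteq> 0 \<or> u p \<noteq> 0" using False by simp
    qed (rule su)
  qed
  define X where "X = x *\<^sub>F E 2 + y *\<^sub>F E 3"
  have X: "field_near p X" unfolding X_def using p sx sy by simp
  have "g p (X p) (E 2 p) = x p" "g p (X p) (E 3 p) = y p"
    unfolding X_def using p by (simp_all add: scale_field_apply g_simps)
  then have X0: "X p \<noteq> 0" using nz p by auto
  have "\<forall>\<^sub>F r in nhds p. g r (X r) (\<xi> r) = 0"
    using frame_eventually[OF frame p]
    by eventually_elim (simp add: X_def scale_field_apply g_simps)
  then obtain V n where V: "p \<in> V" "smooth_fun A V n" "transverse_unit V (n *\<^sub>F X)"
    using normalize_transverse[OF X X0] by metis
  obtain W where W: "p \<in> W" "smooth_fun A W \<Lambda>" using s\<Lambda> unfolding smooth_near_def by blast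
  define Z where "Z = U \<inter> V \<inter> {r\<in>W. \<Lambda> r > 0}"
  have Z: "open Z" unfolding Z_def
    by (intro open_Int frame_open[OF frame] smooth_fun_open[OF V(2)] smooth_fun_open_nonzero(2)[OF W(2)])
  have tZ: "transverse_unit Z (n *\<^sub>F X)"
    by (rule transverse_unit_subset[OF V(3) Z]) (auto simp: Z_def)
  show ?thesis
  proof (rule that[OF _ tZ])
    show "p \<in> Z" unfolding Z_def using p V W \<Lambda>p by simp
    fix r assume r: "r \<in> Z"
    then have rU: "r \<in> U" and rV: "r \<in> V" and \<Lambda>r: "\<Lambda> r > 0" unfolding Z_def by auto
    have "(n *\<^sub>F X) r = (n r * x r) *\<^sub>v E 2 r + (n r * y r) *\<^sub>v E 3 r"
      by (simp add: X_def scale_field_apply fun_eq_iff algebra_simps)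
    note C = rotated_coeffs[OF rU tZ r this, folded u_def q_def]
    have 0: "u r * (n r * x r * (n r * x r) - n r * y r * (n r * y r)) + 2 * (n r * x r * (n r * y r)) * q r
      = n r * n r * (u r * (x r * x r - y r * y r) + 2 * (x r * y r) * q r)"
      by (simp add: algebra_simps)
    then show "connection_coeff (adapted_frame (n *\<^sub>F X)) 2 1 2 r = 1"
      using C(2) xy[of r] by simp
    show "connection_coeff (adapted_frame (n *\<^sub>F X)) 2 1 3 r \<noteq> 0"
    proof
      assume "connection_coeff (adapted_frame (n *\<^sub>F X)) 2 1 3 r = 0"
      moreover define c s where "c = n r * x r" and "s = n r * y r"
      ultimately have "q r * (c * c - s * s) - 2 * (c * s) * u r = 0"
        "u r * (c * c - s * s) + 2 * (c * s) * q r = 0" "c * c + s * s = 1"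
        using C 0 xy[of r] by simp_all
      \<comment> \<open>The double-angle rotation preserves the squared length of (q, u), so the
        vanishing of both new coefficients would force \<open>\<Lambda> r = 0\<close>.\<close>
      moreover have "(u r * u r + q r * q r) * (c * c + s * s) * (c * c + s * s)
        = (q r * (c * c - s * s) - 2 * (c * s) * u r) * (q r * (c * c - s * s) - 2 * (c * s) * u r)
        + (u r * (c * c - s * s) + 2 * (c * s) * q r) * (u r * (c * c - s * s) + 2 * (c * s) * q r)"
        by (simp add: algebra_simps)
      ultimately have "\<Lambda> r = 0" unfolding \<Lambda>_def by simp
      then show False using \<Lambda>r by simp
    qed
  qed
qed

lemma soliton_components:
  assumes p: "p \<in> U" and i: "i \<in> {1..3}" and j: "j \<in> {1..3}" and \<alpha>: "smooth_near A p \<alpha>"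
    and soliton: "cotton_soliton A \<phi> \<xi> g D (\<alpha> *\<^sub>F \<xi>) \<sigma>"
  shows "(if j = 1 then E i p \<alpha> else 0) + (if i = 1 then E j p \<alpha> else 0) + \<alpha> p * (G i 1 j p + G j 1 i p)
    + cotton2 A \<phi> \<xi> g D (E i) (E j) p = (if i = j then \<sigma> else 0)"
proof -
  have "vector_field A U (E i)" "vector_field A U (E j)"
    using frame i j unfolding orthonormal_frame_def by auto
  then have "lie_metric A g (\<alpha> *\<^sub>F \<xi>) (E i) (E j) p + cotton2 A \<phi> \<xi> g D (E i) (E j) p
      - \<sigma> * ap2 g (E i) (E j) p = 0"
    using soliton p unfolding cotton_soliton_def by blast
  then show ?thesis
    using p i j by (simp add: lie_metric_collinear[OF p i j \<alpha>] ap2_def split: if_splits)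
qed

end

text \<open>\<open>G 2 1 2 = 1\<close> makes e an eigenvector of h with eigenvalue -
  \<open>G 2 1 3\<close>. The eigenvalue may be 0, so both cases of the proof start here.\<close>

locale eigenframe_domain = adapted_frame_domain +
  assumes eigen: "\<And>p. p \<in> U \<Longrightarrow> G 2 1 2 p = 1"
begin

lemma dG_eigen: "p \<in> U \<Longrightarrow> i \<in> {1..3} \<Longrightarrow> E i p (G 2 1 2) = 0"
  "p \<in> U \<Longrightarrow> i \<in> {1..3} \<Longrightarrow> E i p (G 3 1 3) = 0"
  by (rule E_const[where k = 1]; simp add: G_simps eigen)+

lemma reeb_q_zero: "p \<in> U \<Longrightarrow> E 1 p (G 2 1 3) = 0"
  using h_parallel_coeffs(1)[of p] eigen[of p] by simp

text \<open>The entries \<open>Ric 1 2\<close> and \<open>Ric 1 3\<close> come from the eigenvector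
  condition in \<open>ricci_reeb\<close>; the entries with \<xi> in the second slot are computed and
  still contain derivatives of \<open>G 2 1 3\<close>.\<close>

lemma Ric_values:
  assumes p: "p \<in> U"
  shows "Ric 1 1 p = - 2 * (1 + G 2 1 3 p * G 2 1 3 p)"
    and "Ric 2 1 p = E 3 p (G 2 1 3) - 2 * G 2 1 3 p * G 2 2 3 p"
    and "Ric 3 1 p = E 2 p (G 2 1 3) + 2 * G 2 1 3 p * G 3 2 3 p"
    and "Ric 2 3 p = - 2 * G 2 1 3 p" and "Ric 3 2 p = - 2 * G 2 1 3 p"
  using p
  by (simp_all add: Ric_frame sum_1_3 curvature_frame[OF frame] G_simps dG_simps dG_eigen eigen
      reeb_q_zero algebra_simps)

text \<open>The off-diagonal Ricci entries vanish on all of \<open>U\<close>, and so do their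
  derivatives. The remaining terms carry a factor \<open>G 2 1 3\<close>, except those with
  \<open>G 1 2 3\<close>, which appear in both summands of the second claim with opposite
  signs.\<close>

lemma cotton3_kenmotsu:
  assumes q0: "\<And>q. q \<in> U \<Longrightarrow> G 2 1 3 q = 0" and p: "p \<in> U"
  shows "cotton3 A g D (E 2) (E 3) (E 1) p = 0"
    and "cotton3 A g D (E 3) (E 1) (E 2) p + cotton3 A g D (E 1) (E 2) (E 3) p = 0"
proof -
  have dq: "E i q (G 2 1 3) = 0" if "q \<in> U" "i \<in> {1..3}" for i q
    using that by (intro E_const[where k = 0]) (simp_all add: q0)
  have "Ric 2 1 q = 0 \<and> Ric 3 1 q = 0 \<and> Ric 2 3 q = 0 \<and> Ric 3 2 q = 0 \<and> Ric 1 2 q = 0 \<and> Ric 1 3 q = 0"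
    if "q \<in> U" for q
    using that by (simp add: Ric_values q0 dq ricci_reeb)
  then have R: "Ric 2 1 q = 0" "Ric 3 1 q = 0" "Ric 2 3 q = 0" "Ric 3 2 q = 0" "Ric 1 2 q = 0" "Ric 1 3 q = 0"
    if "q \<in> U" for q using that by auto
  have dR: "E i p (Ric j k) = 0" if "i \<in> {1..3}" "j \<in> {1..3}" "k \<in> {1..3}" "j \<noteq> k" for i j k
  proof (rule E_const[OF p that(1)])
    have "j = 1 \<or> j = 2 \<or> j = 3" "k = 1 \<or> k = 2 \<or> k = 3" using that(2,3) by auto
    then show "Ric j k q = 0" if "q \<in> U" for q using R[OF that] \<open>j \<noteq> k\<close> by auto
  qed
  show "cotton3 A g D (E 2) (E 3) (E 1) p = 0"
    and "cotton3 A g D (E 3) (E 1) (E 2) p + cotton3 A g D (E 1) (E 2) (E 3) p = 0"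
    using p by (simp_all add: cotton3_def ap2_def cov_ricci_frame[OF frame] sum_1_3
        G_simps eigen q0 R dR algebra_simps)
qed

end

section \<open>The region where h does not vanish\<close>

locale non_kenmotsu_eigenframe = eigenframe_domain +
  assumes q_nonzero: "\<And>p. p \<in> U \<Longrightarrow> G 2 1 3 p \<noteq> 0"
begin

text \<open>\<open>G 2 1 2\<close> is constant on \<open>U\<close>, so its rotation law along \<xi>
  reads 0 = 2 q a with q = \<open>G 2 1 3\<close>.\<close>

lemma a_zero: "p \<in> U \<Longrightarrow> G 1 2 3 p = 0"
  using h_parallel_coeffs(2)[of p] dG_eigen(1)[of p 1] q_nonzero[of p] by simp

lemma da_zero: "p \<in> U \<Longrightarrow> i \<in> {1..3} \<Longrightarrow> E i p (G 1 2 3) = 0"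
  by (rule E_const[where k = 0]) (simp_all add: a_zero)

text \<open>These are the Ricci conditions \<open>Ric 1 3 p = 0\<close> and
  \<open>Ric 1 2 p = 0\<close> once a = 0.\<close>

lemma reeb_b: "p \<in> U \<Longrightarrow> E 1 p (G 2 2 3) = - G 2 2 3 p - G 2 1 3 p * G 3 2 3 p"
  and reeb_c: "p \<in> U \<Longrightarrow> E 1 p (G 3 2 3) = - G 3 2 3 p - G 2 1 3 p * G 2 2 3 p"
  using ricci_reeb[of p 2] ricci_reeb[of p 3]
  by (simp_all add: Ric_frame sum_1_3 curvature_frame[OF frame] G_simps dG_simps dG_eigen eigen a_zero da_zero)

text \<open>In the Bianchi identity the derivatives of \<open>G 2 1 3\<close> along e and \<phi> e
  enter through R(e, \<phi> e) \<xi>. The other curvature terms contain derivatives along \<xi>,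
  known from \<open>reeb_b\<close> and \<open>reeb_c\<close>.\<close>

lemma q_derivatives:
  assumes p: "p \<in> U"
  shows "E 2 p (G 2 1 3) = - 2 * (G 2 1 3 p * G 3 2 3 p)"
    and "E 3 p (G 2 1 3) = 2 * (G 2 1 3 p * G 2 2 3 p)"
proof -
  have "g p (curvature A D (E 1) (E 2) (E 3) p) (E k p) + g p (curvature A D (E 2) (E 3) (E 1) p) (E k p)
      + g p (curvature A D (E 3) (E 1) (E 2) p) (E k p) = 0" if "k \<in> {1..3}" for k
    using bianchi_identity[of p "E 1" "E 2" "E 3"] p that
    by (simp add: g_add_left[symmetric])
  from this[of 2] this[of 3] show "E 2 p (G 2 1 3) = - 2 * (G 2 1 3 p * G 3 2 3 p)"
    and "E 3 p (G 2 1 3) = 2 * (G 2 1 3 p * G 2 2 3 p)"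
    using p by (simp_all add: sum_1_3 curvature_frame[OF frame] G_simps dG_simps dG_eigen eigen a_zero da_zero
        reeb_b reeb_c)
qed

text \<open>Let q = \<open>G 2 1 3\<close>, which \<xi> annihilates. The iterated derivative
  \<xi>(e(q)) follows from \<open>q_derivatives\<close> and \<open>reeb_c\<close>, and again from
  the bracket [\<xi>, e]. The terms q \<open>G 3 2 3\<close> agree, but the terms q^2
  \<open>G 2 2 3\<close> have opposite signs, hence the 4. The pair \<xi>, \<phi> e does the same
  for \<open>G 3 2 3\<close>.\<close>

lemma bc_zero:
  assumes p: "p \<in> U"
  shows "G 2 2 3 p = 0" and "G 3 2 3 p = 0"
proof -
  have 1: "E i p (\<lambda>r. E 1 r (G 2 1 3)) = 0" if "i \<in> {1..3}" for i
    by (rule E_const[OF p that]) (rule reeb_q_zero)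
  have "E 1 p (\<lambda>r. E 2 r (G 2 1 3)) = E 1 p (\<lambda>r. - 2 * (G 2 1 3 r * G 3 2 3 r))"
    using p by (intro E_cong) (simp_all add: q_derivatives)
  also have "\<dots> = - 2 * (G 2 1 3 p * E 1 p (G 3 2 3))"
    using p by (subst E_cmult) (simp_all add: E_mult smooth_near_mult reeb_q_zero)
  finally have "- 2 * (G 2 1 3 p * E 1 p (G 3 2 3)) = (\<Sum>m=1..3. (G 1 2 m p - G 2 1 m p) * E m p (G 2 1 3))"
    using commutator_frame[OF frame p, of 1 2 "G 2 1 3"] 1[of 2] p by simp
  then have "4 * (G 2 1 3 p * G 2 1 3 p * G 2 2 3 p) = 0"
    using p by (simp add: sum_1_3 G_simps eigen a_zero reeb_q_zero reeb_c q_derivatives algebra_simps)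
  then show "G 2 2 3 p = 0" using q_nonzero[OF p] by simp
  have "E 1 p (\<lambda>r. E 3 r (G 2 1 3)) = E 1 p (\<lambda>r. 2 * (G 2 1 3 r * G 2 2 3 r))"
    using p by (intro E_cong) (simp_all add: q_derivatives)
  also have "\<dots> = 2 * (G 2 1 3 p * E 1 p (G 2 2 3))"
    using p by (subst E_cmult) (simp_all add: E_mult smooth_near_mult reeb_q_zero)
  finally have "2 * (G 2 1 3 p * E 1 p (G 2 2 3)) = (\<Sum>m=1..3. (G 1 3 m p - G 3 1 m p) * E m p (G 2 1 3))"
    using commutator_frame[OF frame p, of 1 3 "G 2 1 3"] 1[of 3] p by simp
  then have "4 * (G 2 1 3 p * G 2 1 3 p * G 3 2 3 p) = 0"
    using p by (simp add: sum_1_3 G_simps eigen a_zero reeb_q_zero reeb_b q_derivatives algebra_simps)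
  then show "G 3 2 3 p = 0" using q_nonzero[OF p] by simp
qed

lemma dbc_zero: "p \<in> U \<Longrightarrow> i \<in> {1..3} \<Longrightarrow> E i p (G 2 2 3) = 0" "p \<in> U \<Longrightarrow> i \<in> {1..3} \<Longrightarrow> E i p (G 3 2 3) = 0"
  by (rule E_const[where k = 0]; simp add: bc_zero)+

lemma Ric_diagonal:
  assumes "p \<in> U"
  shows "Ric 2 2 p = - 2" "Ric 3 3 p = - 2"
  using assms by (simp_all add: Ric_frame sum_1_3 curvature_frame[OF frame] G_simps dG_simps dG_eigen eigen
      a_zero da_zero bc_zero dbc_zero)

text \<open>Here r = - 6 - 2 q^2 with q = \<open>G 2 1 3\<close> constant along \<xi>. In the Cotton
  component computed next, \<xi>(r) is the only derivative of r with a nonzero coefficient.\<close>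

lemma scalar_curvature_constant:
  assumes p: "p \<in> U"
  shows "E 1 p (scalar_curvature A g D) = 0"
proof -
  have "E 1 p (scalar_curvature A g D) = E 1 p (\<lambda>q. - 6 + (- 2) * (G 2 1 3 q * G 2 1 3 q))"
    using p by (intro E_cong) (simp_all add: scalar_curvature_frame[OF frame] sum_1_3 Ric_values Ric_diagonal algebra_simps)
  also have "\<dots> = E 1 p (\<lambda>_. - 6) + E 1 p (\<lambda>q. (- 2) * (G 2 1 3 q * G 2 1 3 q))"
    using p by (intro tangent_fun_add[OF E_tangent]) (auto intro!: smooth_near_mult smooth_near_minus)
  also have "E 1 p (\<lambda>_. - 6) = 0" using p by (intro tangent_const[OF E_tangent]) auto
  also have "E 1 p (\<lambda>q. (- 2) * (G 2 1 3 q * G 2 1 3 q)) = 0"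
    using p by (subst E_cmult) (simp_all add: E_mult smooth_near_mult reeb_q_zero)
  finally show ?thesis by simp
qed

text \<open>In the covariant derivative of S along e, evaluated on (\<xi>, e), the contribution 2 +
  2 q^2 of \<open>Ric 2 2\<close> and \<open>Ric 3 2\<close> cancels that of \<open>Ric 1 1\<close>,
  where q = \<open>G 2 1 3\<close>.\<close>

lemma cotton3_vanishes:
  assumes p: "p \<in> U"
  shows "cotton3 A g D (E 1) (E 2) (E 2) p = 0"
proof -
  have "E 1 p (Ric 2 2) = 0" using p by (intro E_const[where k = "-2"]) (simp_all add: Ric_diagonal)
  moreover have "E 2 p (Ric 1 2) = 0" using p by (intro E_const[where k = 0]) (simp_all add: ricci_reeb)
  ultimately show ?thesis
    using p by (simp add: cotton3_def ap2_def scalar_curvature_constant cov_ricci_frame[OF frame] sum_1_3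
        G_simps eigen a_zero bc_zero Ric_values Ric_diagonal ricci_reeb algebra_simps)
qed

end

section \<open>Cotton solitons\<close>

context almost_kenmotsu_3h_manifold
begin

lemma collinear_soliton_trivial:
  assumes eigen: "\<And>p. \<exists>\<mu>. ricci_op A g D \<xi> p = \<mu> *\<^sub>v \<xi> p"
    and \<alpha>: "smooth_fun A UNIV \<alpha>" and soliton: "cotton_soliton A \<phi> \<xi> g D (\<alpha> *\<^sub>F \<xi>) \<sigma>"
  shows "\<alpha> p\<^sub>0 = 0"
proof (rule ccontr)
  assume nz: "\<alpha> p\<^sub>0 \<noteq> 0"
  define W where "W = {p. \<alpha> p \<noteq> 0}"
  have W: "open W" "p\<^sub>0 \<in> W" unfolding W_def using smooth_fun_open_nonzero(1)[OF \<alpha>] nz by simp_all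
  have s\<alpha>: "smooth_near A p \<alpha>" for p using smooth_near_fun[OF \<alpha>] by simp
  have adapted: "adapted_frame_domain A g D \<phi> \<xi> \<eta> U e" if "transverse_unit U e" for U e
    using that eigen by unfold_locales
  \<comment> \<open>By \<open>h_coeffs\<close> these equations say that h e has no components along
    e and \<phi> e at \<open>p\<close>. Where they fail, an eigenframe exists on a
    neighbourhood.\<close>
  have h0: "connection_coeff (adapted_frame e) 2 1 2 p = 1 \<and> connection_coeff (adapted_frame e) 2 1 3 p = 0"
    if p: "p \<in> W" "p \<in> U" and e: "transverse_unit U e" for p U e
  proof (rule ccontr)
    assume "\<not> ?thesis"
    then obtain V e' where V: "p \<in> V" and e': "transverse_unit V e'"
      and 1: "\<And>r. r \<in> V \<Longrightarrow> connection_coeff (adapted_frame e') 2 1 2 r = 1"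
      and 2: "\<And>r. r \<in> V \<Longrightarrow> connection_coeff (adapted_frame e') 2 1 3 r \<noteq> 0"
      using adapted_frame_domain.eigenframe_exists[OF adapted[OF e] p(2)] by metis
    interpret N: adapted_frame_domain A g D \<phi> \<xi> \<eta> V e' by (rule adapted[OF e'])
    interpret N: non_kenmotsu_eigenframe A g D \<phi> \<xi> \<eta> V e'
      by unfold_locales (use 1 2 in auto)
    \<comment> \<open>The 2 arises because \<open>G 3 1 2\<close> equals
      \<open>G 2 1 3\<close>.\<close>
    have "\<alpha> p * (2 * connection_coeff (adapted_frame e') 2 1 3 p) = 0"
      using N.soliton_components[OF V _ _ s\<alpha> soliton, of 2 3] N.cotton2_components(3)[OF V]
        N.cotton3_vanishes[OF V] N.G_simps(7)[OF V] by simp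
    then show False using p(1) 2[OF V] unfolding W_def by simp
  qed
  have *: "2 * \<alpha> p = \<sigma> \<and> 2 * \<xi> p \<alpha> = \<sigma>" if p: "p \<in> W" for p
  proof -
    obtain U e where U: "p \<in> U" and e: "transverse_unit U e" by (rule adapted_frame_exists)
    \<comment> \<open>Shrinking to \<open>W\<close> makes h vanish on the whole frame domain, so the
      derivatives of \<open>G 2 1 3\<close> vanish as well.\<close>
    have "open (U \<inter> W)" using e W(1) vector_field_open unfolding transverse_unit_def by blast
    then have e: "transverse_unit (U \<inter> W) e" by (rule transverse_unit_subset[OF e]) simp
    have pU: "p \<in> U \<inter> W" using U p by simp
    interpret K: adapted_frame_domain A g D \<phi> \<xi> \<eta> "U \<inter> W" e by (rule adapted[OF e])
    interpret K: eigenframe_domain A g D \<phi> \<xi> \<eta> "U \<inter> W" e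
      by unfold_locales (use h0[OF _ _ e] in auto)
    have q0: "connection_coeff (adapted_frame e) 2 1 3 r = 0" if "r \<in> U \<inter> W" for r
      using h0[OF _ that e] that by simp
    note C = K.cotton2_components[OF pU] K.cotton3_kenmotsu[OF q0 pU]
    have "2 * \<xi> p \<alpha> = \<sigma>"
      using K.soliton_components[OF pU _ _ s\<alpha> soliton, of 1 1] C(1,4) K.G_simps(1)[OF pU, of 1 1]
      by (simp add: adapted_frame_simps)
    moreover have "2 * \<alpha> p + cotton2 A \<phi> \<xi> g D (adapted_frame e 2) (adapted_frame e 2) p = \<sigma>"
      "2 * \<alpha> p + cotton2 A \<phi> \<xi> g D (adapted_frame e 3) (adapted_frame e 3) p = \<sigma>"
      using K.soliton_components[OF pU _ _ s\<alpha> soliton, of 2 2] K.soliton_components[OF pU _ _ s\<alpha> soliton, of 3 3]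
        K.eigen[OF pU] K.G_simps(8)[OF pU] by simp_all
    ultimately show ?thesis using C(2,5) by linarith
  qed
  \<comment> \<open>\<alpha> is constant on the open set \<open>W\<close>, so \<xi>(\<alpha>) is 0
    at \<open>p\<^sub>0\<close>; the other equation then gives \<sigma> = 0.\<close>
  have "\<alpha> q = \<sigma> / 2" if "q \<in> W" for q using *[OF that] by simp
  then have "\<xi> p\<^sub>0 \<alpha> = \<xi> p\<^sub>0 (\<lambda>_. \<sigma> / 2)"
    by (rule tangent_cong[OF field_near_tangent[OF reeb_field] W])
  then have "\<xi> p\<^sub>0 \<alpha> = 0" using tangent_const[OF field_near_tangent[OF reeb_field]] by simp
  then show False using *[OF W(2)] nz by simp
qed

end

theorem theorem3p4:
  fixes A :: "'a::{t2_space, second_countable_topology} chart set"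
    and \<phi> :: "'a \<Rightarrow> 'a tvec \<Rightarrow> 'a tvec"
    and \<xi> :: "'a vfield"
    and \<eta> :: "'a \<Rightarrow> 'a tvec \<Rightarrow> real"
    and g :: "'a \<Rightarrow> 'a tvec \<Rightarrow> 'a tvec \<Rightarrow> real"
    and D :: "'a vfield \<Rightarrow> 'a vfield \<Rightarrow> 'a vfield"
  assumes "levi_civita A g D"
    and "almost_kenmotsu_3h A \<phi> \<xi> \<eta> g D"
    and "\<not> kenmotsu A \<phi> \<xi> \<eta> g"
    and "\<forall>p. \<exists>\<mu>::real. ricci_op A g D \<xi> p = \<mu> *\<^sub>v \<xi> p"
  shows "\<not> (\<exists>V \<sigma>. cotton_soliton A \<phi> \<xi> g D V \<sigma> \<and> pointwise_collinear A V \<xi> \<and> (\<exists>p. V p \<noteq> 0))"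
proof
  assume "\<exists>V \<sigma>. cotton_soliton A \<phi> \<xi> g D V \<sigma> \<and> pointwise_collinear A V \<xi> \<and> (\<exists>p. V p \<noteq> 0)"
  then obtain V \<sigma> \<alpha> p where soliton: "cotton_soliton A \<phi> \<xi> g D V \<sigma>"
    and \<alpha>: "smooth_fun A UNIV \<alpha>" "\<And>p. V p = \<alpha> p *\<^sub>v \<xi> p" and "V p \<noteq> 0"
    unfolding pointwise_collinear_def by blast
  then have nz: "\<alpha> p \<noteq> 0" by (auto simp: scale_vec_def zero_fun_def)
  have V: "V = \<alpha> *\<^sub>F \<xi>" using \<alpha>(2) by (simp add: scale_field_def fun_eq_iff)
  have "almost_contact_metric A \<phi> \<xi> \<eta> g"
    using assms(2) unfolding almost_kenmotsu_3h_def almost_kenmotsu_def by blast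
  then interpret almost_kenmotsu_3h_manifold A g D \<phi> \<xi> \<eta>
    using assms(1,2) by unfold_locales (auto simp: almost_contact_metric_def)
  show False
    using collinear_soliton_trivial[OF _ \<alpha>(1) soliton[unfolded V]] assms(4) nz by blast
qed

end
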